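(* Let $M$ be a smooth compact oriented manifold without boundary, $n\ge0$ and $\mu\in\mathbb{R}_{>0}$. The action of $\mathrm{RG}_\mu$ (by precomposition) on a $\mathrm{Cl}_n$-linear representation of $\mathsf{sP}_0(M)$ associated with a super connection $\mathbb{A}$ is precisely the Bismut–Quillen rescaling by $\mu$, $$\mathbb{A}\ \overset{\mathrm{RG}_\mu}{\longmapsto}\ \mu\mathbb{A}(0)+\mathbb{A}(1)+\mu^{-1}\mathbb{A}(2)+\cdots+\mu^{-j+1}\mathbb{A}(j)+\cdots,$$ where $\mathbb{A}(i)\colon\Omega^\bullet(M;V)\to\Omega^{\bullet+i}(M;V)$ is the degree $i$ piece of the super connection.
   Context: Conventions. All vector spaces and bundles are complex and $\mathbb{Z}/2$-graded ("super"). Maps of super manifolds are described on $S$-points. $\underline{\mathsf{SMfld}}(\mathbb{R}^{0|1},M)\cong\Pi TM$ represents $S\mapsto\{\text{maps }S\times\mathbb{R}^{0|1}\to M\}$; its functions are $\Omega^\bullet(M)=\Omega^\bullet(M;\mathbb{C})$, $S$-points are written $(x,\psi)$. $\mathsf{sP}_0(M)$ is the category object in super manifolds with objects $\underline{\mathsf{SMfld}}(\mathbb{R}^{0|1},M)$, morphisms $\mathbb{R}^{1|1}_{\ge0}\times\underline{\mathsf{SMfld}}(\mathbb{R}^{0|1},M)$, source the projection, target $(t,\theta,x,\psi)\mapsto(x+\theta\psi,\psi)$, unit $(0,0)$, composition from $(t,\theta)\cdot(t',\theta')=(t+t'+\theta\theta',\theta+\theta')$. A representation on a super vector bundle $V'$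 over the objects is a section of $\mathsf{Hom}(s^*V',t^*V')$ over morphisms compatible with units and composition. $\mathrm{Cl}_n$-linear representations are finite-dimensional unitary representations with a fiberwise self-adjoint action of the complex Clifford algebra $\mathrm{Cl}_n$ commuting with the representation. Each such representation is associated with a unitary $\mathrm{Cl}_n$-linear super connection $\mathbb{A}$ on a hermitian $\mathrm{Cl}_n$-module bundle $V\to M$: trivializing $V'$ along the odd fibers of $\Pi TM\to M$, sections of $V'$ are $\Omega^\bullet(M;V)$, and the representation is $\rho(t,\theta)=e^{-t\mathbb{A}^2+\theta\mathbb{A}}$. (A super connection is an odd operator on $\Omega^\bullet(M;V)$ with $\mathbb{A}(fs)=df\cdot s+(-1)^{|f|}f\mathbb{A}s$.) The functor $\mathrm{RG}_\mu\colon\mathsf{sP}_0(M)\to\mathsf{sP}_0(M)$ is $(x,\psi)\mapsto(x,\mu^{-1}\psi)$ on objects and $(t,\theta,x,\psi)\mapsto(\mu^2t,\mu\theta,x,\mu^{-1}\psi)$ on morphisms; it acts on representations by $\rho\mapsto\rho\circ\mathrm{RG}_\mu$. *)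

theory Defs
  imports "HOL-Analysis.Analysis" "HOL-Library.Function_Algebras"
begin

section \<open>Smooth manifolds\<close>

text \<open>
  Coordinates take values in \<open>Euclidean_space d\<close>, the set of \<open>x :: nat \<Rightarrow> real\<close> vanishing from index
  \<open>d\<close> on, so that the dimension is a number and \<open>d = 0\<close> is allowed.  Addition, zero and
  multiplication of functions are pointwise throughout.
\<close>

definition pderiv_at :: "nat \<Rightarrow> ((nat \<Rightarrow> real) \<Rightarrow> 'b::real_normed_vector) \<Rightarrow> (nat \<Rightarrow> real) \<Rightarrow> 'b" where
  "pderiv_at i f x = vector_derivative (\<lambda>h. f (x(i := x i + h))) (at 0)"

definition C_infinity :: "nat \<Rightarrow> (nat \<Rightarrow> real) set \<Rightarrow> ((nat \<Rightarrow> real) \<Rightarrow> 'b::real_normed_vector) \<Rightarrow> bool" where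
  "C_infinity d W f \<longleftrightarrow>
     (\<forall>is. set is \<subseteq> {..<d} \<longrightarrow>
        continuous_on W (foldr pderiv_at is f) \<and>
        (\<forall>x\<in>W. \<forall>i<d. (\<lambda>h. foldr pderiv_at is f (x(i := x i + h))) differentiable (at 0)))"

record 'm manifold =
  mdim :: nat
  charts :: "('m set \<times> ('m \<Rightarrow> nat \<Rightarrow> real)) set"

definition smooth_on :: "('m, 'z) manifold_scheme \<Rightarrow> 'm set \<Rightarrow> ('m \<Rightarrow> 'b::real_normed_vector) \<Rightarrow> bool" where
  "smooth_on M U f \<longleftrightarrow>
     (\<forall>(D, \<phi>)\<in>charts M. C_infinity (mdim M) (\<phi> ` (U \<inter> D)) (f \<circ> inv_into D \<phi>))"

definition smooth_manifold :: "('m::{t2_space,second_countable_topology}) manifold \<Rightarrow> bool" where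
  "smooth_manifold M \<longleftrightarrow>
     (\<forall>(D, \<phi>)\<in>charts M. open D \<and> openin (Euclidean_space (mdim M)) (\<phi> ` D) \<and>
        homeomorphism D (\<phi> ` D) \<phi> (inv_into D \<phi>)) \<and>
     (\<Union>(D, \<phi>)\<in>charts M. D) = UNIV \<and>
     (\<forall>(D, \<phi>)\<in>charts M. \<forall>i<mdim M. smooth_on M D (\<lambda>p. \<phi> p i))"

definition jacobian_det :: "nat \<Rightarrow> ((nat \<Rightarrow> real) \<Rightarrow> nat \<Rightarrow> real) \<Rightarrow> (nat \<Rightarrow> real) \<Rightarrow> real" where
  "jacobian_det d F x =
     (\<Sum>\<pi> | \<pi> permutes {..<d}. of_int (sign \<pi>) * (\<Prod>i<d. pderiv_at (\<pi> i) (\<lambda>y. F y i) x))"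

definition oriented_atlas :: "'m manifold \<Rightarrow> bool" where
  "oriented_atlas M \<longleftrightarrow>
     (\<forall>(D, \<phi>)\<in>charts M. \<forall>(D', \<phi>')\<in>charts M. \<forall>x\<in>\<phi> ` (D \<inter> D').
        jacobian_det (mdim M) (\<phi>' \<circ> inv_into D \<phi>) x > 0)"

text \<open>Joint smoothness of a function of \<open>t\<close> and \<open>p \<in> U\<close>; \<open>t\<close> is the last coordinate.\<close>

definition smooth_on_line_times ::
  "('m, 'z) manifold_scheme \<Rightarrow> 'm set \<Rightarrow> (real \<Rightarrow> 'm \<Rightarrow> 'b::real_normed_vector) \<Rightarrow> bool" where
  "smooth_on_line_times M U G \<longleftrightarrow>
     (\<forall>(D, \<phi>)\<in>charts M. let d = mdim M in
        C_infinity (Suc d) {y. y(d := 0) \<in> \<phi> ` (U \<inter> D)}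
          (\<lambda>y. G (y d) (inv_into D \<phi> (y(d := 0)))))"

section \<open>Vector fields, differential forms and the exterior derivative\<close>

type_synonym 'm vfield = "('m \<Rightarrow> real) \<Rightarrow> 'm \<Rightarrow> real"

text \<open>
  Vector fields are the derivations of the algebra of smooth real functions; they are set to
  zero on functions that are not smooth, so that each derivation is represented exactly once.
\<close>

definition vfields :: "'m manifold \<Rightarrow> 'm vfield set" where
  "vfields M = {X.
     (\<forall>f. smooth_on M UNIV f \<longrightarrow> smooth_on M UNIV (X f)) \<and>
     (\<forall>f g. smooth_on M UNIV f \<longrightarrow> smooth_on M UNIV g \<longrightarrow>
        X (f + g) = X f + X g \<and> X (f * g) = X f * g + f * X g) \<and>
     (\<forall>c f. smooth_on M UNIV f \<longrightarrow> X (\<lambda>p. c * f p) = (\<lambda>p. c * X f p)) \<and>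
     (\<forall>f. \<not> smooth_on M UNIV f \<longrightarrow> X f = 0)}"

definition vf_mult :: "('m \<Rightarrow> real) \<Rightarrow> 'm vfield \<Rightarrow> 'm vfield" where
  "vf_mult g X = (\<lambda>f. g * X f)"

definition lie_bracket :: "'m vfield \<Rightarrow> 'm vfield \<Rightarrow> 'm vfield" where
  "lie_bracket X Y = (\<lambda>f. X (Y f) - Y (X f))"

definition vf_complex :: "'m vfield \<Rightarrow> ('m \<Rightarrow> complex) \<Rightarrow> 'm \<Rightarrow> complex" where
  "vf_complex X f p = Complex (X (Re \<circ> f) p) (X (Im \<circ> f) p)"

text \<open>
  An inhomogeneous form is a function on lists of vector fields: its restriction to lists of
  length \<open>k\<close> is its component of degree \<open>k\<close>.
\<close>

type_synonym ('m, 'b) form = "'m vfield list \<Rightarrow> 'm \<Rightarrow> 'b"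

text \<open>
  \<open>\<Omega>\<^sup>\<bullet>(M; \<complex>)\<close>, the direct sum over \<open>k\<close> of the alternating maps of \<open>k\<close> vector fields
  to smooth functions that are multilinear over smooth real functions (extended by zero to lists
  containing something that is not a vector field).
\<close>

definition forms :: "'m manifold \<Rightarrow> ('m, complex) form set" where
  "forms M = {\<omega>.
     (\<forall>Xs. set Xs \<subseteq> vfields M \<longrightarrow> smooth_on M UNIV (\<omega> Xs)) \<and>
     (\<forall>Xs. \<not> set Xs \<subseteq> vfields M \<longrightarrow> \<omega> Xs = 0) \<and>
     (\<forall>Xs X Y Zs. set (Xs @ X # Y # Zs) \<subseteq> vfields M \<longrightarrow>
        \<omega> (Xs @ (X + Y) # Zs) = \<omega> (Xs @ X # Zs) + \<omega> (Xs @ Y # Zs)) \<and>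
     (\<forall>Xs g X Zs. set (Xs @ X # Zs) \<subseteq> vfields M \<longrightarrow> smooth_on M UNIV g \<longrightarrow>
        \<omega> (Xs @ vf_mult g X # Zs) = (\<lambda>p. of_real (g p) * \<omega> (Xs @ X # Zs) p)) \<and>
     (\<forall>Xs. \<not> distinct Xs \<longrightarrow> \<omega> Xs = 0) \<and>
     (\<exists>N. \<forall>Xs. length Xs > N \<longrightarrow> \<omega> Xs = 0)}"

definition ext_deriv :: "'m manifold \<Rightarrow> ('m, complex) form \<Rightarrow> ('m, complex) form" where
  "ext_deriv M \<omega> Xs p =
     (if set Xs \<subseteq> vfields M then
        (\<Sum>i<length Xs. (-1) ^ i * vf_complex (Xs ! i) (\<omega> (nths Xs (- {i}))) p) +
        (\<Sum>j<length Xs. \<Sum>i<j. (-1) ^ (i + j) *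
           \<omega> (lie_bracket (Xs ! i) (Xs ! j) # nths Xs (- {i, j})) p)
      else 0)"

definition parity :: "('m, complex) form \<Rightarrow> ('m, complex) form" where
  "parity \<omega> Xs p = (-1) ^ length Xs * \<omega> Xs p"

text \<open>Sign of the permutation listing first the elements of \<open>S\<close>, then those of \<open>{..<k} - S\<close>.\<close>

definition shuffle_sign :: "nat set \<Rightarrow> nat \<Rightarrow> complex" where
  "shuffle_sign S k = (-1) ^ card {(i, j). i < j \<and> j < k \<and> i \<notin> S \<and> j \<in> S}"

definition wedge :: "('m, complex) form \<Rightarrow> ('m, complex ^ 'k) form \<Rightarrow> ('m, complex ^ 'k) form" where
  "wedge \<omega> \<sigma> Xs p =
     (\<Sum>S\<in>Pow {..<length Xs}. (shuffle_sign S (length Xs) * \<omega> (nths Xs S) p) *s \<sigma> (nths Xs (- S)) p)"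

section \<open>Hermitian Clifford module bundles\<close>

text \<open>
  The fibers \<open>fib p\<close> are complex subspaces of one coordinate space, which serves only to have a
  common type for them: the smooth structure of the bundle is given by its local trivializations
  \<open>(U, r, \<Phi>)\<close>, where \<open>\<Phi> p\<close> identifies \<open>fib p\<close> with \<open>\<complex>\<^sup>r\<close>, and \<open>fib p\<close> need
  not be smooth in the coordinate space.  The \<open>\<int>/2\<close>-grading is given by the involution \<open>grade\<close> with
  eigenvalues \<open>1\<close> and \<open>-1\<close> on the even and odd part, and \<open>cliff i\<close> is the action of the
  \<open>i\<close>-th generator of the Clifford algebra.
\<close>

record ('m, 'k) cl_bundle =
  fib :: "'m \<Rightarrow> (complex ^ 'k) set"
  trivs :: "('m set \<times> nat \<times> ('m \<Rightarrow> complex ^ 'k \<Rightarrow> nat \<Rightarrow> complex)) set"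
  grade :: "'m \<Rightarrow> complex ^ 'k \<Rightarrow> complex ^ 'k"
  herm :: "'m \<Rightarrow> complex ^ 'k \<Rightarrow> complex ^ 'k \<Rightarrow> complex"
  cliff :: "nat \<Rightarrow> 'm \<Rightarrow> complex ^ 'k \<Rightarrow> complex ^ 'k"

definition vector_bundle :: "('m::topological_space) manifold \<Rightarrow> ('m, 'k::finite) cl_bundle \<Rightarrow> bool" where
  "vector_bundle M E \<longleftrightarrow>
     (\<forall>p. vec.subspace (fib E p)) \<and>
     (\<forall>(U, r, \<Phi>)\<in>trivs E. open U \<and>
        (\<forall>p\<in>U. bij_betw (\<Phi> p) (fib E p) {z. \<forall>i\<ge>r. z i = 0} \<and>
          (\<forall>a. \<forall>v\<in>fib E p. \<forall>w\<in>fib E p. \<Phi> p (a *s v + w) = (\<lambda>i. a * \<Phi> p v i + \<Phi> p w i)))) \<and>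
     (\<Union>(U, r, \<Phi>)\<in>trivs E. U) = UNIV \<and>
     (\<forall>(U, r, \<Phi>)\<in>trivs E. \<forall>(U', r', \<Phi>')\<in>trivs E. \<forall>j<r. \<forall>i<r'.
        smooth_on M (U \<inter> U')
          (\<lambda>p. \<Phi>' p (inv_into (fib E p) (\<Phi> p) (\<lambda>l. if l = j then 1 else 0)) i))"

definition sections :: "'m manifold \<Rightarrow> ('m, 'k) cl_bundle \<Rightarrow> ('m \<Rightarrow> complex ^ 'k) set" where
  "sections M E = {s. (\<forall>p. s p \<in> fib E p) \<and>
     (\<forall>(U, r, \<Phi>)\<in>trivs E. \<forall>i<r. smooth_on M U (\<lambda>p. \<Phi> p (s p) i))}"

definition bundle_endo ::
  "'m manifold \<Rightarrow> ('m, 'k::finite) cl_bundle \<Rightarrow> ('m \<Rightarrow> complex ^ 'k \<Rightarrow> complex ^ 'k) \<Rightarrow> bool" where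
  "bundle_endo M E L \<longleftrightarrow>
     (\<forall>p. \<forall>v\<in>fib E p. L p v \<in> fib E p \<and>
        (\<forall>a. \<forall>w\<in>fib E p. L p (a *s v + w) = a *s L p v + L p w)) \<and>
     (\<forall>s\<in>sections M E. (\<lambda>p. L p (s p)) \<in> sections M E)"

text \<open>
  Conventions: the metric is conjugate linear in the first argument, even and odd part are orthogonal,
  and the Clifford generators are odd and self-adjoint with square one.
\<close>

definition hermitian_cl_bundle ::
  "('m::topological_space) manifold \<Rightarrow> nat \<Rightarrow> ('m, 'k::finite) cl_bundle \<Rightarrow> bool" where
  "hermitian_cl_bundle M n E \<longleftrightarrow>
     vector_bundle M E \<and>
     bundle_endo M E (grade E) \<and>
     (\<forall>p. \<forall>v\<in>fib E p. grade E p (grade E p v) = v) \<and>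
     (\<forall>s\<in>sections M E. \<forall>t\<in>sections M E. smooth_on M UNIV (\<lambda>p. herm E p (s p) (t p))) \<and>
     (\<forall>p. \<forall>u\<in>fib E p. \<forall>v\<in>fib E p. \<forall>w\<in>fib E p. \<forall>a.
        herm E p u (a *s v + w) = a * herm E p u v + herm E p u w \<and>
        herm E p v u = cnj (herm E p u v) \<and>
        (u \<noteq> 0 \<longrightarrow> Re (herm E p u u) > 0) \<and>
        herm E p (grade E p u) (grade E p v) = herm E p u v) \<and>
     (\<forall>i<n. bundle_endo M E (cliff E i) \<and>
        (\<forall>p. \<forall>v\<in>fib E p. \<forall>w\<in>fib E p.
           grade E p (cliff E i p v) = - cliff E i p (grade E p v) \<and>
           herm E p (cliff E i p v) w = herm E p v (cliff E i p w))) \<and>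
     (\<forall>i<n. \<forall>j<n. \<forall>p. \<forall>v\<in>fib E p.
        cliff E i p (cliff E j p v) + cliff E j p (cliff E i p v) = (if i = j then 2 *s v else 0))"

text \<open>\<open>\<Omega>\<^sup>\<bullet>(M; V)\<close>, that is, the tensor product of \<open>\<Omega>\<^sup>\<bullet>(M; \<complex>)\<close> and the module of sections
  of \<open>V\<close> over the smooth functions.\<close>

definition bundle_forms :: "'m manifold \<Rightarrow> ('m, 'k::finite) cl_bundle \<Rightarrow> ('m, complex ^ 'k) form set" where
  "bundle_forms M E = {\<sigma>. \<exists>N \<alpha> s. (\<forall>j<N. \<alpha> j \<in> forms M \<and> s j \<in> sections M E) \<and>
     \<sigma> = (\<lambda>Xs p. \<Sum>j<(N::nat). \<alpha> j Xs p *s s j p)}"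

definition scale_form :: "complex \<Rightarrow> ('m, complex ^ 'k) form \<Rightarrow> ('m, complex ^ 'k) form" where
  "scale_form a \<sigma> = (\<lambda>Xs p. a *s \<sigma> Xs p)"

definition total_parity ::
  "('m, 'k) cl_bundle \<Rightarrow> ('m, complex ^ 'k) form \<Rightarrow> ('m, complex ^ 'k) form" where
  "total_parity E \<sigma> = (\<lambda>Xs p. (-1) ^ length Xs *s grade E p (\<sigma> Xs p))"

text \<open>The sign comes from moving the odd generator past the form part.\<close>

definition cliff_act ::
  "('m, 'k) cl_bundle \<Rightarrow> nat \<Rightarrow> ('m, complex ^ 'k) form \<Rightarrow> ('m, complex ^ 'k) form" where
  "cliff_act E i \<sigma> = (\<lambda>Xs p. (-1) ^ length Xs *s cliff E i p (\<sigma> Xs p))"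

text \<open>
  The extension of the metric to \<open>\<Omega>\<^sup>\<bullet>(M; V)\<close> with values in \<open>\<Omega>\<^sup>\<bullet>(M; \<complex>)\<close>: for forms
  \<open>\<alpha>, \<beta>\<close> and sections \<open>v, w\<close> it is \<open>(\<alpha> \<otimes> v)\<^sup>* (\<beta> \<otimes> w) = v\<^sup>* \<alpha>\<^sup>* \<beta> w\<close>, where \<open>*\<close> is conjugate
  linear, reverses the order of products without further sign, and \<open>(dx)\<^sup>* = - dx\<close>.
  Hence \<open>\<alpha>\<^sup>* = (-1)\<^bsup>a(a+1)/2\<^esup> cnj \<alpha>\<close> in degree \<open>a\<close>, and moving \<open>v\<^sup>*\<close> to the right past
  \<open>\<alpha>\<^sup>* \<beta>\<close>, of degree \<open>k\<close>, replaces \<open>v\<close> by \<open>grade\<^sup>k v\<close>.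
\<close>

definition form_pairing ::
  "('m, 'k) cl_bundle \<Rightarrow> ('m, complex ^ 'k) form \<Rightarrow> ('m, complex ^ 'k) form \<Rightarrow> ('m, complex) form" where
  "form_pairing E \<sigma> \<tau> Xs p =
     (let k = length Xs in
      \<Sum>S\<in>Pow {..<k}. shuffle_sign S k * (-1) ^ (card S * (card S + 1) div 2) *
        herm E p ((grade E p ^^ k) (\<sigma> (nths Xs S) p)) (\<tau> (nths Xs (- S)) p))"

section \<open>Super connections\<close>

type_synonym ('m, 'k) form_op = "('m, complex ^ 'k) form \<Rightarrow> ('m, complex ^ 'k) form"

definition super_connection ::
  "'m manifold \<Rightarrow> ('m, 'k::finite) cl_bundle \<Rightarrow> ('m, 'k) form_op \<Rightarrow> bool" where
  "super_connection M E A \<longleftrightarrow>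
     (\<forall>\<sigma>\<in>bundle_forms M E. A \<sigma> \<in> bundle_forms M E) \<and>
     (\<forall>a. \<forall>\<sigma>\<in>bundle_forms M E. \<forall>\<tau>\<in>bundle_forms M E.
        A (scale_form a \<sigma> + \<tau>) = scale_form a (A \<sigma>) + A \<tau>) \<and>
     (\<forall>\<sigma>\<in>bundle_forms M E. A (total_parity E \<sigma>) = - total_parity E (A \<sigma>)) \<and>
     (\<forall>f\<in>forms M. \<forall>\<sigma>\<in>bundle_forms M E.
        A (wedge f \<sigma>) = wedge (ext_deriv M f) \<sigma> + wedge (parity f) (A \<sigma>))"

text \<open>
  Unitarity says that \<open>A\<close> is formally self-adjoint.  On sections \<open>s, t\<close> of \<open>V\<close> it reads
  \<open>h(A(0)s, t) = h(s, A(0)t)\<close>, \<open>d h(s, t) = h(A(1)s, t) + h(s, A(1)t)\<close> and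
  \<open>h(A(k)s, t) = (-1)\<^bsup>k(k+1)/2\<^esup> h(s, A(k)t)\<close> for \<open>k \<ge> 2\<close>; so \<open>A(0)\<close> is self-adjoint and
  \<open>A(1)\<close> is a metric connection.
\<close>

definition unitary_super_connection ::
  "'m manifold \<Rightarrow> ('m, 'k::finite) cl_bundle \<Rightarrow> ('m, 'k) form_op \<Rightarrow> bool" where
  "unitary_super_connection M E A \<longleftrightarrow>
     super_connection M E A \<and>
     (\<forall>\<sigma>\<in>bundle_forms M E. \<forall>\<tau>\<in>bundle_forms M E.
        form_pairing E (A \<sigma>) \<tau> + ext_deriv M (form_pairing E (total_parity E \<sigma>) \<tau>)
          = form_pairing E \<sigma> (A \<tau>))"

text \<open>Commutation of the odd operators \<open>A\<close> and \<open>cliff_act E i\<close> is in the graded sense.\<close>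

definition unitary_cl_super_connection ::
  "'m manifold \<Rightarrow> nat \<Rightarrow> ('m, 'k::finite) cl_bundle \<Rightarrow> ('m, 'k) form_op \<Rightarrow> bool" where
  "unitary_cl_super_connection M n E A \<longleftrightarrow>
     unitary_super_connection M E A \<and>
     (\<forall>i<n. \<forall>\<sigma>\<in>bundle_forms M E. A (cliff_act E i \<sigma>) = - cliff_act E i (A \<sigma>))"

definition degree_part :: "nat \<Rightarrow> ('m, 'b::zero) form \<Rightarrow> ('m, 'b) form" where
  "degree_part k \<sigma> = (\<lambda>Xs. if length Xs = k then \<sigma> Xs else 0)"

text \<open>
  \<open>A(j)\<close>: its value in degree \<open>l \<ge> j\<close> is the degree \<open>l\<close> part of \<open>A\<close> applied to the
  part of degree \<open>l - j\<close> of the argument.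
\<close>

definition degree_piece :: "('m, 'k::finite) form_op \<Rightarrow> nat \<Rightarrow> ('m, 'k) form_op" where
  "degree_piece A j \<sigma> =
     (\<lambda>Xs. if j \<le> length Xs then A (degree_part (length Xs - j) \<sigma>) Xs else 0)"

text \<open>At each argument only the finitely many terms with \<open>j \<le> length Xs\<close> are nonzero.\<close>

definition bismut_quillen_rescaling :: "real \<Rightarrow> ('m, 'k::finite) form_op \<Rightarrow> ('m, 'k) form_op" where
  "bismut_quillen_rescaling \<mu> A \<sigma> =
     (\<lambda>Xs p. \<Sum>j. of_real (\<mu> powi (1 - int j)) *s degree_piece A j \<sigma> Xs p)"

section \<open>The super category of paths, its representations and the renormalization group action\<close>

text \<open>
  Super manifolds enter through their functions and maps through the pullback of functions
  and sections.
  \<^item> The objects \<open>\<Pi>TM\<close> have functions \<open>\<Omega>\<^sup>\<bullet>(M; \<complex>)\<close>; a form is the function of \<open>(x, \<psi>)\<close> that in degree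
    \<open>k\<close> inserts \<open>\<psi>\<close> in all \<open>k\<close> arguments.
  \<^item> \<open>V'\<close> is the pullback of \<open>V\<close> along \<open>\<Pi>TM \<rightarrow> M\<close>, with sections \<open>\<Omega>\<^sup>\<bullet>(M; V)\<close>.
  \<^item> Functions on the morphisms, and sections of the source pullback of \<open>V'\<close>, are expressions
    \<open>F\<^sub>0(t) + \<theta> F\<^sub>1(t)\<close> with \<open>F\<^sub>0, F\<^sub>1\<close> families of (bundle valued) forms depending smoothly on
    \<open>t \<ge> 0\<close>, up to the boundary.  They are encoded by \<open>\<lambda>t. (F\<^sub>0 t, F\<^sub>1 t)\<close>; values at \<open>t < 0\<close>
    are irrelevant.
\<close>

definition smooth_half_line_family ::
  "'m manifold \<Rightarrow> ('m, 'k::finite) cl_bundle \<Rightarrow> (real \<Rightarrow> ('m, complex ^ 'k) form) \<Rightarrow> bool" where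
  "smooth_half_line_family M E F \<longleftrightarrow>
     (\<forall>t\<ge>0. F t \<in> bundle_forms M E) \<and>
     (\<forall>Xs. set Xs \<subseteq> vfields M \<longrightarrow> (\<forall>(U, r, \<Phi>)\<in>trivs E. \<forall>i<r.
        \<exists>G. smooth_on_line_times M U G \<and> (\<forall>t\<ge>0. \<forall>p\<in>U. G t p = \<Phi> p (F t Xs p) i)))"

text \<open>The target map \<open>(t, \<theta>, x, \<psi>) \<mapsto> (x + \<theta>\<psi>, \<psi>)\<close> pulls \<open>f\<close> back to \<open>f + \<theta> df\<close>.\<close>

definition target_pullback ::
  "'m manifold \<Rightarrow> ('m, complex) form \<Rightarrow> ('m, complex) form \<times> ('m, complex) form" where
  "target_pullback M f = (f, ext_deriv M f)"

text \<open>\<open>(f + \<theta> g) (\<sigma>\<^sub>0 + \<theta> \<sigma>\<^sub>1)\<close>, multiplication by \<open>\<theta>\<close>, and the extension of an odd operator to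
  expressions in \<open>\<theta>\<close>, with which it anticommutes.  The same sign rule extends the parity involution,
  since \<open>\<theta>\<close> is odd.\<close>

fun theta_wedge ::
  "('m, complex) form \<times> ('m, complex) form \<Rightarrow> ('m, complex ^ 'k) form \<times> ('m, complex ^ 'k) form
    \<Rightarrow> ('m, complex ^ 'k) form \<times> ('m, complex ^ 'k) form" where
  "theta_wedge (f, g) (\<sigma>\<^sub>0, \<sigma>\<^sub>1) = (wedge f \<sigma>\<^sub>0, wedge g \<sigma>\<^sub>0 + wedge (parity f) \<sigma>\<^sub>1)"

fun theta_mult :: "'a \<times> 'a \<Rightarrow> ('a::zero) \<times> 'a" where
  "theta_mult (\<sigma>\<^sub>0, \<sigma>\<^sub>1) = (0, \<sigma>\<^sub>0)"

fun odd_extension :: "('a \<Rightarrow> 'b::uminus) \<Rightarrow> 'a \<times> 'a \<Rightarrow> 'b \<times> 'b" where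
  "odd_extension A (\<sigma>\<^sub>0, \<sigma>\<^sub>1) = (A \<sigma>\<^sub>0, - A \<sigma>\<^sub>1)"

text \<open>
  A section \<open>\<rho>\<close> of the bundle of homomorphisms over the morphisms is given by its values on
  pulled back sections, \<open>\<rho> \<sigma> t = (\<rho>\<^sub>0 t \<sigma>, \<rho>\<^sub>1 t \<sigma>)\<close>, which stands for
  \<open>\<rho>(t, \<theta>)\<sigma> = \<rho>\<^sub>0(t)\<sigma> + \<theta> \<rho>\<^sub>1(t)\<sigma>\<close>.  It takes the value of \<open>\<sigma>\<close> at the target of a
  morphism to the source; this is the variance for which \<open>e\<^bsup>-tA\<^sup>2+\<theta>A\<^esup>\<close> is linear over functions on the
  morphisms.
\<close>

type_synonym ('m, 'k) path_op =
  "('m, complex ^ 'k) form \<Rightarrow> real \<Rightarrow> ('m, complex ^ 'k) form \<times> ('m, complex ^ 'k) form"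

definition hom_section :: "'m manifold \<Rightarrow> ('m, 'k::finite) cl_bundle \<Rightarrow> ('m, 'k) path_op \<Rightarrow> bool" where
  "hom_section M E \<rho> \<longleftrightarrow>
     (\<forall>\<sigma>\<in>bundle_forms M E.
        smooth_half_line_family M E (\<lambda>t. fst (\<rho> \<sigma> t)) \<and> smooth_half_line_family M E (\<lambda>t. snd (\<rho> \<sigma> t)) \<and>
        (\<forall>t\<ge>0. \<rho> (total_parity E \<sigma>) t = odd_extension (total_parity E) (\<rho> \<sigma> t)) \<and>
        (\<forall>\<tau>\<in>bundle_forms M E. \<forall>t\<ge>0. \<rho> (\<sigma> + \<tau>) t = \<rho> \<sigma> t + \<rho> \<tau> t) \<and>
        (\<forall>f\<in>forms M. \<forall>t\<ge>0. \<rho> (wedge f \<sigma>) t = theta_wedge (target_pullback M f) (\<rho> \<sigma> t)))"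

text \<open>
  Compatibility with composition is an identity between functions of \<open>(t, \<theta>)\<close> and \<open>(t', \<theta>')\<close>:
  \<open>\<rho>(t, \<theta>) \<rho>(t', \<theta>') = \<rho>(t + t' + \<theta>\<theta>', \<theta> + \<theta>')\<close>.  The four functions below are the coefficients of
  \<open>1\<close>, \<open>\<theta>\<close>, \<open>\<theta>'\<close> and \<open>\<theta>\<theta>'\<close> on the left; the sign of the last one comes from moving \<open>\<theta>'\<close> past
  the odd operator \<open>\<rho>\<^sub>1(t)\<close>.  By Taylor expansion in \<open>\<theta>\<theta>'\<close>, the right hand side is
  \<open>\<rho>\<^sub>0(t+t') + (\<theta> + \<theta>') \<rho>\<^sub>1(t+t') + \<theta>\<theta>' \<rho>\<^sub>0'(t+t')\<close>.
\<close>

definition twofold :: "('m, 'k::finite) path_op \<Rightarrow> ('m, complex ^ 'k) form \<Rightarrow> real \<Rightarrow> real \<Rightarrow>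
    ('m, complex ^ 'k) form \<times> ('m, complex ^ 'k) form \<times> ('m, complex ^ 'k) form \<times> ('m, complex ^ 'k) form" where
  "twofold \<rho> \<sigma> t t' =
     (fst (\<rho> (fst (\<rho> \<sigma> t')) t), snd (\<rho> (fst (\<rho> \<sigma> t')) t),
      fst (\<rho> (snd (\<rho> \<sigma> t')) t), - snd (\<rho> (snd (\<rho> \<sigma> t')) t))"

definition representation :: "'m manifold \<Rightarrow> ('m, 'k::finite) cl_bundle \<Rightarrow> ('m, 'k) path_op \<Rightarrow> bool" where
  "representation M E \<rho> \<longleftrightarrow>
     hom_section M E \<rho> \<and>
     (\<forall>\<sigma>\<in>bundle_forms M E. fst (\<rho> \<sigma> 0) = \<sigma>) \<and>
     (\<forall>\<sigma>\<in>bundle_forms M E. \<forall>t\<ge>0. \<forall>t'\<ge>0. \<exists>D.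
        twofold \<rho> \<sigma> t t' = (fst (\<rho> \<sigma> (t + t')), snd (\<rho> \<sigma> (t + t')), snd (\<rho> \<sigma> (t + t')), D) \<and>
        (\<forall>Xs p. ((\<lambda>u. fst (\<rho> \<sigma> u) Xs p) has_vector_derivative D Xs p) (at (t + t') within {0..})))"

text \<open>
  Unitarity: \<open>\<rho>\<close> is adjoint to itself, that is, the target pullback
  \<open>f + \<theta> g \<mapsto> f + \<theta> (df + g)\<close> takes \<open>(\<rho>\<sigma>)\<^sup>* \<tau>\<close> to \<open>\<sigma>\<^sup>* (\<rho>\<tau>)\<close>, with the conventions of
  \<open>form_pairing\<close> and \<open>\<theta>\<^sup>* = - \<theta>\<close>; for \<open>e\<^bsup>-tA\<^sup>2+\<theta>A\<^esup>\<close> this is the unitarity of \<open>A\<close>.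
  The two equations are the coefficients of \<open>1\<close> and \<open>\<theta>\<close>.
\<close>

definition unitary_rep :: "'m manifold \<Rightarrow> ('m, 'k::finite) cl_bundle \<Rightarrow> ('m, 'k) path_op \<Rightarrow> bool" where
  "unitary_rep M E \<rho> \<longleftrightarrow>
     (\<forall>\<sigma>\<in>bundle_forms M E. \<forall>\<tau>\<in>bundle_forms M E. \<forall>t\<ge>0.
        form_pairing E (fst (\<rho> \<sigma> t)) \<tau> = form_pairing E \<sigma> (fst (\<rho> \<tau> t)) \<and>
        ext_deriv M (form_pairing E (fst (\<rho> \<sigma> t)) \<tau>) - form_pairing E (total_parity E (snd (\<rho> \<sigma> t))) \<tau>
          = form_pairing E (total_parity E \<sigma>) (snd (\<rho> \<tau> t)))"

definition cl_representation ::
  "'m manifold \<Rightarrow> nat \<Rightarrow> ('m, 'k::finite) cl_bundle \<Rightarrow> ('m, 'k) path_op \<Rightarrow> bool" where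
  "cl_representation M n E \<rho> \<longleftrightarrow>
     representation M E \<rho> \<and> unitary_rep M E \<rho> \<and>
     (\<forall>i<n. \<forall>\<sigma>\<in>bundle_forms M E. \<forall>t\<ge>0.
        \<rho> (cliff_act E i \<sigma>) t = odd_extension (cliff_act E i) (\<rho> \<sigma> t))"

text \<open>
  \<open>\<rho>(t, \<theta>) = e\<^bsup>-tA\<^sup>2+\<theta>A\<^esup>\<close>.  Evaluated at vector fields and a point, the exponential series is a
  series in a finite dimensional space, where convergence has its usual meaning.
\<close>

definition exponent :: "('m, 'k) form_op \<Rightarrow> real \<Rightarrow>
    ('m, complex ^ 'k::finite) form \<times> ('m, complex ^ 'k) form \<Rightarrow> ('m, complex ^ 'k) form \<times> ('m, complex ^ 'k) form" where
  "exponent A t x =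
     map_prod (scale_form (- of_real t)) (scale_form (- of_real t)) (odd_extension A (odd_extension A x)) +
     theta_mult (odd_extension A x)"

definition associated_rep ::
  "'m manifold \<Rightarrow> ('m, 'k::finite) cl_bundle \<Rightarrow> ('m, 'k) form_op \<Rightarrow> ('m, 'k) path_op \<Rightarrow> bool" where
  "associated_rep M E A \<rho> \<longleftrightarrow>
     (\<forall>\<sigma>\<in>bundle_forms M E. \<forall>t\<ge>0. \<forall>Xs p.
        (\<lambda>k. (1 / fact k) *\<^sub>R fst ((exponent A t ^^ k) (\<sigma>, 0)) Xs p) sums fst (\<rho> \<sigma> t) Xs p \<and>
        (\<lambda>k. (1 / fact k) *\<^sub>R snd ((exponent A t ^^ k) (\<sigma>, 0)) Xs p) sums snd (\<rho> \<sigma> t) Xs p)"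

text \<open>
  Pullback along \<open>(x, \<psi>) \<mapsto> (x, \<mu>\<^sup>-\<^sup>1\<psi>)\<close> of sections of \<open>V'\<close> substitutes \<open>\<mu>\<^sup>-\<^sup>1\<psi>\<close> for \<open>\<psi>\<close>;
  the map covers the identity of \<open>M\<close>, so the pullback of \<open>V'\<close> is again \<open>V'\<close>.
\<close>

definition RG_objects :: "real \<Rightarrow> ('m, 'b) form \<Rightarrow> ('m, 'b) form" where
  "RG_objects \<mu> \<sigma> = (\<lambda>Xs. \<sigma> (map (vf_mult (\<lambda>_. inverse \<mu>)) Xs))"

text \<open>Pullback of \<open>F\<^sub>0(t) + \<theta> F\<^sub>1(t)\<close> along \<open>(t, \<theta>, x, \<psi>) \<mapsto> (\<mu>\<^sup>2t, \<mu>\<theta>, x, \<mu>\<^sup>-\<^sup>1\<psi>)\<close>.\<close>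

definition RG_morphisms ::
  "real \<Rightarrow> (real \<Rightarrow> ('m, complex ^ 'k::finite) form \<times> ('m, complex ^ 'k) form) \<Rightarrow>
   real \<Rightarrow> ('m, complex ^ 'k) form \<times> ('m, complex ^ 'k) form" where
  "RG_morphisms \<mu> F = (\<lambda>t.
     (RG_objects \<mu> (fst (F (\<mu>\<^sup>2 * t))), scale_form (of_real \<mu>) (RG_objects \<mu> (snd (F (\<mu>\<^sup>2 * t))))))"

text \<open>
  Precomposition with the functor \<open>RG\<^sub>\<mu>\<close>: the pulled back section of the bundle of homomorphisms,
  which takes the pullback of \<open>\<sigma>\<close> to the pullback of \<open>\<rho> \<sigma>\<close>.
\<close>

definition RG_action :: "'m manifold \<Rightarrow> ('m, 'k::finite) cl_bundle \<Rightarrow> real \<Rightarrow> ('m, 'k) path_op \<Rightarrow> ('m, 'k) path_op" where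
  "RG_action M E \<mu> \<rho> = (\<lambda>\<sigma>. RG_morphisms \<mu> (\<rho> (inv_into (bundle_forms M E) (RG_objects \<mu>) \<sigma>)))"

end

theory Submission
  imports Defs
begin

text \<open>
  Let \<open>W\<close> multiply the degree \<open>k\<close> part of a form by \<open>\<mu>\<^sup>-\<^sup>k\<close>; this is the pullback along
  \<open>(x, \<psi>) \<mapsto> (x, \<mu>\<^sup>-\<^sup>1\<psi>)\<close>.  By the Leibniz rule a super connection \<open>A\<close> does not lower the degree,
  hence it is the sum of its pieces \<open>A(j)\<close>, and \<open>\<mu> W A W\<^sup>-\<^sup>1\<close> multiplies \<open>A(j)\<close> by \<open>\<mu>\<^sup>1\<^sup>-\<^sup>j\<close>: it is the
  Bismut-Quillen rescaling.  The renormalization group takes \<open>\<rho>(t, \<theta>)\<close> to \<open>W \<rho>(\<mu>\<^sup>2t, \<mu>\<theta>) W\<^sup>-\<^sup>1\<close>, and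
  conjugating \<open>e\<^bsup>-tA\<^sup>2+\<theta>A\<^esup>\<close> by \<open>W\<close> after this substitution of \<open>t\<close> and \<open>\<theta>\<close> replaces \<open>A\<close> by \<open>\<mu> W A W\<^sup>-\<^sup>1\<close>.
  All structure on forms is homogeneous in the degree, up to the factor \<open>\<mu>\<close> for the exterior
  derivative, and therefore carries over.
\<close>

section \<open>Smooth functions\<close>

text \<open>Conjugation is never handled with its inverse. The infinite sum defining the rescaled
  operator \<open>B\<close> is evaluated once, and afterwards \<open>B\<close> is known only through
  \<open>B W = \<mu> W A\<close>. As \<open>W\<close> is invertible, every form is some
  \<open>W \<sigma>\<close>, and each property of the new data at \<open>W \<sigma>\<close> is the
  old property at \<open>\<sigma>\<close> with a common factor. This factor is \<open>W\<close> for
  purely algebraic terms and \<open>\<mu> W\<close> for terms with one \<open>A\<close>, one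
  exterior derivative \<open>d\<close> or one coefficient of \<open>\<theta>\<close>. No identity
  mixes the two kinds, because \<open>d W = \<mu> W d\<close> holds just as for \<open>A\<close> and
  \<open>\<theta>\<close> becomes \<open>\<mu>\<theta>\<close>. Time has to be scaled by
  \<open>\<mu>^2\<close> because \<open>A^2\<close> and \<open>\<theta>\<theta>'\<close> are. The
  remaining work is to see that \<open>W\<close> and the wedge product stay inside the concrete
  encoding: smoothness, given by iterated partial derivatives, must be stable under sums, products
  and scaled coordinates, and a wedge product of forms must again be alternating.\<close>

text \<open>Where a function is not differentiable, \<open>pderiv_at\<close> has an arbitrary value; on a \<open>line_open\<close> set
  it depends only on the values of the function in this set.\<close>

definition line_open :: "nat \<Rightarrow> (nat \<Rightarrow> real) set \<Rightarrow> bool" where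
  "line_open d W \<longleftrightarrow> (\<forall>x\<in>W. \<forall>i<d. \<forall>\<^sub>F h in nhds 0. x(i := x i + h) \<in> W)"

lemma line_open_has_vector_derivative_cong:
  assumes "line_open d W" "x \<in> W" "i < d" "\<And>y. y \<in> W \<Longrightarrow> f y = g y"
    and "((\<lambda>h. g (x(i := x i + h))) has_vector_derivative D) (at 0)"
  shows "((\<lambda>h. f (x(i := x i + h))) has_vector_derivative D) (at 0)"
proof -
  have "\<forall>\<^sub>F h in nhds 0. x(i := x i + h) \<in> W"
    using assms by (auto simp: line_open_def)
  then have "\<forall>\<^sub>F h in nhds 0. f (x(i := x i + h)) = g (x(i := x i + h))"
    by eventually_elim (rule assms(4))
  then have "((\<lambda>h. f (x(i := x i + h))) has_vector_derivative D) (at 0)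
      = ((\<lambda>h. g (x(i := x i + h))) has_vector_derivative D) (at 0)"
    by (intro has_vector_derivative_cong_ev) (auto elim: eventually_mono dest: eventually_nhds_x_imp_x)
  then show ?thesis
    using assms(5) by simp
qed

text \<open>The iterated partial derivatives need not be computed: it suffices to exhibit a class
  \<open>F\<close> closed under differentiation along \<open>W\<close>. An iterated derivative
  agrees with a member of \<open>F\<close> on \<open>W\<close> only, and \<open>line_open\<close>
  makes agreement on \<open>W\<close> enough to differentiate once more.\<close>

lemma C_infinity_coinduct:
  assumes W: "line_open d W" and "f \<in> F"
    and cont: "\<And>f. f \<in> F \<Longrightarrow> continuous_on W f"
    and deriv: "\<And>f i. f \<in> F \<Longrightarrow> i < d \<Longrightarrow>
      \<exists>g\<in>F. \<forall>x\<in>W. ((\<lambda>h. f (x(i := x i + h))) has_vector_derivative g x) (at 0)"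
  shows "C_infinity d W f"
proof -
  have *: "\<exists>g\<in>F. \<forall>x\<in>W. foldr pderiv_at is f x = g x" if "set is \<subseteq> {..<d}" for "is"
    using that
  proof (induction "is")
    case Nil
    then show ?case using \<open>f \<in> F\<close> by auto
  next
    case (Cons i "is")
    then obtain g where g: "g \<in> F" "\<And>x. x \<in> W \<Longrightarrow> foldr pderiv_at is f x = g x"
      by auto
    obtain g' where g': "g' \<in> F"
      "\<And>x. x \<in> W \<Longrightarrow> ((\<lambda>h. g (x(i := x i + h))) has_vector_derivative g' x) (at 0)"
      using deriv[OF g(1), of i] Cons.prems by auto
    have "foldr pderiv_at (i # is) f x = g' x" if "x \<in> W" for x
      using line_open_has_vector_derivative_cong[OF W that _ g(2) g'(2)[OF that]] Cons.prems
      by (simp add: pderiv_at_def vector_derivative_at del: fun_upd_apply)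
    then show ?case using g'(1) by auto
  qed
  show ?thesis
    unfolding C_infinity_def
  proof (intro allI impI conjI ballI)
    fix "is" assume "set is \<subseteq> {..<d}"
    then obtain g where g: "g \<in> F" "\<And>x. x \<in> W \<Longrightarrow> foldr pderiv_at is f x = g x"
      using * by blast
    show "continuous_on W (foldr pderiv_at is f)"
      using cont[OF g(1)] g(2) by (simp cong: continuous_on_cong)
    fix x i assume "x \<in> W" "i < d"
    then obtain D where "((\<lambda>h. g (x(i := x i + h))) has_vector_derivative D) (at 0)"
      using deriv[OF g(1)] by blast
    then show "(\<lambda>h. foldr pderiv_at is f (x(i := x i + h))) differentiable at 0"
      using line_open_has_vector_derivative_cong[OF W \<open>x \<in> W\<close> \<open>i < d\<close> g(2)]
      by (meson differentiableI_vector)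
  qed
qed

lemma C_infinity_continuous: "C_infinity d W f \<Longrightarrow> continuous_on W f"
  unfolding C_infinity_def by (drule spec[of _ "[]"]) auto

lemma C_infinity_has_vector_derivative:
  assumes "C_infinity d W f" "x \<in> W" "i < d"
  shows "((\<lambda>h. f (x(i := x i + h))) has_vector_derivative pderiv_at i f x) (at 0)"
proof -
  have "(\<lambda>h. f (x(i := x i + h))) differentiable at 0"
    using assms(1)[unfolded C_infinity_def, rule_format, of "[]"] assms(2,3) by simp
  then show ?thesis
    by (simp add: pderiv_at_def vector_derivative_works del: fun_upd_apply)
qed

lemma C_infinity_pderiv_at:
  assumes "C_infinity d W f" "i < d"
  shows "C_infinity d W (pderiv_at i f)"
  unfolding C_infinity_def
proof (intro allI impI)
  fix "is" assume "set is \<subseteq> {..<d}"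
  \<comment> \<open>\<open>foldr\<close> applies the last entry first, so the derivative in
    direction \<open>i\<close> goes to the end of the list.\<close>
  with assms show "continuous_on W (foldr pderiv_at is (pderiv_at i f)) \<and>
      (\<forall>x\<in>W. \<forall>j<d. (\<lambda>h. foldr pderiv_at is (pderiv_at i f) (x(j := x j + h))) differentiable at 0)"
    using assms(1)[unfolded C_infinity_def, rule_format, of "is @ [i]"] by simp
qed

lemma C_infinity_const: "C_infinity d W (\<lambda>_. c)"
proof -
  have "\<exists>c'. foldr pderiv_at is (\<lambda>_. c) = (\<lambda>_. c')" for "is"
    by (induction "is") (auto simp: pderiv_at_def)
  then have "continuous_on W (foldr pderiv_at is (\<lambda>_. c)) \<and>
      (\<forall>x\<in>W. \<forall>i<d. (\<lambda>h. foldr pderiv_at is (\<lambda>_. c) (x(i := x i + h))) differentiable at 0)" for "is"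
  proof -
    obtain c' where "foldr pderiv_at is (\<lambda>_. c) = (\<lambda>_. c')"
      using \<open>\<And>is. \<exists>c'. foldr pderiv_at is (\<lambda>_. c) = (\<lambda>_. c')\<close> by blast
    then show ?thesis by simp
  qed
  then show ?thesis
    unfolding C_infinity_def by blast
qed

text \<open>The functions \<open>c f(a y)\<close> form a class closed under differentiation, since
  the chain rule only multiplies \<open>c\<close> by \<open>a i\<close>. With all
  \<open>a i = 1\<close> this gives real multiples; with a factor in the last coordinate only, it
  gives the rescaling of time in a family.\<close>

lemma C_infinity_scale_coordinates:
  fixes a :: "nat \<Rightarrow> real" and f :: "(nat \<Rightarrow> real) \<Rightarrow> 'b::real_normed_vector"
  assumes W: "line_open d W" and f: "C_infinity d W f"
    and S: "\<And>y. y \<in> W \<Longrightarrow> (\<lambda>i. a i * y i) \<in> W"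
  shows "C_infinity d W (\<lambda>y. c *\<^sub>R f (\<lambda>i. a i * y i))"
proof -
  define T :: "real \<Rightarrow> ((nat \<Rightarrow> real) \<Rightarrow> 'b) \<Rightarrow> (nat \<Rightarrow> real) \<Rightarrow> 'b" where
    "T c f = (\<lambda>y. c *\<^sub>R f (\<lambda>i. a i * y i))" for c f
  define F where "F = {T c f | c f. C_infinity d W f}"
  have "C_infinity d W (T c f)"
  proof (rule C_infinity_coinduct[OF W, of _ F])
    show "T c f \<in> F"
      using f by (auto simp: F_def)
  next
    fix g assume "g \<in> F"
    then obtain c f where f: "C_infinity d W f" and g: "g = T c f"
      by (auto simp: F_def)
    have S_cont: "continuous_on W (\<lambda>y i. a i * y i)"
      by (intro continuous_on_coordinatewise_then_product continuous_on_mult_left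
          continuous_on_subset[OF continuous_on_product_coordinates subset_UNIV])
    show "continuous_on W g"
      unfolding g T_def
      by (intro continuous_on_scaleR continuous_on_const
          continuous_on_compose2[OF C_infinity_continuous[OF f] S_cont] image_subsetI S)
    fix i assume "i < d"
    have "((\<lambda>h. g (x(i := x i + h))) has_vector_derivative
        T (c * a i) (pderiv_at i f) x) (at 0)" if "x \<in> W" for x
    proof -
      let ?y = "\<lambda>i. a i * x i"
      \<comment> \<open>The base point is written \<open>a i * 0\<close> because the chain rule
        takes the outer derivative at the image of 0 under multiplication by
        \<open>a i\<close>.\<close>
      have f': "((\<lambda>h. f (?y(i := ?y i + h))) has_vector_derivative pderiv_at i f ?y) (at (a i * 0))"
        using C_infinity_has_vector_derivative[OF f S[OF that] \<open>i < d\<close>]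
        by (simp only: mult_zero_right)
      have "((\<lambda>h. a i * h) has_vector_derivative a i) (at 0)"
        using bounded_linear.has_vector_derivative[OF bounded_linear_mult_right[of "a i"]
            has_vector_derivative_id] by simp
      from vector_diff_chain_at[OF this f']
      have "((\<lambda>h. f (?y(i := ?y i + a i * h))) has_vector_derivative a i *\<^sub>R pderiv_at i f ?y) (at 0)"
        by (simp only: o_def)
      from bounded_linear.has_vector_derivative[OF bounded_linear_scaleR_right this, of c]
      have "((\<lambda>h. c *\<^sub>R f (?y(i := ?y i + a i * h))) has_vector_derivative
          (c * a i) *\<^sub>R pderiv_at i f ?y) (at 0)"
        by (simp only: scaleR_scaleR)
      moreover have "?y(i := ?y i + a i * h) = (\<lambda>j. a j * (x(i := x i + h)) j)" for h
        by (rule ext) (simp add: distrib_left)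
      ultimately show ?thesis
        by (simp only: g T_def)
    qed
    then show "\<exists>g'\<in>F. \<forall>x\<in>W. ((\<lambda>h. g (x(i := x i + h))) has_vector_derivative g' x) (at 0)"
      using C_infinity_pderiv_at[OF f \<open>i < d\<close>] unfolding F_def by blast
  qed
  then show ?thesis
    by (simp only: T_def)
qed

text \<open>The derivative of a product is a sum of products, so the products alone are not visibly
  closed under differentiation. The algebra generated by the smooth functions is, and
  \<open>C_infinity_coinduct\<close> applies to it.\<close>

inductive_set smooth_algebra ::
  "nat \<Rightarrow> (nat \<Rightarrow> real) set \<Rightarrow> ((nat \<Rightarrow> real) \<Rightarrow> 'b::real_normed_algebra) set" for d W where
  base: "C_infinity d W f \<Longrightarrow> f \<in> smooth_algebra d W"
| add: "f \<in> smooth_algebra d W \<Longrightarrow> g \<in> smooth_algebra d W \<Longrightarrow> f + g \<in> smooth_algebra d W"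
| mult: "f \<in> smooth_algebra d W \<Longrightarrow> g \<in> smooth_algebra d W \<Longrightarrow> f * g \<in> smooth_algebra d W"

lemma smooth_algebra_C_infinity:
  assumes W: "line_open d W" and f: "f \<in> smooth_algebra d W"
  shows "C_infinity d W f"
proof (rule C_infinity_coinduct[OF W f])
  fix f :: "(nat \<Rightarrow> real) \<Rightarrow> 'a" assume f: "f \<in> smooth_algebra d W"
  then show "continuous_on W f"
  proof induction
    case (base f)
    then show ?case by (rule C_infinity_continuous)
  next
    case (add f g)
    then show ?case unfolding plus_fun_def by (intro continuous_on_add)
  next
    case (mult f g)
    then show ?case unfolding times_fun_def by (intro continuous_on_mult)
  qed
  fix i assume i: "i < d"
  show "\<exists>g\<in>smooth_algebra d W. \<forall>x\<in>W.
      ((\<lambda>h. f (x(i := x i + h))) has_vector_derivative g x) (at 0)"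
    using f
  proof induction
    case (base f)
    show ?case
      by (intro bexI[of _ "pderiv_at i f"] ballI smooth_algebra.base
          C_infinity_has_vector_derivative[OF base _ i] C_infinity_pderiv_at[OF base i])
  next
    case (add f g)
    then obtain f' g' where *: "f' \<in> smooth_algebra d W" "g' \<in> smooth_algebra d W"
      and d: "\<And>x. x \<in> W \<Longrightarrow> ((\<lambda>h. f (x(i := x i + h))) has_vector_derivative f' x) (at 0)"
        "\<And>x. x \<in> W \<Longrightarrow> ((\<lambda>h. g (x(i := x i + h))) has_vector_derivative g' x) (at 0)"
      by blast
    have "((\<lambda>h. (f + g) (x(i := x i + h))) has_vector_derivative (f' + g') x) (at 0)" if "x \<in> W" for x
      using has_vector_derivative_add[OF d[OF that]] by (simp only: plus_fun_def)
    with smooth_algebra.add[OF *] show ?case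
      by (intro bexI[of _ "f' + g'"] ballI)
  next
    case (mult f g)
    then obtain f' g' where *: "f' \<in> smooth_algebra d W" "g' \<in> smooth_algebra d W"
      and d: "\<And>x. x \<in> W \<Longrightarrow> ((\<lambda>h. f (x(i := x i + h))) has_vector_derivative f' x) (at 0)"
        "\<And>x. x \<in> W \<Longrightarrow> ((\<lambda>h. g (x(i := x i + h))) has_vector_derivative g' x) (at 0)"
      by blast
    have "((\<lambda>h. (f * g) (x(i := x i + h))) has_vector_derivative (f * g' + f' * g) x) (at 0)" if "x \<in> W" for x
      using has_vector_derivative_mult[OF d[OF that]]
      by (simp only: plus_fun_def times_fun_def add_0_right fun_upd_triv)
    moreover have "f * g' + f' * g \<in> smooth_algebra d W"
      by (intro smooth_algebra.add smooth_algebra.mult * mult.hyps)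
    ultimately show ?case
      by (intro bexI[of _ "f * g' + f' * g"] ballI)
  qed
qed

text \<open>A chart image is open only relative to the subspace
  \<open>Euclidean_space (mdim M)\<close> of the product topology. Moving a coordinate below the
  dimension stays in this subspace, so the point remains in the image for small \<open>h\<close>. In
  the second claim the extra last coordinate is time: moving it does not change
  \<open>y(mdim M := 0)\<close>, and moving any other coordinate reduces to the first claim.\<close>

lemma chart_domain_line_open:
  assumes M: "smooth_manifold M" and "(D, \<phi>) \<in> charts M" "open U"
  shows "line_open (mdim M) (\<phi> ` (U \<inter> D))"
    and "line_open (Suc (mdim M)) {y. y(mdim M := 0) \<in> \<phi> ` (U \<inter> D)}"
proof -
  let ?d = "mdim M" and ?W = "\<phi> ` (U \<inter> D)"
  have D: "open D" "openin (Euclidean_space ?d) (\<phi> ` D)" "homeomorphism D (\<phi> ` D) \<phi> (inv_into D \<phi>)"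
    using bspec[OF conjunct1[OF M[unfolded smooth_manifold_def]] assms(2)] by simp_all
  have "openin (top_of_set D) (U \<inter> D)"
    using \<open>open U\<close> by (auto simp: Int_commute openin_open_Int)
  then have "openin (top_of_set (\<phi> ` D)) ?W"
    by (rule homeomorphism_imp_open_map[OF D(3)])
  then obtain T where T: "open T" "?W = \<phi> ` D \<inter> T"
    by (auto simp: openin_open)
  have "openin (top_of_set {x. \<forall>i\<ge>?d. x i = 0}) (\<phi> ` D)"
    using D(2) by (simp add: Euclidean_space_def euclidean_product_topology)
  then obtain T' where T': "open T'" "\<phi> ` D = {x. \<forall>i\<ge>?d. x i = 0} \<inter> T'"
    by (auto simp: openin_open)
  have W: "?W = {x. \<forall>i\<ge>?d. x i = 0} \<inter> (T' \<inter> T)"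
    using T T' by auto
  show L: "line_open ?d ?W"
    unfolding line_open_def
  proof (intro ballI allI impI)
    fix x i assume x: "x \<in> ?W" "i < ?d"
    have "continuous_on UNIV (\<lambda>h. x(i := x i + h))"
    proof (rule continuous_on_coordinatewise_then_product)
      show "continuous_on UNIV (\<lambda>h. (x(i := x i + h)) j)" for j
        by (cases "j = i") (simp_all add: continuous_on_add)
    qed
    then have "open ((\<lambda>h. x(i := x i + h)) -` (T' \<inter> T))"
      by (intro open_vimage open_Int T T')
    moreover have "0 \<in> (\<lambda>h. x(i := x i + h)) -` (T' \<inter> T)"
      using x(1) unfolding W by simp
    ultimately have "\<forall>\<^sub>F h in nhds 0. h \<in> (\<lambda>h. x(i := x i + h)) -` (T' \<inter> T)"
      by (rule eventually_nhds_in_open)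
    then show "\<forall>\<^sub>F h in nhds 0. x(i := x i + h) \<in> ?W"
    proof eventually_elim
      case (elim h)
      then show ?case
        using x(2) x(1)[unfolded W] unfolding W by simp
    qed
  qed
  show "line_open (Suc ?d) {y. y(?d := 0) \<in> ?W}"
    unfolding line_open_def
  proof (intro ballI allI impI)
    fix x i assume x: "x \<in> {y. y(?d := 0) \<in> ?W}" "i < Suc ?d"
    show "\<forall>\<^sub>F h in nhds 0. x(i := x i + h) \<in> {y. y(?d := 0) \<in> ?W}"
    proof (cases "i = ?d")
      case False
      then have "\<forall>\<^sub>F h in nhds 0. (x(?d := 0))(i := (x(?d := 0)) i + h) \<in> ?W"
        using L[unfolded line_open_def, rule_format, of "x(?d := 0)" i] x by simp
      moreover have "(x(?d := 0))(i := (x(?d := 0)) i + h) = (x(i := x i + h))(?d := 0)" for h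
        using False by (intro ext) simp
      ultimately show ?thesis
        by simp
    qed (use x in simp)
  qed
qed

section \<open>Closure properties of smooth functions on manifolds\<close>

lemma smooth_on_const: "smooth_on M U (\<lambda>_. c)"
  by (auto simp: smooth_on_def o_def C_infinity_const)

lemma smooth_on_scaleR:
  assumes "smooth_manifold M" "open U" "smooth_on M U f"
  shows "smooth_on M U (\<lambda>p. c *\<^sub>R f p)"
  unfolding smooth_on_def
proof clarify
  fix D \<phi> assume "(D, \<phi>) \<in> charts M"
  then have "C_infinity (mdim M) (\<phi> ` (U \<inter> D)) (f \<circ> inv_into D \<phi>)"
    and "line_open (mdim M) (\<phi> ` (U \<inter> D))"
    using assms chart_domain_line_open(1) by (auto simp: smooth_on_def)
  from C_infinity_scale_coordinates[OF this(2,1), of "\<lambda>_. 1" c]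
  show "C_infinity (mdim M) (\<phi> ` (U \<inter> D)) ((\<lambda>p. c *\<^sub>R f p) \<circ> inv_into D \<phi>)"
    by (simp add: o_def)
qed

lemma smooth_on_add_mult:
  fixes f g :: "'m::{t2_space,second_countable_topology} \<Rightarrow> 'b::real_normed_algebra"
  assumes "smooth_manifold M" "open U" "smooth_on M U f" "smooth_on M U g"
  shows smooth_on_add: "smooth_on M U (\<lambda>p. f p + g p)"
    and smooth_on_mult: "smooth_on M U (\<lambda>p. f p * g p)"
proof -
  have "C_infinity (mdim M) (\<phi> ` (U \<inter> D)) ((\<lambda>p. f p + g p) \<circ> inv_into D \<phi>) \<and>
      C_infinity (mdim M) (\<phi> ` (U \<inter> D)) ((\<lambda>p. f p * g p) \<circ> inv_into D \<phi>)"
    if "(D, \<phi>) \<in> charts M" for D \<phi>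
  proof -
    have fg: "f \<circ> inv_into D \<phi> \<in> smooth_algebra (mdim M) (\<phi> ` (U \<inter> D))"
      "g \<circ> inv_into D \<phi> \<in> smooth_algebra (mdim M) (\<phi> ` (U \<inter> D))"
      using that assms by (auto simp: smooth_on_def intro: smooth_algebra.base)
    note * = smooth_algebra_C_infinity[OF chart_domain_line_open(1)[OF assms(1) that assms(2)]]
    show ?thesis
      using *[OF smooth_algebra.add[OF fg]] *[OF smooth_algebra.mult[OF fg]]
      by (simp add: o_def plus_fun_def times_fun_def)
  qed
  then show "smooth_on M U (\<lambda>p. f p + g p)" "smooth_on M U (\<lambda>p. f p * g p)"
    by (auto simp: smooth_on_def)
qed

lemma smooth_on_sum:
  fixes f :: "'i \<Rightarrow> 'm::{t2_space,second_countable_topology} \<Rightarrow> 'b::real_normed_algebra"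
  assumes "smooth_manifold M" "open U" "\<And>i. i \<in> I \<Longrightarrow> smooth_on M U (f i)"
  shows "smooth_on M U (\<lambda>p. \<Sum>i\<in>I. f i p)"
  using assms(3)
  by (induction I rule: infinite_finite_induct) (auto intro: smooth_on_const smooth_on_add assms(1,2))

lemma smooth_on_line_times_scale:
  assumes "smooth_manifold M" "open U" "smooth_on_line_times M U G"
  shows "smooth_on_line_times M U (\<lambda>t p. c *\<^sub>R G (m * t) p)"
  unfolding smooth_on_line_times_def Let_def
proof clarify
  fix D \<phi> assume D: "(D, \<phi>) \<in> charts M"
  let ?d = "mdim M"
  let ?W = "{y. y(?d := 0) \<in> \<phi> ` (U \<inter> D)}"
  \<comment> \<open>Time is the last coordinate, so only that one is multiplied by \<open>m\<close>;
    the chart coordinates, and hence the domain, do not change.\<close>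
  let ?a = "\<lambda>i. if i = ?d then m else 1"
  have eq: "(\<lambda>i. ?a i * y i)(?d := 0) = y(?d := 0)" for y :: "nat \<Rightarrow> real"
    by auto
  have "C_infinity (Suc ?d) ?W (\<lambda>y. G (y ?d) (inv_into D \<phi> (y(?d := 0))))"
    using assms(3) D by (auto simp: smooth_on_line_times_def Let_def)
  from C_infinity_scale_coordinates[OF chart_domain_line_open(2)[OF assms(1) D assms(2)] this, of ?a c]
  show "C_infinity (Suc ?d) ?W (\<lambda>y. c *\<^sub>R G (m * y ?d) (inv_into D \<phi> (y(?d := 0))))"
    unfolding mem_Collect_eq eq by simp
qed

section \<open>Differential forms\<close>

lemma vfieldsD:
  assumes "X \<in> vfields M"
  shows vfields_smooth: "smooth_on M UNIV f \<Longrightarrow> smooth_on M UNIV (X f)"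
    and vfields_plus: "smooth_on M UNIV f \<Longrightarrow> smooth_on M UNIV g \<Longrightarrow> X (f + g) = X f + X g"
    and vfields_times: "smooth_on M UNIV f \<Longrightarrow> smooth_on M UNIV g \<Longrightarrow> X (f * g) = X f * g + f * X g"
    and vfields_scale_smooth: "smooth_on M UNIV f \<Longrightarrow> X (\<lambda>p. c * f p) = (\<lambda>p. c * X f p)"
    and vfields_not_smooth: "\<not> smooth_on M UNIV f \<Longrightarrow> X f = 0"
proof -
  note X = assms[unfolded vfields_def mem_Collect_eq]
  show "smooth_on M UNIV f \<Longrightarrow> smooth_on M UNIV (X f)"
    by (rule X[THEN conjunct1, rule_format])
  note X = X[THEN conjunct2]
  show "smooth_on M UNIV f \<Longrightarrow> smooth_on M UNIV g \<Longrightarrow> X (f + g) = X f + X g"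
    by (rule X[THEN conjunct1, rule_format, THEN conjunct1])
  show "smooth_on M UNIV f \<Longrightarrow> smooth_on M UNIV g \<Longrightarrow> X (f * g) = X f * g + f * X g"
    by (rule X[THEN conjunct1, rule_format, THEN conjunct2])
  note X = X[THEN conjunct2]
  show "smooth_on M UNIV f \<Longrightarrow> X (\<lambda>p. c * f p) = (\<lambda>p. c * X f p)"
    by (rule X[THEN conjunct1, rule_format])
  show "\<not> smooth_on M UNIV f \<Longrightarrow> X f = 0"
    by (rule X[THEN conjunct2, rule_format])
qed

text \<open>The convention that \<open>X\<close> vanishes on functions that are not smooth extends
  homogeneity to them, because a nonzero multiple of such a function is again not smooth. As a
  result \<open>ext_deriv\<close> is homogeneous on arbitrary functions of vector field lists, and
  later this applies to values of \<open>form_pairing\<close> without a proof that they are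
  forms.\<close>

lemma vfields_scale:
  assumes M: "smooth_manifold M" and X: "X \<in> vfields M"
  shows "X (\<lambda>p. c * f p) = (\<lambda>p. c * X f p)"
proof (cases "smooth_on M UNIV f")
  case True
  then show ?thesis
    by (rule vfields_scale_smooth[OF X])
next
  case f: False
  show ?thesis
  proof (cases "c = 0")
    case True
    \<comment> \<open>Homogeneity with the factor 0 yields that \<open>X\<close> maps the zero
      function to zero.\<close>
    have "X (\<lambda>p. 0 * (0::real)) = (\<lambda>p. 0 * X (\<lambda>p. 0) p)"
      by (rule vfields_scale_smooth[OF X smooth_on_const])
    then show ?thesis
      using True by simp
  next
    case False
    have "\<not> smooth_on M UNIV (\<lambda>p. c * f p)"
      using smooth_on_scaleR[OF M open_UNIV, of "\<lambda>p. c * f p" "inverse c"] f False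
      by (auto simp: mult.assoc[symmetric])
    then show ?thesis
      using vfields_not_smooth[OF X] f by (auto simp: zero_fun_def)
  qed
qed

text \<open>Needed for the polarization in \<open>alternating_if_adjacent\<close>, where the sum of
  two arguments is repeated as an argument.\<close>

lemma vfields_add:
  fixes M :: "'m::{t2_space,second_countable_topology} manifold"
  assumes M: "smooth_manifold M" and X: "X \<in> vfields M" and Y: "Y \<in> vfields M"
  shows "X + Y \<in> vfields M"
  unfolding vfields_def mem_Collect_eq
proof (intro conjI allI impI)
  show "smooth_on M UNIV ((X + Y) f)" if "smooth_on M UNIV f" for f
    using smooth_on_add[OF M open_UNIV vfields_smooth[OF X that] vfields_smooth[OF Y that]]
    by (simp add: plus_fun_def)
  fix f g :: "'m \<Rightarrow> real" assume fg: "smooth_on M UNIV f" "smooth_on M UNIV g"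
  have "X (f + g) = X f + X g" "X (f * g) = X f * g + f * X g"
    by (rule vfields_plus[OF X fg], rule vfields_times[OF X fg])
  moreover have "Y (f + g) = Y f + Y g" "Y (f * g) = Y f * g + f * Y g"
    by (rule vfields_plus[OF Y fg], rule vfields_times[OF Y fg])
  ultimately show "(X + Y) (f + g) = (X + Y) f + (X + Y) g"
    and "(X + Y) (f * g) = (X + Y) f * g + f * (X + Y) g"
    by (simp_all add: plus_fun_apply algebra_simps)
next
  show "(X + Y) (\<lambda>p. c * f p) = (\<lambda>p. c * (X + Y) f p)" for c f
    unfolding plus_fun_def vfields_scale[OF M X, of c f] vfields_scale[OF M Y, of c f]
    by (simp add: distrib_left)
  show "(X + Y) f = 0" if "\<not> smooth_on M UNIV f" for f
    using vfields_not_smooth[OF X that] vfields_not_smooth[OF Y that] by (simp add: plus_fun_apply)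
qed

lemma vf_mult_const_vfields:
  fixes M :: "'m::{t2_space,second_countable_topology} manifold"
  assumes M: "smooth_manifold M" and X: "X \<in> vfields M"
  shows "vf_mult (\<lambda>_. c) X \<in> vfields M"
  unfolding vfields_def mem_Collect_eq
proof (intro conjI allI impI)
  show "smooth_on M UNIV (vf_mult (\<lambda>_. c) X f)" if "smooth_on M UNIV f" for f
    using smooth_on_mult[OF M open_UNIV smooth_on_const[of _ _ c] vfields_smooth[OF X that]]
    by (simp add: vf_mult_def times_fun_def)
  fix f g :: "'m \<Rightarrow> real" assume fg: "smooth_on M UNIV f" "smooth_on M UNIV g"
  have "X (f + g) = X f + X g" "X (f * g) = X f * g + f * X g"
    by (rule vfields_plus[OF X fg], rule vfields_times[OF X fg])
  then show "vf_mult (\<lambda>_. c) X (f + g) = vf_mult (\<lambda>_. c) X f + vf_mult (\<lambda>_. c) X g"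
    and "vf_mult (\<lambda>_. c) X (f * g) = vf_mult (\<lambda>_. c) X f * g + f * vf_mult (\<lambda>_. c) X g"
    by (simp_all add: vf_mult_def algebra_simps)
next
  show "vf_mult (\<lambda>_. c) X (\<lambda>p. c' * f p) = (\<lambda>p. c' * vf_mult (\<lambda>_. c) X f p)" for c' f
    unfolding vf_mult_def times_fun_def vfields_scale[OF M X, of c' f] by (simp add: mult.left_commute)
  show "vf_mult (\<lambda>_. c) X f = 0" if "\<not> smooth_on M UNIV f" for f
    using vfields_not_smooth[OF X that] by (simp add: vf_mult_def)
qed

text \<open>Forms vanish by convention on lists containing something that is not a vector field; the
  equivalence ensures that substituting a multiple of \<open>X\<close> for \<open>X\<close> respects
  this convention.\<close>

lemma vf_mult_const_vfields_iff:
  assumes M: "smooth_manifold M" and c: "c \<noteq> 0"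
  shows "vf_mult (\<lambda>_. c) X \<in> vfields M \<longleftrightarrow> X \<in> vfields M"
proof
  assume "vf_mult (\<lambda>_. c) X \<in> vfields M"
  from vf_mult_const_vfields[OF M this, of "inverse c"] show "X \<in> vfields M"
    using c by (simp add: vf_mult_def times_fun_def mult.assoc[symmetric])
qed (rule vf_mult_const_vfields[OF M])

text \<open>With an arbitrary function \<open>w\<close> of the degree this covers the pullback on
  objects, the parity sign, the projection to one degree and real scalars, so one homogeneity lemma
  per structure serves them all.\<close>

definition weight :: "(nat \<Rightarrow> real) \<Rightarrow> ('m, 'b::real_vector) form \<Rightarrow> ('m, 'b) form" where
  "weight w \<sigma> = (\<lambda>Xs p. w (length Xs) *\<^sub>R \<sigma> Xs p)"

lemma weight_weight: "weight u (weight v \<sigma>) = weight (\<lambda>k. u k * v k) \<sigma>"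
  by (simp add: weight_def)

lemma weight_one [simp]: "weight (\<lambda>_. 1) \<sigma> = \<sigma>"
  by (simp add: weight_def)

lemma weight_add: "weight w (\<sigma> + \<tau>) = weight w \<sigma> + weight w \<tau>"
  by (simp add: weight_def plus_fun_def scaleR_add_right)

lemma weight_diff: "weight w (\<sigma> - \<tau>) = weight w \<sigma> - weight w \<tau>"
  by (simp add: weight_def fun_diff_def scaleR_diff_right)

lemma weight_minus: "weight w (- \<sigma>) = - weight w \<sigma>"
  by (simp add: weight_def fun_Compl_def)

lemma of_real_scale_vec: "of_real c *s v = c *\<^sub>R (v :: complex ^ 'k)"
  unfolding vec_eq_iff vector_smult_component vector_scaleR_component
  by (simp add: scaleR_conv_of_real)

lemma scale_form_of_real: "scale_form (of_real c) = weight (\<lambda>_. c)"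
  by (simp add: fun_eq_iff scale_form_def weight_def of_real_scale_vec)

lemma degree_part_eq_weight: "degree_part k \<sigma> = weight (\<lambda>l. if l = k then 1 else 0) \<sigma>"
  by (auto simp: degree_part_def weight_def fun_eq_iff)

lemma parity_eq_weight: "parity = weight (\<lambda>k. (-1) ^ k)"
  by (simp add: fun_eq_iff parity_def weight_def scaleR_conv_of_real)

lemma formsD:
  assumes "\<omega> \<in> forms M"
  shows forms_smooth: "set Xs \<subseteq> vfields M \<Longrightarrow> smooth_on M UNIV (\<omega> Xs)"
    and forms_outside: "\<not> set Xs \<subseteq> vfields M \<Longrightarrow> \<omega> Xs = 0"
    and forms_add: "set (Xs @ X # Y # Zs) \<subseteq> vfields M \<Longrightarrow>
        \<omega> (Xs @ (X + Y) # Zs) = \<omega> (Xs @ X # Zs) + \<omega> (Xs @ Y # Zs)"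
    and forms_vf_mult: "set (Xs @ X # Zs) \<subseteq> vfields M \<Longrightarrow> smooth_on M UNIV g \<Longrightarrow>
        \<omega> (Xs @ vf_mult g X # Zs) = (\<lambda>p. of_real (g p) * \<omega> (Xs @ X # Zs) p)"
    and forms_not_distinct: "\<not> distinct Xs \<Longrightarrow> \<omega> Xs = 0"
    and forms_bounded_degree: "\<exists>N. \<forall>Xs. length Xs > N \<longrightarrow> \<omega> Xs = 0"
proof -
  note \<omega> = assms[unfolded forms_def mem_Collect_eq]
  show "set Xs \<subseteq> vfields M \<Longrightarrow> smooth_on M UNIV (\<omega> Xs)"
    by (rule \<omega>[THEN conjunct1, rule_format])
  note \<omega> = \<omega>[THEN conjunct2]
  show "\<not> set Xs \<subseteq> vfields M \<Longrightarrow> \<omega> Xs = 0"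
    by (rule \<omega>[THEN conjunct1, rule_format])
  note \<omega> = \<omega>[THEN conjunct2]
  show "set (Xs @ X # Y # Zs) \<subseteq> vfields M \<Longrightarrow>
      \<omega> (Xs @ (X + Y) # Zs) = \<omega> (Xs @ X # Zs) + \<omega> (Xs @ Y # Zs)"
    by (rule \<omega>[THEN conjunct1, rule_format])
  note \<omega> = \<omega>[THEN conjunct2]
  show "set (Xs @ X # Zs) \<subseteq> vfields M \<Longrightarrow> smooth_on M UNIV g \<Longrightarrow>
      \<omega> (Xs @ vf_mult g X # Zs) = (\<lambda>p. of_real (g p) * \<omega> (Xs @ X # Zs) p)"
    by (rule \<omega>[THEN conjunct1, rule_format])
  note \<omega> = \<omega>[THEN conjunct2]
  show "\<not> distinct Xs \<Longrightarrow> \<omega> Xs = 0"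
    by (rule \<omega>[THEN conjunct1, rule_format])
  show "\<exists>N. \<forall>Xs. length Xs > N \<longrightarrow> \<omega> Xs = 0"
    by (rule \<omega>[THEN conjunct2])
qed

lemma formsI:
  assumes "\<And>Xs. set Xs \<subseteq> vfields M \<Longrightarrow> smooth_on M UNIV (\<omega> Xs)"
    and "\<And>Xs. \<not> set Xs \<subseteq> vfields M \<Longrightarrow> \<omega> Xs = 0"
    and "\<And>Xs X Y Zs. set (Xs @ X # Y # Zs) \<subseteq> vfields M \<Longrightarrow>
        \<omega> (Xs @ (X + Y) # Zs) = \<omega> (Xs @ X # Zs) + \<omega> (Xs @ Y # Zs)"
    and "\<And>Xs g X Zs. set (Xs @ X # Zs) \<subseteq> vfields M \<Longrightarrow> smooth_on M UNIV g \<Longrightarrow>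
        \<omega> (Xs @ vf_mult g X # Zs) = (\<lambda>p. of_real (g p) * \<omega> (Xs @ X # Zs) p)"
    and "\<And>Xs. \<not> distinct Xs \<Longrightarrow> \<omega> Xs = 0"
    and "\<And>Xs. length Xs > N \<Longrightarrow> \<omega> Xs = 0"
  shows "\<omega> \<in> forms M"
  unfolding forms_def mem_Collect_eq
  by (intro conjI allI impI exI[of _ N] assms)

lemma weight_forms:
  assumes M: "smooth_manifold M" and \<omega>: "\<omega> \<in> forms M"
  shows "weight w \<omega> \<in> forms M"
proof -
  obtain N where N: "\<And>Xs. length Xs > N \<Longrightarrow> \<omega> Xs = 0"
    using forms_bounded_degree[OF \<omega>] by blast
  show ?thesis
  proof (rule formsI)
    show "smooth_on M UNIV (weight w \<omega> Xs)" if "set Xs \<subseteq> vfields M" for Xs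
      unfolding weight_def by (rule smooth_on_scaleR[OF M open_UNIV forms_smooth[OF \<omega> that]])
    show "weight w \<omega> Xs = 0" if "\<not> set Xs \<subseteq> vfields M" for Xs
      using forms_outside[OF \<omega> that] by (simp add: weight_def zero_fun_def)
    show "weight w \<omega> Xs = 0" if "\<not> distinct Xs" for Xs
      using forms_not_distinct[OF \<omega> that] by (simp add: weight_def zero_fun_def)
    show "weight w \<omega> Xs = 0" if "length Xs > N" for Xs
      using N[OF that] by (simp add: weight_def zero_fun_def)
    show "weight w \<omega> (Xs @ (X + Y) # Zs) = weight w \<omega> (Xs @ X # Zs) + weight w \<omega> (Xs @ Y # Zs)"
      if "set (Xs @ X # Y # Zs) \<subseteq> vfields M" for Xs X Y Zs
      using forms_add[OF \<omega> that] by (simp add: weight_def plus_fun_def scaleR_add_right)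
    show "weight w \<omega> (Xs @ vf_mult g X # Zs) = (\<lambda>p. of_real (g p) * weight w \<omega> (Xs @ X # Zs) p)"
      if "set (Xs @ X # Zs) \<subseteq> vfields M" "smooth_on M UNIV g" for Xs g X Zs
      using forms_vf_mult[OF \<omega> that] by (simp add: weight_def)
  qed
qed

lemma forms_map_vf_mult_const:
  assumes M: "smooth_manifold M" and \<omega>: "\<omega> \<in> forms M" and "set Xs \<subseteq> vfields M"
  shows "\<omega> (map (vf_mult (\<lambda>_. c)) Xs) = (\<lambda>p. c ^ length Xs *\<^sub>R \<omega> Xs p)"
proof -
  \<comment> \<open>Multilinearity acts on one entry at a time, so the entries already treated are
    moved to an unscaled prefix \<open>Ys\<close>.\<close>
  have "\<omega> (Ys @ map (vf_mult (\<lambda>_. c)) Xs) = (\<lambda>p. c ^ length Xs *\<^sub>R \<omega> (Ys @ Xs) p)"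
    if "set Ys \<subseteq> vfields M" for Ys
    using assms(3) that
  proof (induction Xs arbitrary: Ys)
    case (Cons X Xs)
    have "set (map (vf_mult (\<lambda>_. c)) Xs) \<subseteq> vfields M"
      using Cons.prems vf_mult_const_vfields[OF M] by auto
    then have "\<omega> (Ys @ vf_mult (\<lambda>_. c) X # map (vf_mult (\<lambda>_. c)) Xs)
        = (\<lambda>p. of_real c * \<omega> (Ys @ X # map (vf_mult (\<lambda>_. c)) Xs) p)"
      using Cons.prems by (intro forms_vf_mult[OF \<omega>] smooth_on_const) auto
    also have "\<omega> (Ys @ X # map (vf_mult (\<lambda>_. c)) Xs) = (\<lambda>p. c ^ length Xs *\<^sub>R \<omega> ((Ys @ [X]) @ Xs) p)"
      using Cons.IH[of "Ys @ [X]"] Cons.prems by simp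
    finally show ?case
      by (simp add: scaleR_conv_of_real mult.assoc)
  qed simp
  from this[of "[]"] show ?thesis
    by simp
qed

text \<open>Wedging with these constants is multiplication by a complex number, so that closure
  under \<open>scale_form\<close> becomes a case of closure under \<open>wedge\<close>.\<close>

definition const_form :: "complex \<Rightarrow> ('m, complex) form" where
  "const_form c = (\<lambda>Xs p. if Xs = [] then c else 0)"

lemma const_form_forms: "const_form c \<in> forms M"
  by (rule formsI[where N = 0]) (auto simp: const_form_def smooth_on_const fun_eq_iff)

section \<open>Wedge products and alternation\<close>

lemma length_nths_Compl: "length (nths Xs S) + length (nths Xs (- S)) = length Xs"
proof (induction Xs arbitrary: S)
  case (Cons X Xs)
  have "{j. Suc j \<notin> S} = - {j. Suc j \<in> S}"
    by auto
  then show ?case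
    using Cons[of "{j. Suc j \<in> S}"] by (simp add: nths_Cons)
qed simp

lemma nths_insert_position:
  "nths (Xs @ X # Zs) S =
    nths Xs S @ (if length Xs \<in> S then [X] else []) @ nths Zs {j. Suc (j + length Xs) \<in> S}"
  by (simp add: nths_append nths_Cons)

text \<open>Polarization: expanding the vanishing value at two adjacent copies of
  \<open>X + Y\<close> shows that exchanging neighbors changes the sign. Two equal arguments at a
  distance are then brought next to each other by such exchanges.\<close>

lemma alternating_if_adjacent:
  fixes \<omega> :: "'a::semigroup_add list \<Rightarrow> 'b::ab_group_add"
  assumes V: "\<And>X Y. X \<in> V \<Longrightarrow> Y \<in> V \<Longrightarrow> X + Y \<in> V"
    and add: "\<And>Xs X Y Zs. set (Xs @ X # Y # Zs) \<subseteq> V \<Longrightarrow>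
        \<omega> (Xs @ (X + Y) # Zs) = \<omega> (Xs @ X # Zs) + \<omega> (Xs @ Y # Zs)"
    and adj: "\<And>Xs X Zs. set (Xs @ X # Zs) \<subseteq> V \<Longrightarrow> \<omega> (Xs @ X # X # Zs) = 0"
    and "set Xs \<subseteq> V" "\<not> distinct Xs"
  shows "\<omega> Xs = 0"
proof -
  have swap: "\<omega> (Xs @ X # Y # Zs) = - \<omega> (Xs @ Y # X # Zs)" if *: "set (Xs @ X # Y # Zs) \<subseteq> V" for Xs X Y Zs
  proof -
    have XY: "X \<in> V" "Y \<in> V" "X + Y \<in> V"
      using * V by auto
    have "0 = \<omega> (Xs @ (X + Y) # (X + Y) # Zs)"
      using adj[of Xs "X + Y" Zs] * XY by simp
    also have "\<dots> = \<omega> (Xs @ X # (X + Y) # Zs) + \<omega> (Xs @ Y # (X + Y) # Zs)"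
      using add[of Xs X Y "(X + Y) # Zs"] * XY by simp
    also have "\<omega> (Xs @ X # (X + Y) # Zs) = \<omega> (Xs @ X # X # Zs) + \<omega> (Xs @ X # Y # Zs)"
      using add[of "Xs @ [X]" X Y Zs] * by simp
    also have "\<omega> (Xs @ Y # (X + Y) # Zs) = \<omega> (Xs @ Y # X # Zs) + \<omega> (Xs @ Y # Y # Zs)"
      using add[of "Xs @ [Y]" X Y Zs] * by simp
    finally show ?thesis
      using adj[of Xs X Zs] adj[of Xs Y Zs] * by (simp add: eq_neg_iff_add_eq_0)
  qed
  have sep: "\<omega> (Xs @ X # Ys @ X # Zs) = 0" if "set (Xs @ X # Ys @ Zs) \<subseteq> V" for Xs X Ys Zs
    using that
  proof (induction Ys arbitrary: Xs)
    case Nil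
    then show ?case
      using adj[of Xs X Zs] by simp
  next
    case (Cons Y Ys)
    then show ?case
      using swap[of Xs X Y "Ys @ X # Zs"] Cons.IH[of "Xs @ [Y]"] by simp
  qed
  obtain As X Bs Cs where "Xs = As @ [X] @ Bs @ [X] @ Cs"
    using not_distinct_decomp[OF assms(5)] by blast
  then show ?thesis
    using sep[of As X Bs Cs] assms(4) by simp
qed

text \<open>These are the coefficients of \<open>wedge\<close> on bundle valued forms: the product
  of \<open>\<omega>\<close> with \<open>\<alpha>\<close> tensor \<open>s\<close> is
  \<open>form_wedge \<omega> \<alpha>\<close> tensor \<open>s\<close>.\<close>

definition form_wedge :: "('m, complex) form \<Rightarrow> ('m, complex) form \<Rightarrow> ('m, complex) form" where
  "form_wedge \<omega> \<alpha> Xs p =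
     (\<Sum>S\<in>Pow {..<length Xs}. shuffle_sign S (length Xs) * \<omega> (nths Xs S) p * \<alpha> (nths Xs (- S)) p)"

lemma transpose_image_iff:
  "i \<in> Transposition.transpose a b ` S \<longleftrightarrow> Transposition.transpose a b i \<in> S"
  by (metis image_iff transpose_involutory)

text \<open>The sign counts the pairs \<open>i < j\<close> with \<open>i\<close> outside and
  \<open>j\<close> inside the set. The transposition matches these pairs for \<open>S\<close> with
  those for its image, except for \<open>(l, Suc l)\<close>, which becomes such a pair only through
  the exchange.\<close>

lemma shuffle_sign_adjacent_swap:
  assumes S: "l \<in> S" "Suc l \<notin> S" and "Suc l < k"
  shows "shuffle_sign (Transposition.transpose l (Suc l) ` S) k = - shuffle_sign S k"
proof -
  let ?t = "Transposition.transpose l (Suc l)"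
  define I where "I S = {(i, j). i < j \<and> j < k \<and> i \<notin> S \<and> j \<in> S}" for S
  have fin: "finite (I S)" for S
    by (rule finite_subset[of _ "{..<k} \<times> {..<k}"]) (auto simp: I_def)
  note mem = transpose_image_iff[of _ l "Suc l"]
  have t: "?t i = (if i = l then Suc l else if i = Suc l then l else i)" for i
    by (simp add: Transposition.transpose_def)
  have "bij_betw (\<lambda>(i, j). (?t i, ?t j)) (I S) (I (?t ` S) - {(l, Suc l)})"
  proof (rule bij_betw_byWitness[where f' = "\<lambda>(i, j). (?t i, ?t j)"])
    show "(\<lambda>(i, j). (?t i, ?t j)) ` I S \<subseteq> I (?t ` S) - {(l, Suc l)}"
    proof (rule image_subsetI)
      fix x assume "x \<in> I S"
      moreover obtain i j where x: "x = (i, j)"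
        by (cases x)
      ultimately have ij: "i < j" "j < k" "i \<notin> S" "j \<in> S"
        by (simp_all add: I_def)
      then have "?t i < ?t j" "?t j < k" "(?t i, ?t j) \<noteq> (l, Suc l)"
        using assms by (auto simp: t)
      then show "(case x of (i, j) \<Rightarrow> (?t i, ?t j)) \<in> I (?t ` S) - {(l, Suc l)}"
        using ij by (simp add: x I_def mem)
    qed
    show "(\<lambda>(i, j). (?t i, ?t j)) ` (I (?t ` S) - {(l, Suc l)}) \<subseteq> I S"
    proof (rule image_subsetI)
      fix x assume "x \<in> I (?t ` S) - {(l, Suc l)}"
      moreover obtain i j where x: "x = (i, j)"
        by (cases x)
      ultimately have ij: "i < j" "j < k" "?t i \<notin> S" "?t j \<in> S" "(i, j) \<noteq> (l, Suc l)"
        by (simp_all add: I_def mem)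
      then have "?t i < ?t j" "?t j < k"
        using assms by (auto simp: t split: if_splits)
      then show "(case x of (i, j) \<Rightarrow> (?t i, ?t j)) \<in> I S"
        using ij by (simp add: x I_def)
    qed
  qed auto
  then have "card (I (?t ` S) - {(l, Suc l)}) = card (I S)"
    by (metis bij_betw_same_card)
  moreover have "(l, Suc l) \<in> I (?t ` S)"
    using assms by (simp add: I_def mem)
  ultimately have "card (I (?t ` S)) = Suc (card (I S))"
    using card.remove[OF fin] by metis
  then show ?thesis
    by (simp add: shuffle_sign_def I_def)
qed

lemma nths_cong_set:
  assumes "\<And>i. i < length Xs \<Longrightarrow> i \<in> S \<longleftrightarrow> i \<in> T"
  shows "nths Xs S = nths Xs T"
  unfolding nths_def
  by (rule arg_cong[of _ _ "map fst"], rule filter_cong) (auto simp: assms set_zip)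

text \<open>Exchanging the two equal arguments pairs the summands up with opposite shuffle signs.\<close>

lemma form_wedge_adjacent:
  assumes \<omega>: "\<omega> \<in> forms M" and \<alpha>: "\<alpha> \<in> forms M"
  shows "form_wedge \<omega> \<alpha> (Ys @ X # X # Zs) = 0"
proof
  fix p
  let ?Xs = "Ys @ X # X # Zs"
  let ?l = "length Ys" and ?n = "length ?Xs"
  let ?t = "Transposition.transpose ?l (Suc ?l)"
  define g where "g S = shuffle_sign S ?n * \<omega> (nths ?Xs S) p * \<alpha> (nths ?Xs (- S)) p" for S
  have t: "?t i = (if i = ?l then Suc ?l else if i = Suc ?l then ?l else i)" for i
    by (simp add: Transposition.transpose_def)
  note mem = transpose_image_iff[of _ ?l "Suc ?l"]
  have tt: "?t ` ?t ` S = S" for S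
    by (rule set_eqI) (simp only: mem transpose_involutory)
  have nths: "nths ?Xs S = nths Ys S @ (if ?l \<in> S then [X] else []) @ (if Suc ?l \<in> S then [X] else [])
      @ nths Zs {j. Suc (Suc (j + ?l)) \<in> S}" for S
    by (simp add: nths_append nths_Cons)
  have nths_t: "nths Ys (?t ` S) = nths Ys S" "nths Ys (- ?t ` S) = nths Ys (- S)"
    "nths Zs {j. Suc (Suc (j + ?l)) \<in> ?t ` S} = nths Zs {j. Suc (Suc (j + ?l)) \<in> S}"
    "nths Zs {j. Suc (Suc (j + ?l)) \<in> - ?t ` S} = nths Zs {j. Suc (Suc (j + ?l)) \<in> - S}" for S
    by (rule nths_cong_set, simp only: mem Compl_iff mem_Collect_eq, simp add: t)+
  have swap: "g (?t ` S) = - g S" if "?l \<in> S" "Suc ?l \<notin> S" for S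
  proof -
    have "nths ?Xs (?t ` S) = nths ?Xs S" "nths ?Xs (- ?t ` S) = nths ?Xs (- S)"
      unfolding nths nths_t Compl_iff mem using that by (auto simp: t)
    moreover have "shuffle_sign (?t ` S) ?n = - shuffle_sign S ?n"
      using that by (intro shuffle_sign_adjacent_swap) auto
    ultimately show ?thesis
      by (simp add: g_def)
  qed
  \<comment> \<open>If \<open>S\<close> contains both positions, or neither, then one of the two
    factors receives \<open>X\<close> twice and vanishes, for \<open>S\<close> as for its image. If
    \<open>S\<close> contains only the second position, its image contains only the first.\<close>
  have neg: "g (?t ` S) = - g S" for S
  proof -
    consider "?l \<in> S" "Suc ?l \<in> S" | "?l \<in> S" "Suc ?l \<notin> S" | "?l \<notin> S" "Suc ?l \<in> S" | "?l \<notin> S" "Suc ?l \<notin> S"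
      by blast
    then show ?thesis
    proof cases
      case 1
      then have "\<not> distinct (nths ?Xs S)" "\<not> distinct (nths ?Xs (?t ` S))"
        unfolding nths nths_t mem by (simp_all add: t)
      then show ?thesis
        by (simp add: g_def forms_not_distinct[OF \<omega>])
    next
      case 2
      then show ?thesis by (rule swap)
    next
      case 3
      then show ?thesis
        using swap[of "?t ` S"] unfolding tt mem by (simp add: t)
    next
      case 4
      then have "\<not> distinct (nths ?Xs (- S))" "\<not> distinct (nths ?Xs (- ?t ` S))"
        unfolding nths nths_t Compl_iff mem by (simp_all add: t)
      then show ?thesis
        by (simp add: g_def forms_not_distinct[OF \<alpha>])
    qed
  qed
  have sub: "?t ` S \<in> Pow {..<?n}" if "S \<in> Pow {..<?n}" for S
    using that unfolding Pow_iff by (intro image_subsetI) (auto simp: t)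
  have "sum g (Pow {..<?n}) = (\<Sum>S\<in>Pow {..<?n}. g (?t ` S))"
    by (rule sum.reindex_bij_witness[where i = "(`) ?t" and j = "(`) ?t"]) (simp_all only: sub tt)
  also have "\<dots> = - sum g (Pow {..<?n})"
    by (simp add: neg sum_negf)
  finally show "form_wedge \<omega> \<alpha> ?Xs p = 0 p"
    by (simp add: form_wedge_def g_def del: length_append)
qed

text \<open>Alternation is reduced to adjacent equal arguments by
  \<open>alternating_if_adjacent\<close>; lists that leave the vector fields are settled separately,
  because polarization is available for vector fields only. Linearity in one argument holds summand
  by summand, since its position belongs to exactly one of \<open>S\<close> and the complement of
  \<open>S\<close>.\<close>

lemma form_wedge_forms:
  assumes M: "smooth_manifold M" and \<omega>: "\<omega> \<in> forms M" and \<alpha>: "\<alpha> \<in> forms M"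
  shows "form_wedge \<omega> \<alpha> \<in> forms M"
proof -
  obtain N\<^sub>\<omega> where N\<^sub>\<omega>: "\<forall>Xs. length Xs > N\<^sub>\<omega> \<longrightarrow> \<omega> Xs = 0"
    using forms_bounded_degree[OF \<omega>] by (rule exE)
  obtain N\<^sub>\<alpha> where N\<^sub>\<alpha>: "\<forall>Xs. length Xs > N\<^sub>\<alpha> \<longrightarrow> \<alpha> Xs = 0"
    using forms_bounded_degree[OF \<alpha>] by (rule exE)
  have len: "length (Xs @ X # Zs) = Suc (length Xs + length Zs)" for Xs Zs and X :: "'a vfield"
    by simp
  have outside: "form_wedge \<omega> \<alpha> Xs = 0" if Xs: "\<not> set Xs \<subseteq> vfields M" for Xs
  proof
    fix p
    obtain i where i: "i < length Xs" "Xs ! i \<notin> vfields M"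
      using Xs by (auto simp: in_set_conv_nth subset_iff)
    have *: "\<omega> (nths Xs S) p * \<alpha> (nths Xs (- S)) p = 0" for S
    proof (cases "i \<in> S")
      case True
      then have "\<not> set (nths Xs S) \<subseteq> vfields M"
        using i by (auto simp: set_nths)
      then show ?thesis
        by (simp add: forms_outside[OF \<omega>])
    next
      case False
      then have "\<not> set (nths Xs (- S)) \<subseteq> vfields M"
        using i by (auto simp: set_nths)
      then show ?thesis
        by (simp add: forms_outside[OF \<alpha>])
    qed
    then show "form_wedge \<omega> \<alpha> Xs p = 0 p"
      by (simp only: form_wedge_def mult.assoc * mult_zero_right sum.neutral_const zero_fun_apply)
  qed
  have sub: "set (nths Ys S) \<subseteq> vfields M" if "set Ys \<subseteq> vfields M" for Ys S
    using that set_nths_subset by fast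
  have add: "form_wedge \<omega> \<alpha> (Xs @ (X + Y) # Zs) = form_wedge \<omega> \<alpha> (Xs @ X # Zs) + form_wedge \<omega> \<alpha> (Xs @ Y # Zs)"
    if V: "set (Xs @ X # Y # Zs) \<subseteq> vfields M" for Xs X Y Zs
  proof
    fix p
    have V': "set (nths Xs S @ X # Y # nths Zs T) \<subseteq> vfields M" for S T
      using V sub[of Xs S] sub[of Zs T] by simp
    have "\<omega> (nths (Xs @ (X + Y) # Zs) S) p * \<alpha> (nths (Xs @ (X + Y) # Zs) (- S)) p
        = \<omega> (nths (Xs @ X # Zs) S) p * \<alpha> (nths (Xs @ X # Zs) (- S)) p
        + \<omega> (nths (Xs @ Y # Zs) S) p * \<alpha> (nths (Xs @ Y # Zs) (- S)) p" for S
      unfolding nths_insert_position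
      using forms_add[OF \<omega> V'] forms_add[OF \<alpha> V'] by (simp add: plus_fun_apply distrib_left distrib_right)
    then show "form_wedge \<omega> \<alpha> (Xs @ (X + Y) # Zs) p
        = (form_wedge \<omega> \<alpha> (Xs @ X # Zs) + form_wedge \<omega> \<alpha> (Xs @ Y # Zs)) p"
      unfolding form_wedge_def plus_fun_apply len by (simp add: mult.assoc distrib_left sum.distrib)
  qed
  show ?thesis
  proof (rule formsI)
    show "smooth_on M UNIV (form_wedge \<omega> \<alpha> Xs)" if "set Xs \<subseteq> vfields M" for Xs
      unfolding form_wedge_def
    proof (rule smooth_on_sum[OF M open_UNIV])
      fix S
      show "smooth_on M UNIV (\<lambda>p. shuffle_sign S (length Xs) * \<omega> (nths Xs S) p * \<alpha> (nths Xs (- S)) p)"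
        by (rule smooth_on_mult[OF M open_UNIV smooth_on_mult[OF M open_UNIV smooth_on_const
              forms_smooth[OF \<omega> sub[OF that]]] forms_smooth[OF \<alpha> sub[OF that]]])
    qed
    show "form_wedge \<omega> \<alpha> (Xs @ vf_mult g X # Zs) = (\<lambda>p. of_real (g p) * form_wedge \<omega> \<alpha> (Xs @ X # Zs) p)"
      if V: "set (Xs @ X # Zs) \<subseteq> vfields M" and g: "smooth_on M UNIV g" for Xs g X Zs
    proof
      fix p
      have V': "set (nths Xs S @ X # nths Zs T) \<subseteq> vfields M" for S T
        using V sub[of Xs S] sub[of Zs T] by simp
      have "\<omega> (nths (Xs @ vf_mult g X # Zs) S) p * \<alpha> (nths (Xs @ vf_mult g X # Zs) (- S)) p
          = of_real (g p) * (\<omega> (nths (Xs @ X # Zs) S) p * \<alpha> (nths (Xs @ X # Zs) (- S)) p)" for S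
        unfolding nths_insert_position
        using forms_vf_mult[OF \<omega> V' g] forms_vf_mult[OF \<alpha> V' g] by simp
      then show "form_wedge \<omega> \<alpha> (Xs @ vf_mult g X # Zs) p = of_real (g p) * form_wedge \<omega> \<alpha> (Xs @ X # Zs) p"
        unfolding form_wedge_def len sum_distrib_left by (simp add: mult.assoc mult.left_commute)
    qed
    show "form_wedge \<omega> \<alpha> Xs = 0" if "\<not> distinct Xs" for Xs
    proof (cases "set Xs \<subseteq> vfields M")
      case True
      show ?thesis
        by (rule alternating_if_adjacent[OF vfields_add[OF M] add form_wedge_adjacent[OF \<omega> \<alpha>] True that])
    next
      case False
      then show ?thesis by (rule outside)
    qed
    show "form_wedge \<omega> \<alpha> Xs = 0" if "length Xs > N\<^sub>\<omega> + N\<^sub>\<alpha>" for Xs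
    proof
      fix p
      have *: "\<omega> (nths Xs S) p * \<alpha> (nths Xs (- S)) p = 0" for S
      proof (cases "length (nths Xs S) > N\<^sub>\<omega>")
        case True
        then show ?thesis by (simp add: N\<^sub>\<omega>)
      next
        case False
        then have "length (nths Xs (- S)) > N\<^sub>\<alpha>"
          using that length_nths_Compl[of Xs S] by linarith
        then show ?thesis by (simp add: N\<^sub>\<alpha>)
      qed
      then show "form_wedge \<omega> \<alpha> Xs p = 0 p"
        by (simp only: form_wedge_def mult.assoc * mult_zero_right sum.neutral_const zero_fun_apply)
    qed
  next
    show "form_wedge \<omega> \<alpha> Xs = 0" if "\<not> set Xs \<subseteq> vfields M" for Xs
      by (rule outside[OF that])
    show "form_wedge \<omega> \<alpha> (Xs @ (X + Y) # Zs) = form_wedge \<omega> \<alpha> (Xs @ X # Zs) + form_wedge \<omega> \<alpha> (Xs @ Y # Zs)"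
      if "set (Xs @ X # Y # Zs) \<subseteq> vfields M" for Xs X Y Zs
      by (rule add[OF that])
  qed
qed

section \<open>Bundle valued forms\<close>

lemma fib_subspace: "vector_bundle M E \<Longrightarrow> vec.subspace (fib E p)"
  by (simp add: vector_bundle_def)

lemma fib_scaleR: "vector_bundle M E \<Longrightarrow> v \<in> fib E p \<Longrightarrow> c *\<^sub>R v \<in> fib E p"
  using vec.subspace_scale[OF fib_subspace, of M E v p "of_real c"] by (simp only: of_real_scale_vec)

lemma bundle_endo_in:
  assumes "bundle_endo M E L" "v \<in> fib E p"
  shows "L p v \<in> fib E p"
  using assms by (simp add: bundle_endo_def)

lemma bundle_endo_linear:
  assumes "bundle_endo M E L" "v \<in> fib E p" "w \<in> fib E p"
  shows "L p (a *s v + w) = a *s L p v + L p w"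
  using assms by (simp add: bundle_endo_def)

lemma bundle_endo_zero:
  assumes "vector_bundle M E" "bundle_endo M E L"
  shows "L p 0 = 0"
  using bundle_endo_linear[OF assms(2), of 0 p 0 1] vec.subspace_0[OF fib_subspace[OF assms(1)]] by simp

lemma bundle_endo_scale:
  assumes "vector_bundle M E" "bundle_endo M E L" "v \<in> fib E p"
  shows "L p (a *s v) = a *s L p v"
  using bundle_endo_linear[OF assms(2,3) vec.subspace_0[OF fib_subspace[OF assms(1)]], of a]
    bundle_endo_zero[OF assms(1,2)] by simp

lemma bundle_endo_scaleR:
  assumes "vector_bundle M E" "bundle_endo M E L" "v \<in> fib E p"
  shows "L p (c *\<^sub>R v) = c *\<^sub>R L p v"
  using bundle_endo_scale[OF assms, of "of_real c"] by (simp only: of_real_scale_vec)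

lemma bundle_endo_sum:
  assumes "vector_bundle M E" "bundle_endo M E L" "\<And>j. j < N \<Longrightarrow> v j \<in> fib E p"
  shows "L p (\<Sum>j<N::nat. a j *s v j) = (\<Sum>j<N. a j *s L p (v j))"
  using assms(3)
proof (induction N)
  case 0
  show ?case by (simp add: bundle_endo_zero[OF assms(1,2)])
next
  case (Suc N)
  have "(\<Sum>j<N. a j *s v j) \<in> fib E p"
    using Suc.prems fib_subspace[OF assms(1)] by (intro vec.subspace_sum vec.subspace_scale) auto
  with Suc show ?case
    using bundle_endo_linear[OF assms(2), of "v N" p "\<Sum>j<N. a j *s v j" "a N"] by (simp add: add.commute)
qed

lemma sections_in_fib: "s \<in> sections M E \<Longrightarrow> s p \<in> fib E p"
  by (simp add: sections_def)

lemma bundle_formsI: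
  fixes N :: nat
  assumes "\<And>j. j < N \<Longrightarrow> \<alpha> j \<in> forms M" "\<And>j. j < N \<Longrightarrow> s j \<in> sections M E"
    and "\<And>Xs p. \<sigma> Xs p = (\<Sum>j<N. \<alpha> j Xs p *s s j p)"
  shows "\<sigma> \<in> bundle_forms M E"
  unfolding bundle_forms_def mem_Collect_eq
  by (rule exI[of _ N], rule exI[of _ \<alpha>], rule exI[of _ s]) (simp add: assms fun_eq_iff)

lemma bundle_formsE:
  assumes "\<sigma> \<in> bundle_forms M E"
  obtains N :: nat and \<alpha> s where "\<forall>j<N. \<alpha> j \<in> forms M" "\<forall>j<N. s j \<in> sections M E"
    "\<forall>Xs p. \<sigma> Xs p = (\<Sum>j<N. \<alpha> j Xs p *s s j p)"
proof -
  obtain N :: nat and \<alpha> s where *: "\<forall>j<N. \<alpha> j \<in> forms M \<and> s j \<in> sections M E"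
    and \<sigma>: "\<sigma> = (\<lambda>Xs p. \<Sum>j<N. \<alpha> j Xs p *s s j p)"
    using assms unfolding bundle_forms_def mem_Collect_eq by (elim exE conjE)
  show thesis
    by (rule that[of N \<alpha> s]) (simp_all add: * \<sigma>)
qed

lemma bundle_forms_in_fib:
  assumes E: "vector_bundle M E" and "\<sigma> \<in> bundle_forms M E"
  shows "\<sigma> Xs p \<in> fib E p"
proof -
  obtain N :: nat and \<alpha> s where "\<forall>j<N. \<alpha> j \<in> forms M" "\<forall>j<N. s j \<in> sections M E"
    "\<forall>Xs p. \<sigma> Xs p = (\<Sum>j<N. \<alpha> j Xs p *s s j p)"
    using assms(2) by (rule bundle_formsE)
  note * = this[rule_format]
  show ?thesis
    unfolding *(3)
    by (intro vec.subspace_sum vec.subspace_scale fib_subspace[OF E] sections_in_fib[OF *(2)]) simp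
qed

lemma bundle_forms_zero: "0 \<in> bundle_forms M E"
  by (rule bundle_formsI[where N = 0]) auto

lemma bundle_forms_add:
  assumes "\<sigma> \<in> bundle_forms M E" "\<tau> \<in> bundle_forms M E"
  shows "\<sigma> + \<tau> \<in> bundle_forms M E"
proof -
  obtain N :: nat and \<alpha> s where "\<forall>j<N. \<alpha> j \<in> forms M" "\<forall>j<N. s j \<in> sections M E"
    "\<forall>Xs p. \<sigma> Xs p = (\<Sum>j<N. \<alpha> j Xs p *s s j p)"
    using assms(1) by (rule bundle_formsE)
  note 1 = this[rule_format]
  obtain N' :: nat and \<alpha>' s' where "\<forall>j<N'. \<alpha>' j \<in> forms M" "\<forall>j<N'. s' j \<in> sections M E"
    "\<forall>Xs p. \<tau> Xs p = (\<Sum>j<N'. \<alpha>' j Xs p *s s' j p)"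
    using assms(2) by (rule bundle_formsE)
  note 2 = this[rule_format]
  let ?\<alpha> = "\<lambda>j. if j < N then \<alpha> j else \<alpha>' (j - N)" and ?s = "\<lambda>j. if j < N then s j else s' (j - N)"
  show ?thesis
  proof (rule bundle_formsI[where N = "N + N'" and \<alpha> = ?\<alpha> and s = ?s])
    fix Xs p
    have "(\<Sum>j<N + N'. ?\<alpha> j Xs p *s ?s j p)
        = (\<Sum>j<N. ?\<alpha> j Xs p *s ?s j p) + (\<Sum>j<N'. ?\<alpha> (N + j) Xs p *s ?s (N + j) p)"
      by (induction N') (simp_all add: add.assoc)
    then show "(\<sigma> + \<tau>) Xs p = (\<Sum>j<N + N'. ?\<alpha> j Xs p *s ?s j p)"
      by (simp add: 1(3) 2(3))
  qed (use 1(1,2) 2(1,2) in simp_all)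
qed

lemma bundle_forms_sum:
  assumes "\<And>i. i \<in> I \<Longrightarrow> \<sigma> i \<in> bundle_forms M E"
  shows "(\<Sum>i\<in>I. \<sigma> i) \<in> bundle_forms M E"
  using assms
  by (induction I rule: infinite_finite_induct) (auto intro: bundle_forms_zero bundle_forms_add)

lemma scaleR_scale_vec: "(c *\<^sub>R a) *s v = c *\<^sub>R (a *s (v :: complex ^ 'k))"
  by (simp add: vec_eq_iff)

lemma bundle_forms_weight:
  assumes M: "smooth_manifold M" and "\<sigma> \<in> bundle_forms M E"
  shows "weight w \<sigma> \<in> bundle_forms M E"
proof -
  obtain N :: nat and \<alpha> s where "\<forall>j<N. \<alpha> j \<in> forms M" "\<forall>j<N. s j \<in> sections M E"
    "\<forall>Xs p. \<sigma> Xs p = (\<Sum>j<N. \<alpha> j Xs p *s s j p)"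
    using assms(2) by (rule bundle_formsE)
  note * = this[rule_format]
  show ?thesis
  proof (rule bundle_formsI[where N = N and \<alpha> = "\<lambda>j. weight w (\<alpha> j)" and s = s])
    show "weight w \<sigma> Xs p = (\<Sum>j<N. weight w (\<alpha> j) Xs p *s s j p)" for Xs p
      by (simp only: weight_def *(3) scaleR_right.sum scaleR_scale_vec)
  qed (intro weight_forms[OF M] *(1,2); assumption)+
qed

lemma bundle_forms_fiberwise:
  assumes E: "vector_bundle M E" and L: "bundle_endo M E L" and "\<sigma> \<in> bundle_forms M E"
  shows "(\<lambda>Xs p. L p (\<sigma> Xs p)) \<in> bundle_forms M E"
proof -
  obtain N :: nat and \<alpha> s where "\<forall>j<N. \<alpha> j \<in> forms M" "\<forall>j<N. s j \<in> sections M E"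
    "\<forall>Xs p. \<sigma> Xs p = (\<Sum>j<N. \<alpha> j Xs p *s s j p)"
    using assms(3) by (rule bundle_formsE)
  note * = this[rule_format]
  show ?thesis
  proof (rule bundle_formsI[where N = N and \<alpha> = \<alpha> and s = "\<lambda>j p. L p (s j p)"])
    show "(\<lambda>p. L p (s j p)) \<in> sections M E" if "j < N" for j
      using L *(2)[OF that] by (simp add: bundle_endo_def)
    show "L p (\<sigma> Xs p) = (\<Sum>j<N. \<alpha> j Xs p *s L p (s j p))" for Xs p
      unfolding *(3) by (rule bundle_endo_sum[OF E L sections_in_fib[OF *(2)]])
  qed (rule *(1))
qed

lemma fiberwise_weight:
  assumes "vector_bundle M E" "bundle_endo M E L" "\<And>Xs p. \<sigma> Xs p \<in> fib E p"
  shows "(\<lambda>Xs p. L p (weight w \<sigma> Xs p)) = weight w (\<lambda>Xs p. L p (\<sigma> Xs p))"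
  unfolding weight_def by (intro ext bundle_endo_scaleR[OF assms(1,2)] assms(3))

lemma neg_one_power_scale_vec: "(-1) ^ k *s v = (-1) ^ k *\<^sub>R (v :: complex ^ 'k)"
  by (cases "even k") simp_all

lemma total_parity_eq: "total_parity E \<sigma> = weight (\<lambda>k. (-1) ^ k) (\<lambda>Xs p. grade E p (\<sigma> Xs p))"
  by (simp add: total_parity_def weight_def neg_one_power_scale_vec)

lemma cliff_act_eq: "cliff_act E i \<sigma> = weight (\<lambda>k. (-1) ^ k) (\<lambda>Xs p. cliff E i p (\<sigma> Xs p))"
  by (simp add: cliff_act_def weight_def neg_one_power_scale_vec)

lemma total_parity_weight:
  assumes "vector_bundle M E" "bundle_endo M E (grade E)" "\<And>Xs p. \<sigma> Xs p \<in> fib E p"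
  shows "total_parity E (weight w \<sigma>) = weight w (total_parity E \<sigma>)"
  unfolding total_parity_eq fiberwise_weight[OF assms] weight_weight by (simp add: mult.commute)

lemma cliff_act_weight:
  assumes "vector_bundle M E" "bundle_endo M E (cliff E i)" "\<And>Xs p. \<sigma> Xs p \<in> fib E p"
  shows "cliff_act E i (weight w \<sigma>) = weight w (cliff_act E i \<sigma>)"
  unfolding cliff_act_eq fiberwise_weight[OF assms] weight_weight by (simp add: mult.commute)

lemma bundle_forms_total_parity:
  assumes "smooth_manifold M" "vector_bundle M E" "bundle_endo M E (grade E)" "\<sigma> \<in> bundle_forms M E"
  shows "total_parity E \<sigma> \<in> bundle_forms M E"
  unfolding total_parity_eq
  by (rule bundle_forms_weight[OF assms(1) bundle_forms_fiberwise[OF assms(2-4)]])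

lemma bundle_forms_cliff_act:
  assumes "smooth_manifold M" "vector_bundle M E" "bundle_endo M E (cliff E i)" "\<sigma> \<in> bundle_forms M E"
  shows "cliff_act E i \<sigma> \<in> bundle_forms M E"
  unfolding cliff_act_eq
  by (rule bundle_forms_weight[OF assms(1) bundle_forms_fiberwise[OF assms(2-4)]])

lemma bundle_forms_wedge:
  assumes M: "smooth_manifold M" and \<omega>: "\<omega> \<in> forms M" and "\<sigma> \<in> bundle_forms M E"
  shows "wedge \<omega> \<sigma> \<in> bundle_forms M E"
proof -
  obtain N :: nat and \<alpha> s where "\<forall>j<N. \<alpha> j \<in> forms M" "\<forall>j<N. s j \<in> sections M E"
    "\<forall>Xs p. \<sigma> Xs p = (\<Sum>j<N. \<alpha> j Xs p *s s j p)"
    using assms(3) by (rule bundle_formsE)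
  note * = this[rule_format]
  show ?thesis
  proof (rule bundle_formsI[where N = N and \<alpha> = "\<lambda>j. form_wedge \<omega> (\<alpha> j)" and s = s])
    show "wedge \<omega> \<sigma> Xs p = (\<Sum>j<N. form_wedge \<omega> (\<alpha> j) Xs p *s s j p)" for Xs p
      unfolding wedge_def *(3) form_wedge_def vec.scale_sum_left vec.scale_sum_right vec.scale_scale
      by (rule sum.swap)
  qed (rule form_wedge_forms[OF M \<omega> *(1)] *(2); assumption)+
qed

lemma wedge_const_form: "wedge (const_form c) \<sigma> = scale_form c \<sigma>"
proof (intro ext)
  fix Xs :: "'a vfield list" and p
  let ?n = "length Xs"
  have "const_form c (nths Xs S) p = 0" if "S \<in> Pow {..<?n} - {{}}" for S
  proof -
    have "\<exists>i<?n. i \<in> S"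
      using that by auto
    then have "nths Xs S \<noteq> []"
      unfolding set_empty[symmetric] set_nths by blast
    then show ?thesis
      by (simp add: const_form_def)
  qed
  then have "wedge (const_form c) \<sigma> Xs p = (\<Sum>S\<in>{{}}. (shuffle_sign S ?n * const_form c (nths Xs S) p)
      *s \<sigma> (nths Xs (- S)) p)"
    unfolding wedge_def by (intro sum.mono_neutral_right) auto
  moreover have "shuffle_sign {} ?n = 1"
    by (simp add: shuffle_sign_def)
  ultimately show "wedge (const_form c) \<sigma> Xs p = scale_form c \<sigma> Xs p"
    by (simp add: const_form_def scale_form_def nths_all)
qed

lemma bundle_forms_scale:
  "smooth_manifold M \<Longrightarrow> \<sigma> \<in> bundle_forms M E \<Longrightarrow> scale_form c \<sigma> \<in> bundle_forms M E"
  using bundle_forms_wedge[OF _ const_form_forms] by (simp add: wedge_const_form)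

text \<open>With sections placed in degree 0, every bundle valued form is a finite sum of products
  \<open>wedge \<alpha> (section_form s)\<close>, the shape to which the Leibniz rule
  applies.\<close>

definition section_form :: "('m \<Rightarrow> complex ^ 'k) \<Rightarrow> ('m, complex ^ 'k) form" where
  "section_form s = (\<lambda>Xs p. if Xs = [] then s p else 0)"

lemma section_form_bundle_forms: "s \<in> sections M E \<Longrightarrow> section_form s \<in> bundle_forms M E"
  by (rule bundle_formsI[where N = 1 and \<alpha> = "\<lambda>_. const_form 1" and s = "\<lambda>_. s"], rule const_form_forms)
    (simp_all add: section_form_def const_form_def)

lemma wedge_section_form: "wedge \<omega> (section_form s) Xs p = \<omega> Xs p *s s p"
proof -
  let ?n = "length Xs"
  \<comment> \<open>An element of degree 0 takes no arguments, so only the summand with all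
    positions in \<open>S\<close> remains; it has no inversions and hence sign 1.\<close>
  have "section_form s (nths Xs (- S)) p = 0" if "S \<in> Pow {..<?n} - {{..<?n}}" for S
  proof -
    have "\<exists>i<?n. i \<notin> S"
      using that by auto
    then have "nths Xs (- S) \<noteq> []"
      unfolding set_empty[symmetric] set_nths by blast
    then show ?thesis
      by (simp add: section_form_def)
  qed
  then have "wedge \<omega> (section_form s) Xs p = (\<Sum>S\<in>{{..<?n}}. (shuffle_sign S ?n * \<omega> (nths Xs S) p)
      *s section_form s (nths Xs (- S)) p)"
    unfolding wedge_def by (intro sum.mono_neutral_right) auto
  moreover have "{(i, j). i < j \<and> j < ?n \<and> i \<notin> {..<?n} \<and> j \<in> {..<?n}} = {}"
    by auto
  then have "shuffle_sign {..<?n} ?n = 1"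
    unfolding shuffle_sign_def by (simp only: card.empty power_0)
  moreover have "length (nths Xs (- {..<?n})) = 0"
    using length_nths_Compl[of Xs "{..<?n}"] by simp
  ultimately show ?thesis
    by (simp add: section_form_def)
qed

section \<open>Homogeneity\<close>

text \<open>A shuffle divides the arguments into two lists whose lengths add up to the degree.
  Different weights on the two sides make room for an extra factor \<open>\<mu>\<close> on either of
  them.\<close>

lemma wedge_weight:
  assumes "\<And>i j. u i * v j = w (i + j)"
  shows "wedge (weight u \<omega>) (weight v \<sigma>) = weight w (wedge \<omega> \<sigma>)"
proof (intro ext)
  fix Xs :: "'a vfield list" and p
  let ?n = "length Xs"
  have *: "(c * (a *\<^sub>R x)) *s (b *\<^sub>R y) = (a * b) *\<^sub>R ((c * x) *s y)" for a b c x and y :: "complex ^ 'b"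
    by (simp add: vec_eq_iff)
  have "u (length (nths Xs S)) * v (length (nths Xs (- S))) = w ?n" for S
    by (simp only: assms length_nths_Compl)
  then show "wedge (weight u \<omega>) (weight v \<sigma>) Xs p = weight w (wedge \<omega> \<sigma>) Xs p"
    unfolding wedge_def weight_def * by (simp only: scaleR_right.sum)
qed

lemma vf_complex_scaleR:
  assumes M: "smooth_manifold M" and X: "X \<in> vfields M"
  shows "vf_complex X (\<lambda>p. c *\<^sub>R f p) p = c *\<^sub>R vf_complex X f p"
proof -
  have "Re \<circ> (\<lambda>p. c *\<^sub>R f p) = (\<lambda>p. c * (Re \<circ> f) p)" "Im \<circ> (\<lambda>p. c *\<^sub>R f p) = (\<lambda>p. c * (Im \<circ> f) p)"
    by (simp_all add: fun_eq_iff)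
  then show ?thesis
    unfolding vf_complex_def by (simp only: vfields_scale[OF M X] complex_scaleR)
qed

text \<open>The value of \<open>v 0\<close> is irrelevant because the derivative has no component in degree zero.\<close>

lemma ext_deriv_weight:
  assumes M: "smooth_manifold M" and v: "\<And>k. v (Suc k) = u k"
  shows "ext_deriv M (weight u \<omega>) = weight v (ext_deriv M \<omega>)"
proof (intro ext)
  fix Xs p
  show "ext_deriv M (weight u \<omega>) Xs p = weight v (ext_deriv M \<omega>) Xs p"
  proof (cases "set Xs \<subseteq> vfields M \<and> Xs \<noteq> []")
    case False
    then show ?thesis
      by (auto simp: ext_deriv_def weight_def)
  next
    case True
    let ?n = "length Xs"
    have n: "?n > 0" and Xs: "Xs ! i \<in> vfields M" if "i < ?n" for i
      using True that nth_mem by auto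
    define c where "c = v ?n"
    have c: "u (?n - 1) = c"
      using v[of "?n - 1"] True by (simp add: c_def)
    have len1: "length (nths Xs (- {i})) = ?n - 1" if "i < ?n" for i
    proof -
      have "{j. j < ?n \<and> j \<in> - {i}} = {..<?n} - {i}"
        by auto
      then show ?thesis
        using that by (simp add: length_nths)
    qed
    \<comment> \<open>The bracket replaces two arguments by one, so this term also evaluates
      \<open>\<omega>\<close> in degree \<open>?n - 1\<close>.\<close>
    have len2: "Suc (length (nths Xs (- {i, j}))) = ?n - 1" if "j < ?n" "i < j" for i j
    proof -
      have "{k. k < ?n \<and> k \<in> - {i, j}} = {..<?n} - {i, j}"
        by auto
      then have "length (nths Xs (- {i, j})) = ?n - card {i, j}"
        using that by (simp add: length_nths card_Diff_subset del: card_insert_disjoint)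
      then show ?thesis
        using that by simp
    qed
    have 1: "(-1) ^ i * vf_complex (Xs ! i) (weight u \<omega> (nths Xs (- {i}))) p
        = c *\<^sub>R ((-1) ^ i * vf_complex (Xs ! i) (\<omega> (nths Xs (- {i}))) p)" if "i < ?n" for i
      unfolding weight_def len1[OF that] c vf_complex_scaleR[OF M Xs[OF that]] by simp
    have 2: "(-1) ^ (i + j) * weight u \<omega> (lie_bracket (Xs ! i) (Xs ! j) # nths Xs (- {i, j})) p
        = c *\<^sub>R ((-1) ^ (i + j) * \<omega> (lie_bracket (Xs ! i) (Xs ! j) # nths Xs (- {i, j})) p)"
      if "j < ?n" "i < j" for i j
      unfolding weight_def list.size(4) add_Suc_right add_0_right len2[OF that] c by simp
    have "(\<Sum>i<?n. (-1) ^ i * vf_complex (Xs ! i) (weight u \<omega> (nths Xs (- {i}))) p)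
        = (\<Sum>i<?n. c *\<^sub>R ((-1) ^ i * vf_complex (Xs ! i) (\<omega> (nths Xs (- {i}))) p))"
      by (intro sum.cong refl 1) simp
    moreover have "(\<Sum>j<?n. \<Sum>i<j. (-1) ^ (i + j) *
          weight u \<omega> (lie_bracket (Xs ! i) (Xs ! j) # nths Xs (- {i, j})) p)
        = (\<Sum>j<?n. \<Sum>i<j. c *\<^sub>R ((-1) ^ (i + j) *
          \<omega> (lie_bracket (Xs ! i) (Xs ! j) # nths Xs (- {i, j})) p))"
      by (intro sum.cong refl 2) simp_all
    ultimately have "ext_deriv M (weight u \<omega>) Xs p = c *\<^sub>R ext_deriv M \<omega> Xs p"
      using True by (simp only: ext_deriv_def if_True simp_thms scaleR_right.sum scaleR_add_right)
    then show ?thesis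
      by (simp add: weight_def c_def)
  qed
qed

section \<open>Homogeneity of the hermitian pairing\<close>

lemma hermitian_cl_bundleD:
  assumes "hermitian_cl_bundle M n E"
  shows hermitian_vector_bundle: "vector_bundle M E"
    and hermitian_grade: "bundle_endo M E (grade E)"
    and hermitian_cliff: "i < n \<Longrightarrow> bundle_endo M E (cliff E i)"
  using assms unfolding hermitian_cl_bundle_def by simp_all

lemma herm_linear:
  assumes "hermitian_cl_bundle M n E" "u \<in> fib E p" "v \<in> fib E p" "w \<in> fib E p"
  shows "herm E p u (a *s v + w) = a * herm E p u v + herm E p u w"
    and "herm E p v u = cnj (herm E p u v)"
  using assms unfolding hermitian_cl_bundle_def by blast+

lemma herm_scaleR_right:
  assumes E: "hermitian_cl_bundle M n E" and u: "u \<in> fib E p" and v: "v \<in> fib E p"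
  shows "herm E p u (c *\<^sub>R v) = of_real c * herm E p u v"
proof -
  have 0: "0 \<in> fib E p"
    by (rule vec.subspace_0[OF fib_subspace[OF hermitian_vector_bundle[OF E]]])
  have "herm E p u 0 = 0"
    using herm_linear(1)[OF E u 0 0, of 1] by simp
  then show ?thesis
    using herm_linear(1)[OF E u v 0, of "of_real c"] by (simp add: of_real_scale_vec)
qed

lemma herm_scaleR_left:
  assumes E: "hermitian_cl_bundle M n E" and u: "u \<in> fib E p" and v: "v \<in> fib E p"
  shows "herm E p (c *\<^sub>R u) v = of_real c * herm E p u v"
  using herm_linear(2)[OF E v fib_scaleR[OF hermitian_vector_bundle[OF E] u] v, of c]
    herm_linear(2)[OF E v u v] herm_scaleR_right[OF E v u, of c] by simp

text \<open>Conjugate linearity in the first argument does no harm because the weights are real;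
  likewise the powers of the grading commute with real factors in the fiber.\<close>

lemma form_pairing_weight:
  assumes E: "hermitian_cl_bundle M n E" and uv: "\<And>i j. u i * v j = w (i + j)"
    and \<sigma>: "\<And>Xs p. \<sigma> Xs p \<in> fib E p" and \<tau>: "\<And>Xs p. \<tau> Xs p \<in> fib E p"
  shows "form_pairing E (weight u \<sigma>) (weight v \<tau>) = weight w (form_pairing E \<sigma> \<tau>)"
proof (intro ext)
  fix Xs :: "'a vfield list" and p
  let ?n = "length Xs"
  note VB = hermitian_vector_bundle[OF E] and G = hermitian_grade[OF E]
  have g: "(grade E p ^^ k) x \<in> fib E p \<and> (grade E p ^^ k) (c *\<^sub>R x) = c *\<^sub>R (grade E p ^^ k) x"
    if "x \<in> fib E p" for k x c
    using that by (induction k) (simp_all add: bundle_endo_in[OF G] bundle_endo_scaleR[OF VB G])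
  have w: "of_real (u (length (nths Xs S))) * of_real (v (length (nths Xs (- S)))) = (of_real (w ?n) :: complex)" for S
    by (simp only: uv length_nths_Compl flip: of_real_mult)
  have "herm E p ((grade E p ^^ ?n) (u (length (nths Xs S)) *\<^sub>R \<sigma> (nths Xs S) p))
        (v (length (nths Xs (- S))) *\<^sub>R \<tau> (nths Xs (- S)) p)
      = of_real (w ?n) * herm E p ((grade E p ^^ ?n) (\<sigma> (nths Xs S) p)) (\<tau> (nths Xs (- S)) p)" for S
    unfolding w[of S, symmetric]
    by (simp add: g \<sigma> \<tau> fib_scaleR[OF VB] herm_scaleR_left[OF E] herm_scaleR_right[OF E])
  then show "form_pairing E (weight u \<sigma>) (weight v \<tau>) Xs p = weight w (form_pairing E \<sigma> \<tau>) Xs p"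
    unfolding form_pairing_def weight_def Let_def
    by (simp only: scaleR_conv_of_real sum_distrib_left mult.left_commute)
qed

section \<open>Super connections and the degree filtration\<close>

lemma super_connectionD:
  assumes "super_connection M E A" "\<sigma> \<in> bundle_forms M E"
  shows super_connection_closed: "A \<sigma> \<in> bundle_forms M E"
    and super_connection_linear: "\<tau> \<in> bundle_forms M E \<Longrightarrow> A (scale_form a \<sigma> + \<tau>) = scale_form a (A \<sigma>) + A \<tau>"
    and super_connection_odd: "A (total_parity E \<sigma>) = - total_parity E (A \<sigma>)"
    and super_connection_Leibniz: "\<omega> \<in> forms M \<Longrightarrow>
      A (wedge \<omega> \<sigma>) = wedge (ext_deriv M \<omega>) \<sigma> + wedge (parity \<omega>) (A \<sigma>)"
  using assms unfolding super_connection_def by simp_all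

lemma super_connection_add:
  assumes "super_connection M E A" "\<sigma> \<in> bundle_forms M E" "\<tau> \<in> bundle_forms M E"
  shows "A (\<sigma> + \<tau>) = A \<sigma> + A \<tau>"
  using super_connection_linear[OF assms, of 1] by (simp add: scale_form_def)

lemma super_connection_zero:
  assumes "super_connection M E A"
  shows "A 0 = 0"
  using super_connection_add[OF assms bundle_forms_zero bundle_forms_zero] by simp

lemma super_connection_scale:
  assumes "super_connection M E A" "\<sigma> \<in> bundle_forms M E"
  shows "A (weight (\<lambda>_. c) \<sigma>) = weight (\<lambda>_. c) (A \<sigma>)"
  using super_connection_linear[OF assms bundle_forms_zero, of "of_real c"] super_connection_zero[OF assms(1)]
  by (simp add: scale_form_of_real)

lemma super_connection_sum:
  assumes A: "super_connection M E A" and "\<And>i. i \<in> I \<Longrightarrow> \<sigma> i \<in> bundle_forms M E"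
  shows "A (\<Sum>i\<in>I. \<sigma> i) = (\<Sum>i\<in>I. A (\<sigma> i))"
  using assms(2)
proof (induction I rule: infinite_finite_induct)
  case (insert i I)
  have "\<sigma> i \<in> bundle_forms M E" "sum \<sigma> I \<in> bundle_forms M E"
    using insert.prems by (auto intro: bundle_forms_sum)
  then show ?case
    using insert.IH insert.prems by (simp only: sum.insert[OF insert.hyps] super_connection_add[OF A] insert_iff simp_thms)
qed (simp_all add: super_connection_zero[OF A])

lemma sum_form_apply: "(\<Sum>i\<in>I. \<sigma> i) Xs p = (\<Sum>i\<in>I. (\<sigma> i :: 'a list \<Rightarrow> 'm \<Rightarrow> 'b::comm_monoid_add) Xs p)"
  by (induction I rule: infinite_finite_induct) simp_all

lemma wedge_vanish:
  assumes "\<And>Ys. length Ys \<le> length Xs \<Longrightarrow> \<omega> Ys = 0"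
  shows "wedge \<omega> \<sigma> Xs = 0"
proof
  fix p
  have "\<omega> (nths Xs S) = 0" for S
    using length_nths_Compl[of Xs S] by (intro assms) simp
  then show "wedge \<omega> \<sigma> Xs p = 0 p"
    by (simp add: wedge_def)
qed

text \<open>Each bundle valued form is a sum of products \<open>\<alpha> \<and> s\<close>, and both terms of the Leibniz rule have
  at least the degree of \<open>\<alpha>\<close>.\<close>

lemma super_connection_weight_vanish:
  assumes M: "smooth_manifold M" and A: "super_connection M E A" and "\<sigma> \<in> bundle_forms M E"
    and w: "\<And>k. k \<le> length Xs \<Longrightarrow> w k = 0"
  shows "A (weight w \<sigma>) Xs = 0"
proof -
  obtain N :: nat and \<alpha> s where "\<forall>j<N. \<alpha> j \<in> forms M" "\<forall>j<N. s j \<in> sections M E"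
    "\<forall>Xs p. \<sigma> Xs p = (\<Sum>j<N. \<alpha> j Xs p *s s j p)"
    using assms(3) by (rule bundle_formsE)
  note * = this[rule_format]
  have 1: "weight w (\<alpha> j) \<in> forms M" "section_form (s j) \<in> bundle_forms M E" if "j < N" for j
    using that by (auto intro: weight_forms[OF M] section_form_bundle_forms *)
  have vanish: "weight v \<omega> Ys = 0" if "\<And>k. k \<le> length Xs \<Longrightarrow> v k = 0" "length Ys \<le> length Xs"
    for v Ys and \<omega> :: "('a, complex) form"
    using that by (simp add: weight_def fun_eq_iff)
  \<comment> \<open>The derivative raises the degree by one, so its weight is shifted. The free
    value at 0 is chosen as 0, so that \<open>w'\<close> vanishes in all degrees where
    \<open>w\<close> is required to.\<close>
  define w' where "w' k = (case k of 0 \<Rightarrow> 0 | Suc k \<Rightarrow> w k)" for k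
  have w': "w' k = 0" if "k \<le> length Xs" for k
    using that by (cases k) (simp_all add: w'_def w)
  have vanish_j: "A (wedge (weight w (\<alpha> j)) (section_form (s j))) Xs = 0" if "j < N" for j
  proof -
    have d: "ext_deriv M (weight w (\<alpha> j)) = weight w' (ext_deriv M (\<alpha> j))"
      by (rule ext_deriv_weight[OF M]) (simp add: w'_def)
    have "wedge (ext_deriv M (weight w (\<alpha> j))) (section_form (s j)) Xs = 0"
      unfolding d by (rule wedge_vanish[OF vanish[OF w']])
    moreover have "wedge (parity (weight w (\<alpha> j))) (A (section_form (s j))) Xs = 0"
      unfolding parity_eq_weight weight_weight
      by (rule wedge_vanish[OF vanish]) (simp_all add: w)
    ultimately show ?thesis
      unfolding super_connection_Leibniz[OF A 1(2)[OF that] 1(1)[OF that]] by simp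
  qed
  have \<sigma>: "weight w \<sigma> = (\<Sum>j<N. wedge (weight w (\<alpha> j)) (section_form (s j)))"
  proof (intro ext)
    show "weight w \<sigma> Ys p = (\<Sum>j<N. wedge (weight w (\<alpha> j)) (section_form (s j))) Ys p" for Ys p
      unfolding sum_form_apply wedge_section_form
      by (simp only: weight_def *(3) scaleR_right.sum scaleR_scale_vec)
  qed
  have A_sum: "A (\<Sum>j<N. wedge (weight w (\<alpha> j)) (section_form (s j)))
      = (\<Sum>j<N. A (wedge (weight w (\<alpha> j)) (section_form (s j))))"
    by (rule super_connection_sum[OF A]) (simp add: bundle_forms_wedge[OF M] 1)
  show ?thesis
    unfolding \<sigma> A_sum fun_eq_iff sum_form_apply by (auto simp: vanish_j)
qed

text \<open>At \<open>length Xs\<close> arguments the components of larger degree contribute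
  nothing, by \<open>super_connection_weight_vanish\<close>. This cuts the expansion of
  \<open>\<sigma>\<close> into degrees down to a finite sum with an explicit bound, to which
  additivity of \<open>A\<close> applies.\<close>

lemma super_connection_weight:
  assumes M: "smooth_manifold M" and A: "super_connection M E A" and \<sigma>: "\<sigma> \<in> bundle_forms M E"
  shows "A (weight w \<sigma>) Xs p = (\<Sum>k\<le>length Xs. w k *\<^sub>R A (degree_part k \<sigma>) Xs p)"
proof -
  let ?l = "length Xs"
  define \<tau> where "\<tau> = weight (\<lambda>k. if k \<le> ?l then 0 else w k) \<sigma>"
  have D: "degree_part k \<sigma> \<in> bundle_forms M E" for k
    unfolding degree_part_eq_weight by (rule bundle_forms_weight[OF M \<sigma>])
  have S: "(\<Sum>k\<le>?l. weight (\<lambda>_. w k) (degree_part k \<sigma>)) \<in> bundle_forms M E"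
    by (intro bundle_forms_sum bundle_forms_weight[OF M] D)
  have T: "\<tau> \<in> bundle_forms M E"
    unfolding \<tau>_def by (rule bundle_forms_weight[OF M \<sigma>])
  have \<sigma>_eq: "weight w \<sigma> = (\<Sum>k\<le>?l. weight (\<lambda>_. w k) (degree_part k \<sigma>)) + \<tau>"
  proof (intro ext)
    fix Ys q
    have "(\<Sum>k\<le>?l. weight (\<lambda>_. w k) (degree_part k \<sigma>) Ys q)
        = (\<Sum>k\<le>?l. if length Ys = k then w k *\<^sub>R \<sigma> Ys q else 0)"
      by (intro sum.cong refl) (simp add: weight_def degree_part_def)
    then show "weight w \<sigma> Ys q = ((\<Sum>k\<le>?l. weight (\<lambda>_. w k) (degree_part k \<sigma>)) + \<tau>) Ys q"
      by (simp add: sum_form_apply \<tau>_def weight_def)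
  qed
  have A_sum: "A (\<Sum>k\<le>?l. weight (\<lambda>_. w k) (degree_part k \<sigma>))
      = (\<Sum>k\<le>?l. weight (\<lambda>_. w k) (A (degree_part k \<sigma>)))"
    by (simp only: super_connection_sum[OF A] bundle_forms_weight[OF M] D super_connection_scale[OF A])
  have "A \<tau> Xs = 0"
    unfolding \<tau>_def by (rule super_connection_weight_vanish[OF M A \<sigma>]) simp
  then show ?thesis
    unfolding \<sigma>_eq super_connection_add[OF A S T] A_sum plus_fun_apply sum_form_apply
    by (simp add: weight_def)
qed

text \<open>The piece \<open>A(j)\<close> leads from degree \<open>l - j\<close> to degree
  \<open>l\<close>, and its coefficient splits as
  \<open>\<mu> * inverse \<mu> ^ l * \<mu> ^ (l - j)\<close>: up to one \<open>\<mu>\<close>, a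
  factor for the target degree times a factor for the source degree.\<close>

lemma bismut_quillen_rescaling_conjugate:
  assumes M: "smooth_manifold M" and A: "super_connection M E A" and \<sigma>: "\<sigma> \<in> bundle_forms M E"
    and \<mu>: "\<mu> > 0"
  shows "bismut_quillen_rescaling \<mu> A \<sigma> = weight (\<lambda>k. \<mu> * inverse \<mu> ^ k) (A (weight (\<lambda>k. \<mu> ^ k) \<sigma>))"
proof (intro ext)
  fix Xs :: "'a vfield list" and p
  let ?l = "length Xs"
  have "bismut_quillen_rescaling \<mu> A \<sigma> Xs p
      = (\<Sum>j\<le>?l. of_real (\<mu> powi (1 - int j)) *s degree_piece A j \<sigma> Xs p)"
    unfolding bismut_quillen_rescaling_def
    by (rule suminf_finite) (simp_all add: degree_piece_def)
  also have "\<dots> = (\<Sum>j\<le>?l. \<mu> powi (1 - int j) *\<^sub>R A (degree_part (?l - j) \<sigma>) Xs p)"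
    by (rule sum.cong) (simp_all only: degree_piece_def atMost_iff if_True of_real_scale_vec)
  also have "\<dots> = (\<Sum>k\<le>?l. \<mu> powi (1 - int (?l - k)) *\<^sub>R A (degree_part k \<sigma>) Xs p)"
    by (rule sum.reindex_bij_witness[where i = "\<lambda>k. ?l - k" and j = "\<lambda>k. ?l - k"]) auto
  also have "\<dots> = (\<Sum>k\<le>?l. (\<mu> * inverse \<mu> ^ ?l) *\<^sub>R \<mu> ^ k *\<^sub>R A (degree_part k \<sigma>) Xs p)"
  proof (rule sum.cong)
    fix k assume "k \<in> {..?l}"
    then have "\<mu> powi (1 - int (?l - k)) = \<mu> * inverse \<mu> ^ ?l * \<mu> ^ k"
      using \<mu> by (simp add: of_nat_diff power_int_diff power_int_add power_inverse field_simps)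
    then show "\<mu> powi (1 - int (?l - k)) *\<^sub>R A (degree_part k \<sigma>) Xs p
        = (\<mu> * inverse \<mu> ^ ?l) *\<^sub>R \<mu> ^ k *\<^sub>R A (degree_part k \<sigma>) Xs p"
      by simp
  qed simp
  also have "\<dots> = weight (\<lambda>k. \<mu> * inverse \<mu> ^ k) (A (weight (\<lambda>k. \<mu> ^ k) \<sigma>)) Xs p"
    by (simp only: weight_def[of "\<lambda>k. \<mu> * inverse \<mu> ^ k"] super_connection_weight[OF M A \<sigma>] scaleR_right.sum)
  finally show "bismut_quillen_rescaling \<mu> A \<sigma> Xs p
      = weight (\<lambda>k. \<mu> * inverse \<mu> ^ k) (A (weight (\<lambda>k. \<mu> ^ k) \<sigma>)) Xs p" .
qed

text \<open>On vector fields multilinearity extracts one factor \<open>inverse \<mu>\<close> per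
  argument. On other lists both sides vanish, the left one because rescaling by a nonzero constant
  does not turn such a list into vector fields.\<close>

lemma RG_objects_eq_weight:
  assumes M: "smooth_manifold M" and \<mu>: "\<mu> > 0" and "\<sigma> \<in> bundle_forms M E"
  shows "RG_objects \<mu> \<sigma> = weight (\<lambda>k. inverse \<mu> ^ k) \<sigma>"
proof -
  obtain N :: nat and \<alpha> s where "\<forall>j<N. \<alpha> j \<in> forms M" "\<forall>j<N. s j \<in> sections M E"
    "\<forall>Xs p. \<sigma> Xs p = (\<Sum>j<N. \<alpha> j Xs p *s s j p)"
    using assms(3) by (rule bundle_formsE)
  note * = this[rule_format]
  let ?m = "map (vf_mult (\<lambda>_. inverse \<mu>))"
  have "\<alpha> j (?m Xs) p = inverse \<mu> ^ length Xs *\<^sub>R \<alpha> j Xs p" if "j < N" for j Xs p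
  proof (cases "set Xs \<subseteq> vfields M")
    case True
    show ?thesis
      unfolding forms_map_vf_mult_const[OF M *(1)[OF that] True] ..
  next
    case False
    then have "\<not> set (?m Xs) \<subseteq> vfields M"
      using vf_mult_const_vfields_iff[OF M, of "inverse \<mu>"] \<mu> by (auto simp: subset_iff)
    with False show ?thesis
      by (simp add: forms_outside[OF *(1)[OF that]])
  qed
  then show ?thesis
    by (simp add: RG_objects_def weight_def fun_eq_iff *(3) scaleR_right.sum scaleR_scale_vec)
qed

section \<open>Exponentials of super connections\<close>

lemma super_connection_minus:
  assumes "super_connection M E A" "\<sigma> \<in> bundle_forms M E"
  shows "A (- \<sigma>) = - A \<sigma>"
  using super_connection_scale[OF assms, of "- 1"] by (simp add: weight_def fun_Compl_def)

text \<open>The sign that \<open>odd_extension\<close> puts on the coefficient of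
  \<open>\<theta>\<close> occurs twice in \<open>A^2\<close> and cancels, while
  \<open>\<theta>A\<close> feeds the first component into the second.\<close>

lemma exponent_super_connection:
  assumes M: "smooth_manifold M" and A: "super_connection M E A" and b: "b \<in> bundle_forms M E"
  shows "exponent A t (a, b) = (weight (\<lambda>_. - t) (A (A a)), weight (\<lambda>_. - t) (A (A b)) + A a)"
proof -
  have "scale_form (- of_real t) \<sigma> = weight (\<lambda>_. - t) \<sigma>" for \<sigma> :: "('a, complex ^ 'b) form"
    using fun_cong[OF scale_form_of_real[of "- t"], of \<sigma>] by simp
  then show ?thesis
    unfolding exponent_def odd_extension.simps theta_mult.simps map_prod_simp add_Pair
      super_connection_minus[OF A super_connection_closed[OF A b]] by simp
qed

text \<open>If \<open>weight u\<close> intertwines \<open>A\<close> with \<open>B\<close> up to the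
  factor \<open>c\<close>, it intertwines the squares up to \<open>c^2\<close>, which turns
  \<open>t\<close> into \<open>c^2 t\<close>; the term \<open>\<theta>A\<close> gains one
  \<open>c\<close>, which the second component of the map absorbs. General \<open>u\<close> and
  \<open>c\<close> allow two uses: the pullback with \<open>c = \<mu>\<close>, and constants with
  \<open>c = 1\<close>.\<close>

lemma exponent_power_conjugate:
  fixes x :: "('m::{t2_space,second_countable_topology}, complex ^ 'k::finite) form \<times> ('m, complex ^ 'k) form"
  assumes M: "smooth_manifold M" and A: "super_connection M E A" and B: "super_connection M E B"
    and AB: "\<And>\<sigma>. \<sigma> \<in> bundle_forms M E \<Longrightarrow> B (weight u \<sigma>) = weight (\<lambda>k. c * u k) (A \<sigma>)"
    and x: "x \<in> bundle_forms M E \<times> bundle_forms M E"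
  shows "(exponent B t ^^ n) (map_prod (weight u) (weight (\<lambda>k. c * u k)) x)
    = map_prod (weight u) (weight (\<lambda>k. c * u k)) ((exponent A (c\<^sup>2 * t) ^^ n) x)"
proof -
  let ?F = "bundle_forms M E"
  let ?s = "c\<^sup>2 * t"
  let ?\<Phi> = "map_prod (weight u) (weight (\<lambda>k. c * u k)) :: _ \<Rightarrow> ('m, complex ^ 'k) form \<times> ('m, complex ^ 'k) form"
  have step: "exponent A ?s y \<in> ?F \<times> ?F \<and> exponent B t (?\<Phi> y) = ?\<Phi> (exponent A ?s y)" if "y \<in> ?F \<times> ?F" for y
  proof -
    obtain a b where y: "y = (a, b)"
      by (cases y)
    with that have a: "a \<in> ?F" and b: "b \<in> ?F"
      by auto
    note cl = super_connection_closed[OF A] bundle_forms_weight[OF M]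
    have cu: "weight (\<lambda>k. c * u k) \<sigma> = weight (\<lambda>_. c) (weight u \<sigma>)" for \<sigma> :: "('m, complex ^ 'k) form"
      by (simp add: weight_weight)
    have B1: "B (weight (\<lambda>k. c * u k) \<sigma>) = weight (\<lambda>k. c\<^sup>2 * u k) (A \<sigma>)" if "\<sigma> \<in> ?F" for \<sigma>
      unfolding cu super_connection_scale[OF B cl(2)[OF that]] AB[OF that]
      by (simp add: weight_weight power2_eq_square mult.assoc)
    have B2: "B (weight (\<lambda>k. c\<^sup>2 * u k) \<sigma>) = weight (\<lambda>k. c * (c\<^sup>2 * u k)) (A \<sigma>)" if "\<sigma> \<in> ?F" for \<sigma>
    proof -
      have "weight (\<lambda>k. c\<^sup>2 * u k) \<sigma> = weight (\<lambda>_. c\<^sup>2) (weight u \<sigma>)"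
        by (simp add: weight_weight)
      then show ?thesis
        using super_connection_scale[OF B cl(2)[OF that]] AB[OF that]
        by (simp add: weight_weight mult.left_commute)
    qed
    have "exponent B t (?\<Phi> y) = (weight (\<lambda>k. - t * (c\<^sup>2 * u k)) (A (A a)),
        weight (\<lambda>k. - t * (c * (c\<^sup>2 * u k))) (A (A b)) + weight (\<lambda>k. c * u k) (A a))"
      unfolding y map_prod_simp exponent_super_connection[OF M B cl(2)[OF b]]
      by (simp only: AB[OF a] B1[OF cl(1)[OF a]] B1[OF b] B2[OF cl(1)[OF b]] weight_weight)
    also have "\<dots> = ?\<Phi> (exponent A ?s y)"
      unfolding y exponent_super_connection[OF M A b] map_prod_simp weight_add weight_weight
      by (simp add: algebra_simps)
    finally show ?thesis
      unfolding y exponent_super_connection[OF M A b]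
      by (simp add: a b cl bundle_forms_add)
  qed
  \<comment> \<open>The induction carries along membership in the bundle valued forms, where alone
    the intertwining relation is available.\<close>
  have "(exponent A ?s ^^ n) x \<in> ?F \<times> ?F \<and> (exponent B t ^^ n) (?\<Phi> x) = ?\<Phi> ((exponent A ?s ^^ n) x)"
  proof (induction n)
    case 0
    show ?case using x by simp
  next
    case (Suc n)
    then show ?case
      using step[of "(exponent A ?s ^^ n) x"] by simp
  qed
  then show ?thesis
    by blast
qed

text \<open>At fixed arguments and a fixed point \<open>weight u\<close> is multiplication by a real
  number, so convergence of the series for \<open>A\<close> at time \<open>c^2 t\<close> carries
  over term by term.\<close>

lemma associated_rep_conjugate_sums:
  assumes M: "smooth_manifold M" and A: "super_connection M E A" and B: "super_connection M E B"
    and AB: "\<And>\<sigma>. \<sigma> \<in> bundle_forms M E \<Longrightarrow> B (weight u \<sigma>) = weight (\<lambda>k. c * u k) (A \<sigma>)"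
    and \<rho>: "associated_rep M E A \<rho>" and \<sigma>: "\<sigma> \<in> bundle_forms M E" and t: "t \<ge> 0"
  shows "(\<lambda>k. (1 / fact k) *\<^sub>R fst ((exponent B t ^^ k) (weight u \<sigma>, 0)) Xs p)
      sums weight u (fst (\<rho> \<sigma> (c\<^sup>2 * t))) Xs p"
    and "(\<lambda>k. (1 / fact k) *\<^sub>R snd ((exponent B t ^^ k) (weight u \<sigma>, 0)) Xs p)
      sums weight (\<lambda>k. c * u k) (snd (\<rho> \<sigma> (c\<^sup>2 * t))) Xs p"
proof -
  have zero: "weight w 0 = (0 :: ('a, complex ^ 'b) form)" for w
    by (simp add: weight_def zero_fun_def)
  have "(\<sigma>, 0) \<in> bundle_forms M E \<times> bundle_forms M E"
    using \<sigma> bundle_forms_zero by blast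
  from exponent_power_conjugate[OF M A B AB this]
  have pow: "(exponent B t ^^ k) (weight u \<sigma>, 0)
      = map_prod (weight u) (weight (\<lambda>k. c * u k)) ((exponent A (c\<^sup>2 * t) ^^ k) (\<sigma>, 0))" for k
    by (simp only: map_prod_simp zero)
  have "c\<^sup>2 * t \<ge> 0"
    using t by simp
  then have "(\<lambda>k. (1 / fact k) *\<^sub>R fst ((exponent A (c\<^sup>2 * t) ^^ k) (\<sigma>, 0)) Xs p) sums fst (\<rho> \<sigma> (c\<^sup>2 * t)) Xs p"
    and "(\<lambda>k. (1 / fact k) *\<^sub>R snd ((exponent A (c\<^sup>2 * t) ^^ k) (\<sigma>, 0)) Xs p) sums snd (\<rho> \<sigma> (c\<^sup>2 * t)) Xs p"
    using \<rho>[unfolded associated_rep_def, rule_format, OF \<sigma>] by blast+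
  note this[THEN sums_scaleR_right]
  note 1 = this(1)[of "u (length Xs)"] and 2 = this(2)[of "c * u (length Xs)"]
  show "(\<lambda>k. (1 / fact k) *\<^sub>R fst ((exponent B t ^^ k) (weight u \<sigma>, 0)) Xs p)
      sums weight u (fst (\<rho> \<sigma> (c\<^sup>2 * t))) Xs p"
    using 1 unfolding pow by (simp add: weight_def mult.commute)
  show "(\<lambda>k. (1 / fact k) *\<^sub>R snd ((exponent B t ^^ k) (weight u \<sigma>, 0)) Xs p)
      sums weight (\<lambda>k. c * u k) (snd (\<rho> \<sigma> (c\<^sup>2 * t))) Xs p"
    using 2 unfolding pow by (simp add: weight_def mult.commute)
qed

text \<open>Constants commute with \<open>A\<close>, so this is the intertwining with
  \<open>B = A\<close> and \<open>c = 1\<close>, followed by uniqueness of limits. It serves the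
  composition law, where the coefficient of \<open>\<theta>'\<close> carries a factor
  \<open>\<mu>\<close> into the second application of \<open>\<rho>\<close>.\<close>

lemma associated_rep_scale:
  assumes M: "smooth_manifold M" and A: "super_connection M E A" and \<rho>: "associated_rep M E A \<rho>"
    and \<sigma>: "\<sigma> \<in> bundle_forms M E" and t: "t \<ge> 0"
  shows "\<rho> (weight (\<lambda>_. c) \<sigma>) t = map_prod (weight (\<lambda>_. c)) (weight (\<lambda>_. c)) (\<rho> \<sigma> t)"
proof -
  have A': "A (weight (\<lambda>_. c) \<tau>) = weight (\<lambda>k. 1 * c) (A \<tau>)" if "\<tau> \<in> bundle_forms M E" for \<tau>
    using super_connection_scale[OF A that] by simp
  have c\<sigma>: "weight (\<lambda>_. c) \<sigma> \<in> bundle_forms M E"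
    by (rule bundle_forms_weight[OF M \<sigma>])
  note 1 = associated_rep_conjugate_sums[OF M A A A' \<rho> \<sigma> t, unfolded power_one mult_1]
  have 2: "(\<lambda>k. (1 / fact k) *\<^sub>R fst ((exponent A t ^^ k) (weight (\<lambda>_. c) \<sigma>, 0)) Xs p)
        sums fst (\<rho> (weight (\<lambda>_. c) \<sigma>) t) Xs p"
    "(\<lambda>k. (1 / fact k) *\<^sub>R snd ((exponent A t ^^ k) (weight (\<lambda>_. c) \<sigma>, 0)) Xs p)
        sums snd (\<rho> (weight (\<lambda>_. c) \<sigma>) t) Xs p" for Xs p
    using \<rho>[unfolded associated_rep_def, rule_format, OF c\<sigma> t] by blast+
  show ?thesis
    by (intro prod_eqI ext) (simp_all add: sums_unique2[OF 2(1) 1(1)] sums_unique2[OF 2(2) 1(2)])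
qed

section \<open>The renormalization group action\<close>

locale renormalization =
  fixes M :: "('m::{t2_space,second_countable_topology}) manifold"
    and E :: "('m, 'k::finite) cl_bundle" and n :: nat and \<mu> :: real
  assumes M: "smooth_manifold M" and E: "hermitian_cl_bundle M n E" and \<mu>: "\<mu> > 0"
begin

abbreviation forms_E :: "('m, complex ^ 'k) form set" ("\<Omega>") where
  "\<Omega> \<equiv> bundle_forms M E"

abbreviation pull :: "('m, 'b::real_vector) form \<Rightarrow> ('m, 'b) form" where
  "pull \<equiv> weight (\<lambda>k. inverse \<mu> ^ k)"

abbreviation push :: "('m, 'b::real_vector) form \<Rightarrow> ('m, 'b) form" where
  "push \<equiv> weight (\<lambda>k. \<mu> ^ k)"

text \<open>The weight of everything that enters with one factor \<open>\<mu>\<close>: the rescaled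
  super connection, the exterior derivative of a pullback, and the coefficient of
  \<open>\<theta>\<close>.\<close>

abbreviation scaled_pull :: "('m, 'b::real_vector) form \<Rightarrow> ('m, 'b) form" where
  "scaled_pull \<equiv> weight (\<lambda>k. \<mu> * inverse \<mu> ^ k)"

lemma pull_push: "pull (push \<sigma>) = \<sigma>"
  using \<mu> by (simp add: weight_weight flip: power_mult_distrib)

lemma push_pull: "push (pull \<sigma>) = \<sigma>"
  using \<mu> by (simp add: weight_weight flip: power_mult_distrib)

lemma scaled_pull_eq: "scaled_pull \<sigma> = weight (\<lambda>_. \<mu>) (pull \<sigma>)" "scaled_pull \<sigma> = pull (weight (\<lambda>_. \<mu>) \<sigma>)"
  by (simp_all add: weight_weight mult.commute)

lemma vector_bundle_E: "vector_bundle M E"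
  by (rule hermitian_vector_bundle[OF E])

lemmas grade_E = hermitian_grade[OF E]

lemmas in_fib = bundle_forms_in_fib[OF vector_bundle_E]

lemmas weight_closed = bundle_forms_weight[OF M]

text \<open>Reduces every statement about the rescaled data to pullbacks, where the original
  identity can be used.\<close>

lemma pull_cases:
  assumes "\<sigma> \<in> \<Omega>"
  obtains \<sigma>' where "\<sigma>' \<in> \<Omega>" "\<sigma> = pull \<sigma>'"
  by (rule that[OF weight_closed[OF assms, of "\<lambda>k. \<mu> ^ k"]]) (simp only: pull_push)

lemma forms_pull_cases:
  assumes "\<omega> \<in> forms M"
  obtains \<omega>' where "\<omega>' \<in> forms M" "\<omega> = pull \<omega>'"
  by (rule that[OF weight_forms[OF M assms, of "\<lambda>k. \<mu> ^ k"]]) (simp only: pull_push)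

lemmas total_parity_weight_E = total_parity_weight[OF vector_bundle_E grade_E in_fib]

lemmas total_parity_closed = bundle_forms_total_parity[OF M vector_bundle_E grade_E]

lemma pull_wedge: "pull (wedge \<omega> \<sigma>) = wedge (pull \<omega>) (pull \<sigma>)"
  by (rule wedge_weight[symmetric]) (simp add: power_add)

lemma scaled_pull_wedge:
  "scaled_pull (wedge \<omega> \<sigma>) = wedge (scaled_pull \<omega>) (pull \<sigma>)"
  "scaled_pull (wedge \<omega> \<sigma>) = wedge (pull \<omega>) (scaled_pull \<sigma>)"
  by (rule wedge_weight[symmetric]; simp add: power_add)+

text \<open>The shift of the degree produces the extra factor, as
  \<open>\<mu> * inverse \<mu> ^ Suc k = inverse \<mu> ^ k\<close>.\<close>

lemma ext_deriv_pull: "ext_deriv M (pull \<omega>) = scaled_pull (ext_deriv M \<omega>)"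
  by (rule ext_deriv_weight[OF M]) (use \<mu> in simp)

lemma parity_pull: "parity (pull \<omega>) = pull (parity \<omega>)"
  by (simp add: parity_eq_weight weight_weight mult.commute)

lemma pairing_pull:
  assumes "\<sigma> \<in> \<Omega>" "\<tau> \<in> \<Omega>"
  shows "form_pairing E (pull \<sigma>) (pull \<tau>) = pull (form_pairing E \<sigma> \<tau>)"
    and "form_pairing E (scaled_pull \<sigma>) (pull \<tau>) = scaled_pull (form_pairing E \<sigma> \<tau>)"
    and "form_pairing E (pull \<sigma>) (scaled_pull \<tau>) = scaled_pull (form_pairing E \<sigma> \<tau>)"
  by (rule form_pairing_weight[OF E _ in_fib[OF assms(1)] in_fib[OF assms(2)]]; simp add: power_add)+

text \<open>The relation \<open>B W = \<mu> W A\<close>, through which alone the rescaled operator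
  is used from here on.\<close>

lemma rescaling_pull:
  assumes "super_connection M E A" "\<sigma> \<in> \<Omega>"
  shows "bismut_quillen_rescaling \<mu> A (pull \<sigma>) = scaled_pull (A \<sigma>)"
  unfolding bismut_quillen_rescaling_conjugate[OF M assms(1) weight_closed[OF assms(2)] \<mu>] push_pull ..

text \<open>In the Leibniz rule the term with the exterior derivative and the term with the
  connection gain the same factor \<open>\<mu>\<close>; this corresponds to the coefficient 1 of
  \<open>A(1)\<close> in the rescaling.\<close>

lemma super_connection_rescaling:
  assumes A: "super_connection M E A"
  shows "super_connection M E (bismut_quillen_rescaling \<mu> A)"
  unfolding super_connection_def
proof (intro conjI ballI allI)
  let ?B = "bismut_quillen_rescaling \<mu> A"
  note closed = super_connection_closed[OF A]
  fix \<sigma> assume "\<sigma> \<in> \<Omega>"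
  then obtain \<sigma>' where \<sigma>': "\<sigma>' \<in> \<Omega>" "\<sigma> = pull \<sigma>'"
    by (rule pull_cases)
  show "?B \<sigma> \<in> \<Omega>"
    unfolding \<sigma>'(2) rescaling_pull[OF A \<sigma>'(1)] by (rule weight_closed[OF closed[OF \<sigma>'(1)]])
  show "?B (total_parity E \<sigma>) = - total_parity E (?B \<sigma>)"
    unfolding \<sigma>'(2) total_parity_weight_E[OF \<sigma>'(1)] rescaling_pull[OF A total_parity_closed[OF \<sigma>'(1)]]
      rescaling_pull[OF A \<sigma>'(1)] super_connection_odd[OF A \<sigma>'(1)] weight_minus
      total_parity_weight_E[OF closed[OF \<sigma>'(1)]] ..
  show "?B (scale_form a \<sigma> + \<tau>) = scale_form a (?B \<sigma>) + ?B \<tau>" if \<tau>: "\<tau> \<in> \<Omega>" for a \<tau>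
  proof -
    obtain \<tau>' where \<tau>': "\<tau>' \<in> \<Omega>" "\<tau> = pull \<tau>'"
      using \<tau> by (rule pull_cases)
    have scale: "scale_form a (weight w \<alpha>) = weight w (scale_form a \<alpha>)" for w and \<alpha> :: "('m, complex ^ 'k) form"
      by (simp add: scale_form_def weight_def fun_eq_iff vec_eq_iff)
    have "scale_form a \<sigma>' + \<tau>' \<in> \<Omega>"
      by (intro bundle_forms_add bundle_forms_scale M \<sigma>'(1) \<tau>'(1))
    then have "?B (pull (scale_form a \<sigma>' + \<tau>')) = scaled_pull (A (scale_form a \<sigma>' + \<tau>'))"
      by (rule rescaling_pull[OF A])
    then show ?thesis
      unfolding \<sigma>'(2) \<tau>'(2) rescaling_pull[OF A \<sigma>'(1)] rescaling_pull[OF A \<tau>'(1)]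
        super_connection_linear[OF A \<sigma>'(1) \<tau>'(1)] weight_add scale .
  qed
  show "?B (wedge \<omega> \<sigma>) = wedge (ext_deriv M \<omega>) \<sigma> + wedge (parity \<omega>) (?B \<sigma>)" if \<omega>: "\<omega> \<in> forms M" for \<omega>
  proof -
    obtain \<omega>' where \<omega>': "\<omega>' \<in> forms M" "\<omega> = pull \<omega>'"
      using \<omega> by (rule forms_pull_cases)
    show ?thesis
      unfolding \<sigma>'(2) \<omega>'(2) pull_wedge[symmetric] rescaling_pull[OF A bundle_forms_wedge[OF M \<omega>'(1) \<sigma>'(1)]]
        super_connection_Leibniz[OF A \<sigma>'(1) \<omega>'(1)] weight_add ext_deriv_pull parity_pull
        rescaling_pull[OF A \<sigma>'(1)]
      by (simp only: scaled_pull_wedge(1)[of "ext_deriv M \<omega>'"] scaled_pull_wedge(2)[of "parity \<omega>'"])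
  qed
qed

text \<open>All three terms of the unitarity equation become \<open>scaled_pull\<close> of the
  original ones: \<open>A\<close> acts once in two of them and the exterior derivative once in the
  third.\<close>

lemma unitary_cl_super_connection_rescaling:
  assumes A: "unitary_cl_super_connection M n E A"
  shows "unitary_cl_super_connection M n E (bismut_quillen_rescaling \<mu> A)"
proof -
  let ?B = "bismut_quillen_rescaling \<mu> A"
  note A' = A[unfolded unitary_cl_super_connection_def unitary_super_connection_def]
  have sc: "super_connection M E A"
    by (rule A'[THEN conjunct1, THEN conjunct1])
  have unitary: "form_pairing E (A \<sigma>) \<tau> + ext_deriv M (form_pairing E (total_parity E \<sigma>) \<tau>) = form_pairing E \<sigma> (A \<tau>)"
      if "\<sigma> \<in> \<Omega>" "\<tau> \<in> \<Omega>" for \<sigma> \<tau>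
    by (rule A'[THEN conjunct1, THEN conjunct2, rule_format, OF that])
  have cl: "A (cliff_act E i \<sigma>) = - cliff_act E i (A \<sigma>)" if "i < n" "\<sigma> \<in> \<Omega>" for i \<sigma>
    by (rule A'[THEN conjunct2, rule_format, OF that])
  note closed = super_connection_closed[OF sc]
  have "form_pairing E (?B \<sigma>) \<tau> + ext_deriv M (form_pairing E (total_parity E \<sigma>) \<tau>) = form_pairing E \<sigma> (?B \<tau>)"
    if \<sigma>: "\<sigma> \<in> \<Omega>" and \<tau>: "\<tau> \<in> \<Omega>" for \<sigma> \<tau>
  proof -
    obtain \<sigma>' where \<sigma>': "\<sigma>' \<in> \<Omega>" "\<sigma> = pull \<sigma>'"
      using \<sigma> by (rule pull_cases)
    obtain \<tau>' where \<tau>': "\<tau>' \<in> \<Omega>" "\<tau> = pull \<tau>'"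
      using \<tau> by (rule pull_cases)
    have "form_pairing E (?B \<sigma>) \<tau> + ext_deriv M (form_pairing E (total_parity E \<sigma>) \<tau>)
        = scaled_pull (form_pairing E (A \<sigma>') \<tau>' + ext_deriv M (form_pairing E (total_parity E \<sigma>') \<tau>'))"
      by (simp only: \<sigma>'(2) \<tau>'(2) rescaling_pull[OF sc \<sigma>'(1)] total_parity_weight_E[OF \<sigma>'(1)]
          pairing_pull(1)[OF total_parity_closed[OF \<sigma>'(1)] \<tau>'(1)]
          pairing_pull(2)[OF closed[OF \<sigma>'(1)] \<tau>'(1)] ext_deriv_pull weight_add)
    also have "\<dots> = scaled_pull (form_pairing E \<sigma>' (A \<tau>'))"
      by (simp only: unitary[OF \<sigma>'(1) \<tau>'(1)])
    also have "\<dots> = form_pairing E \<sigma> (?B \<tau>)"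
      by (simp only: \<sigma>'(2) \<tau>'(2) rescaling_pull[OF sc \<tau>'(1)] pairing_pull(3)[OF \<sigma>'(1) closed[OF \<tau>'(1)]])
    finally show ?thesis .
  qed
  moreover have "?B (cliff_act E i \<sigma>) = - cliff_act E i (?B \<sigma>)" if i: "i < n" and \<sigma>: "\<sigma> \<in> \<Omega>" for i \<sigma>
  proof -
    obtain \<sigma>' where \<sigma>': "\<sigma>' \<in> \<Omega>" "\<sigma> = pull \<sigma>'"
      using \<sigma> by (rule pull_cases)
    note C = hermitian_cliff[OF E i]
    note cliff_weight = cliff_act_weight[OF vector_bundle_E C in_fib]
    have "?B (cliff_act E i \<sigma>) = scaled_pull (A (cliff_act E i \<sigma>'))"
      by (simp only: \<sigma>'(2) cliff_weight[OF \<sigma>'(1)]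
          rescaling_pull[OF sc bundle_forms_cliff_act[OF M vector_bundle_E C \<sigma>'(1)]])
    also have "\<dots> = - cliff_act E i (?B \<sigma>)"
      by (simp only: \<sigma>'(2) cl[OF i \<sigma>'(1)] weight_minus rescaling_pull[OF sc \<sigma>'(1)]
          cliff_weight[OF closed[OF \<sigma>'(1)]])
    finally show ?thesis .
  qed
  ultimately show ?thesis
    unfolding unitary_cl_super_connection_def unitary_super_connection_def
    by (intro conjI ballI allI impI super_connection_rescaling[OF sc])
qed

end

section \<open>Smooth families over the half line and homomorphism sections\<close>

lemma trivialization_scaleR:
  assumes E: "vector_bundle M E" and \<Phi>: "(U, r, \<Phi>) \<in> trivs E" and p: "p \<in> U" and v: "v \<in> fib E p"
  shows "\<Phi> p (c *\<^sub>R v) i = c *\<^sub>R \<Phi> p v i"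
proof -
  have lin: "\<Phi> p (a *s x + y) = (\<lambda>i. a * \<Phi> p x i + \<Phi> p y i)" if "x \<in> fib E p" "y \<in> fib E p" for a x y
    using bspec[OF conjunct1[OF conjunct2[OF E[unfolded vector_bundle_def]]] \<Phi>] p that by simp
  have 0: "0 \<in> fib E p"
    by (rule vec.subspace_0[OF fib_subspace[OF E]])
  have "\<Phi> p 0 i = 0"
    using fun_cong[OF lin[OF 0 0, of 1], of i] by simp
  then show ?thesis
    using fun_cong[OF lin[OF v 0, of "of_real c"], of i] by (simp add: of_real_scale_vec scaleR_conv_of_real)
qed

text \<open>In a trivialization the family extends smoothly to all real \<open>t\<close>; the
  extension of the new family is the old one at \<open>m * t\<close> times the weight of the degree.
  The weight is a parameter because the coefficients of \<open>1\<close> and \<open>\<theta>\<close>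
  are rescaled differently.\<close>

lemma smooth_half_line_family_weight:
  assumes M: "smooth_manifold M" and E: "vector_bundle M E" and F: "smooth_half_line_family M E F"
    and m: "m \<ge> 0" and F': "\<And>t. t \<ge> 0 \<Longrightarrow> F' t = weight w (F (m * t))"
  shows "smooth_half_line_family M E F'"
  unfolding smooth_half_line_family_def
proof (intro conjI allI impI ballI)
  have F_closed: "F t \<in> bundle_forms M E" if "t \<ge> 0" for t
    using F that unfolding smooth_half_line_family_def by simp
  show "F' t \<in> bundle_forms M E" if "t \<ge> 0" for t
    unfolding F'[OF that] using m that by (intro bundle_forms_weight[OF M] F_closed) simp
  fix Xs T assume Xs: "set Xs \<subseteq> vfields M" and T: "T \<in> trivs E"
  obtain U r \<Phi> where T_eq: "T = (U, r, \<Phi>)"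
    by (cases T)
  have U: "open U"
    using bspec[OF conjunct1[OF conjunct2[OF E[unfolded vector_bundle_def]]] T] unfolding T_eq by simp
  have "\<exists>G. smooth_on_line_times M U G \<and> (\<forall>t\<ge>0. \<forall>p\<in>U. G t p = \<Phi> p (F' t Xs p) i)" if i: "i < r" for i
  proof -
    obtain G where G: "smooth_on_line_times M U G" "\<forall>t\<ge>0. \<forall>p\<in>U. G t p = \<Phi> p (F t Xs p) i"
      using F[unfolded smooth_half_line_family_def, THEN conjunct2, rule_format, OF Xs T] i
      unfolding T_eq by auto
    have "w (length Xs) *\<^sub>R G (m * t) p = \<Phi> p (F' t Xs p) i" if "t \<ge> 0" "p \<in> U" for t p
    proof -
      have mt: "m * t \<ge> 0"
        using m that by simp
      show ?thesis
        unfolding F'[OF that(1)] weight_def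
          trivialization_scaleR[OF E T[unfolded T_eq] that(2) bundle_forms_in_fib[OF E F_closed[OF mt]]]
        using G(2) mt that(2) by simp
    qed
    then show ?thesis
      using smooth_on_line_times_scale[OF M U G(1), of "w (length Xs)" m] by blast
  qed
  then show "case T of (U, r, \<Phi>) \<Rightarrow> \<forall>i<r. \<exists>G. smooth_on_line_times M U G \<and>
      (\<forall>t\<ge>0. \<forall>p\<in>U. G t p = \<Phi> p (F' t Xs p) i)"
    unfolding T_eq by simp
qed

lemma hom_sectionD:
  assumes "hom_section M E \<rho>" "\<sigma> \<in> bundle_forms M E"
  shows hom_section_smooth_fst: "smooth_half_line_family M E (\<lambda>t. fst (\<rho> \<sigma> t))"
    and hom_section_smooth_snd: "smooth_half_line_family M E (\<lambda>t. snd (\<rho> \<sigma> t))"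
    and hom_section_parity: "t \<ge> 0 \<Longrightarrow> \<rho> (total_parity E \<sigma>) t = odd_extension (total_parity E) (\<rho> \<sigma> t)"
    and hom_section_add: "t \<ge> 0 \<Longrightarrow> \<tau> \<in> bundle_forms M E \<Longrightarrow> \<rho> (\<sigma> + \<tau>) t = \<rho> \<sigma> t + \<rho> \<tau> t"
    and hom_section_wedge: "t \<ge> 0 \<Longrightarrow> \<omega> \<in> forms M \<Longrightarrow>
      \<rho> (wedge \<omega> \<sigma>) t = theta_wedge (target_pullback M \<omega>) (\<rho> \<sigma> t)"
proof -
  note \<rho> = bspec[OF assms(1)[unfolded hom_section_def] assms(2)]
  show "smooth_half_line_family M E (\<lambda>t. fst (\<rho> \<sigma> t))" "smooth_half_line_family M E (\<lambda>t. snd (\<rho> \<sigma> t))"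
    using \<rho> by simp_all
  note \<rho> = \<rho>[THEN conjunct2, THEN conjunct2]
  show "t \<ge> 0 \<Longrightarrow> \<rho> (total_parity E \<sigma>) t = odd_extension (total_parity E) (\<rho> \<sigma> t)"
    by (rule \<rho>[THEN conjunct1, rule_format])
  note \<rho> = \<rho>[THEN conjunct2]
  show "t \<ge> 0 \<Longrightarrow> \<tau> \<in> bundle_forms M E \<Longrightarrow> \<rho> (\<sigma> + \<tau>) t = \<rho> \<sigma> t + \<rho> \<tau> t"
    by (rule \<rho>[THEN conjunct1, rule_format])
  show "t \<ge> 0 \<Longrightarrow> \<omega> \<in> forms M \<Longrightarrow> \<rho> (wedge \<omega> \<sigma>) t = theta_wedge (target_pullback M \<omega>) (\<rho> \<sigma> t)"
    by (rule \<rho>[THEN conjunct2, rule_format])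
qed

lemma hom_section_closed:
  assumes "hom_section M E \<rho>" "\<sigma> \<in> bundle_forms M E" "t \<ge> 0"
  shows "fst (\<rho> \<sigma> t) \<in> bundle_forms M E" and "snd (\<rho> \<sigma> t) \<in> bundle_forms M E"
  using hom_section_smooth_fst[OF assms(1,2)] hom_section_smooth_snd[OF assms(1,2)] assms(3)
  unfolding smooth_half_line_family_def by simp_all

lemma odd_extension_map_prod:
  assumes "L (f (fst x)) = f (L (fst x))" "L (g (snd x)) = g (L (snd x))" "\<And>y. g (- y) = - g y"
  shows "odd_extension L (map_prod f g x) = map_prod f g (odd_extension L x)"
  using assms by (cases x) simp

section \<open>Pullback of representations along the renormalization functor\<close>

context renormalization
begin

lemma RG_objects_pull: "\<sigma> \<in> \<Omega> \<Longrightarrow> RG_objects \<mu> \<sigma> = pull \<sigma>"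
  by (rule RG_objects_eq_weight[OF M \<mu>])

text \<open>\<open>RG_action\<close> recovers \<open>\<sigma>\<close> by choosing a preimage, and
  the choice is determined because \<open>push\<close> inverts the pullback on
  \<open>\<Omega>\<close>.\<close>

lemma inv_RG_objects_pull:
  assumes "\<sigma> \<in> \<Omega>"
  shows "inv_into \<Omega> (RG_objects \<mu>) (pull \<sigma>) = \<sigma>"
proof (rule inv_into_f_eq)
  show "inj_on (RG_objects \<mu>) \<Omega>"
  proof (rule inj_onI)
    fix \<sigma> \<tau> assume "\<sigma> \<in> \<Omega>" "\<tau> \<in> \<Omega>" "RG_objects \<mu> \<sigma> = RG_objects \<mu> \<tau>"
    then have "push (pull \<sigma>) = push (pull \<tau>)"
      by (simp only: RG_objects_pull)
    then show "\<sigma> = \<tau>"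
      by (simp only: push_pull)
  qed
qed (simp_all only: assms RG_objects_pull)

text \<open>The substitution of \<open>\<mu>\<theta>\<close> for \<open>\<theta>\<close> accounts
  for \<open>scaled_pull\<close> on the second component. For \<open>t \<ge> 0\<close> the values of
  \<open>\<rho>\<close> are bundle valued forms, on which \<open>RG_objects\<close> is a
  weight.\<close>

lemma RG_action_pull:
  assumes \<rho>: "hom_section M E \<rho>" and \<sigma>: "\<sigma> \<in> \<Omega>" and t: "t \<ge> 0"
  shows "RG_action M E \<mu> \<rho> (pull \<sigma>) t = map_prod pull scaled_pull (\<rho> \<sigma> (\<mu>\<^sup>2 * t))"
proof -
  have "\<mu>\<^sup>2 * t \<ge> 0"
    using t by simp
  note closed = hom_section_closed[OF \<rho> \<sigma> this]
  show ?thesis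
    unfolding RG_action_def RG_morphisms_def inv_RG_objects_pull[OF \<sigma>] RG_objects_pull[OF closed(1)]
      RG_objects_pull[OF closed(2)] scale_form_of_real scaled_pull_eq(1)[symmetric]
    by (simp add: map_prod_def case_prod_beta)
qed

text \<open>Compatibility of the functor with target maps: the target pullback is
  \<open>f + \<theta> df\<close>, and the factor that \<open>d\<close> gains on a pullback is the
  one that \<open>\<theta>\<close> gains on morphisms.\<close>

lemma theta_wedge_pull:
  "theta_wedge (target_pullback M (pull \<omega>)) (map_prod pull scaled_pull x)
    = map_prod pull scaled_pull (theta_wedge (target_pullback M \<omega>) x)"
proof -
  obtain a b where x: "x = (a, b)"
    by (cases x)
  show ?thesis
    unfolding x target_pullback_def map_prod_simp theta_wedge.simps ext_deriv_pull parity_pull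
      weight_add pull_wedge[of \<omega>] scaled_pull_wedge(1)[of "ext_deriv M \<omega>"]
      scaled_pull_wedge(2)[of "parity \<omega>"] ..
qed

lemma hom_section_RG_action:
  assumes \<rho>: "hom_section M E \<rho>"
  shows "hom_section M E (RG_action M E \<mu> \<rho>)"
  unfolding hom_section_def
proof (intro ballI conjI allI impI)
  let ?\<rho> = "RG_action M E \<mu> \<rho>"
  fix \<sigma> assume "\<sigma> \<in> \<Omega>"
  then obtain \<sigma>' where \<sigma>': "\<sigma>' \<in> \<Omega>" "\<sigma> = pull \<sigma>'"
    by (rule pull_cases)
  note RG = RG_action_pull[OF \<rho>]
  show "smooth_half_line_family M E (\<lambda>t. fst (?\<rho> \<sigma> t))"
    by (rule smooth_half_line_family_weight[OF M vector_bundle_E hom_section_smooth_fst[OF \<rho> \<sigma>'(1)], of "\<mu>\<^sup>2"])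
      (simp_all add: \<sigma>'(2) RG[OF \<sigma>'(1)])
  show "smooth_half_line_family M E (\<lambda>t. snd (?\<rho> \<sigma> t))"
    by (rule smooth_half_line_family_weight[OF M vector_bundle_E hom_section_smooth_snd[OF \<rho> \<sigma>'(1)], of "\<mu>\<^sup>2"])
      (simp_all add: \<sigma>'(2) RG[OF \<sigma>'(1)])
  fix t :: real assume t: "t \<ge> 0"
  then have mt: "\<mu>\<^sup>2 * t \<ge> 0"
    by simp
  note closed = hom_section_closed[OF \<rho> \<sigma>'(1) mt]
  show "?\<rho> (total_parity E \<sigma>) t = odd_extension (total_parity E) (?\<rho> \<sigma> t)"
  proof -
    have "?\<rho> (total_parity E \<sigma>) t = map_prod pull scaled_pull (\<rho> (total_parity E \<sigma>') (\<mu>\<^sup>2 * t))"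
      by (simp only: \<sigma>'(2) total_parity_weight_E[OF \<sigma>'(1)] RG[OF total_parity_closed[OF \<sigma>'(1)] t])
    also have "\<dots> = odd_extension (total_parity E) (map_prod pull scaled_pull (\<rho> \<sigma>' (\<mu>\<^sup>2 * t)))"
      unfolding hom_section_parity[OF \<rho> \<sigma>'(1) mt]
      by (rule odd_extension_map_prod[symmetric])
        (simp_all only: total_parity_weight_E[OF closed(1)] total_parity_weight_E[OF closed(2)] weight_minus)
    finally show ?thesis
      by (simp only: \<sigma>'(2) RG[OF \<sigma>'(1) t])
  qed
  show "?\<rho> (\<sigma> + \<tau>) t = ?\<rho> \<sigma> t + ?\<rho> \<tau> t" if \<tau>: "\<tau> \<in> \<Omega>" for \<tau>
  proof -
    obtain \<tau>' where \<tau>': "\<tau>' \<in> \<Omega>" "\<tau> = pull \<tau>'"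
      using \<tau> by (rule pull_cases)
    have "?\<rho> (pull (\<sigma>' + \<tau>')) t = map_prod pull scaled_pull (\<rho> \<sigma>' (\<mu>\<^sup>2 * t) + \<rho> \<tau>' (\<mu>\<^sup>2 * t))"
      by (simp only: RG[OF bundle_forms_add[OF \<sigma>'(1) \<tau>'(1)] t] hom_section_add[OF \<rho> \<sigma>'(1) mt \<tau>'(1)])
    also have "\<dots> = map_prod pull scaled_pull (\<rho> \<sigma>' (\<mu>\<^sup>2 * t)) + map_prod pull scaled_pull (\<rho> \<tau>' (\<mu>\<^sup>2 * t))"
      by (intro prod_eqI) (simp_all only: fst_add snd_add fst_map_prod snd_map_prod weight_add)
    finally show ?thesis
      by (simp only: \<sigma>'(2) \<tau>'(2) weight_add RG[OF \<sigma>'(1) t] RG[OF \<tau>'(1) t])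
  qed
  show "?\<rho> (wedge \<omega> \<sigma>) t = theta_wedge (target_pullback M \<omega>) (?\<rho> \<sigma> t)" if \<omega>: "\<omega> \<in> forms M" for \<omega>
  proof -
    obtain \<omega>' where \<omega>': "\<omega>' \<in> forms M" "\<omega> = pull \<omega>'"
      using \<omega> by (rule forms_pull_cases)
    have "?\<rho> (wedge \<omega> \<sigma>) t = map_prod pull scaled_pull (\<rho> (wedge \<omega>' \<sigma>') (\<mu>\<^sup>2 * t))"
      by (simp only: \<sigma>'(2) \<omega>'(2) pull_wedge[symmetric] RG[OF bundle_forms_wedge[OF M \<omega>'(1) \<sigma>'(1)] t])
    also have "\<dots> = theta_wedge (target_pullback M \<omega>) (?\<rho> \<sigma> t)"
      by (simp only: \<sigma>'(2) \<omega>'(2) RG[OF \<sigma>'(1) t] hom_section_wedge[OF \<rho> \<sigma>'(1) mt \<omega>'(1)] theta_wedge_pull)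
    finally show ?thesis .
  qed
qed

text \<open>In the composition law the coefficient of \<open>\<theta>\<theta>'\<close> gains
  \<open>\<mu>^2\<close>, and so does the time derivative after \<open>t\<close> is replaced by
  \<open>\<mu>^2 t\<close>. The coefficients of \<open>\<theta>\<close> and \<open>\<theta>'\<close>
  gain \<open>\<mu>\<close> on both sides.\<close>

lemma representation_RG_action:
  assumes \<rho>: "representation M E \<rho>"
    and scale: "\<And>\<sigma> t c. \<sigma> \<in> \<Omega> \<Longrightarrow> t \<ge> 0 \<Longrightarrow>
      \<rho> (weight (\<lambda>_. c) \<sigma>) t = map_prod (weight (\<lambda>_. c)) (weight (\<lambda>_. c)) (\<rho> \<sigma> t)"
  shows "representation M E (RG_action M E \<mu> \<rho>)"
  unfolding representation_def
proof (intro conjI ballI allI impI)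
  let ?\<rho> = "RG_action M E \<mu> \<rho>"
  note \<rho>' = \<rho>[unfolded representation_def]
  note hom = \<rho>'[THEN conjunct1]
  note RG = RG_action_pull[OF hom]
  show "hom_section M E ?\<rho>"
    by (rule hom_section_RG_action[OF hom])
  fix \<sigma> assume "\<sigma> \<in> \<Omega>"
  then obtain \<sigma>' where \<sigma>': "\<sigma>' \<in> \<Omega>" "\<sigma> = pull \<sigma>'"
    by (rule pull_cases)
  show "fst (?\<rho> \<sigma> 0) = \<sigma>"
    using \<rho>'[THEN conjunct2, THEN conjunct1, rule_format, OF \<sigma>'(1)] RG[OF \<sigma>'(1) order_refl] \<sigma>'(2)
    by simp
  fix t t' :: real assume t: "t \<ge> 0" and t': "t' \<ge> 0"
  let ?s = "\<mu>\<^sup>2 * t" and ?s' = "\<mu>\<^sup>2 * t'"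
  have s: "?s \<ge> 0" "?s' \<ge> 0" and tt': "t + t' \<ge> 0"
    using t t' by simp_all
  obtain D where D: "twofold \<rho> \<sigma>' ?s ?s' = (fst (\<rho> \<sigma>' (?s + ?s')), snd (\<rho> \<sigma>' (?s + ?s')), snd (\<rho> \<sigma>' (?s + ?s')), D)"
    and deriv: "\<forall>Xs p. ((\<lambda>u. fst (\<rho> \<sigma>' u) Xs p) has_vector_derivative D Xs p) (at (?s + ?s') within {0..})"
    using \<rho>'[THEN conjunct2, THEN conjunct2, rule_format, OF \<sigma>'(1) s] by (elim exE conjE)
  note closed = hom_section_closed[OF hom \<sigma>'(1) s(2)]
  have D': "fst (\<rho> (fst (\<rho> \<sigma>' ?s')) ?s) = fst (\<rho> \<sigma>' (?s + ?s'))"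
    "snd (\<rho> (fst (\<rho> \<sigma>' ?s')) ?s) = snd (\<rho> \<sigma>' (?s + ?s'))"
    "fst (\<rho> (snd (\<rho> \<sigma>' ?s')) ?s) = snd (\<rho> \<sigma>' (?s + ?s'))"
    "- snd (\<rho> (snd (\<rho> \<sigma>' ?s')) ?s) = D"
    using D by (simp_all add: twofold_def)
  define D\<^sub>\<mu> where "D\<^sub>\<mu> = weight (\<lambda>k. \<mu>\<^sup>2 * inverse \<mu> ^ k) D"
  have first: "?\<rho> (fst (?\<rho> \<sigma> t')) t = map_prod pull scaled_pull (\<rho> (fst (\<rho> \<sigma>' ?s')) ?s)"
    by (simp only: \<sigma>'(2) RG[OF \<sigma>'(1) t'] fst_map_prod RG[OF closed(1) t])
  \<comment> \<open>The inner application has already put a factor \<open>\<mu>\<close> on this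
    component; \<open>scale\<close> moves it through the outer one, where the coefficient of
    \<open>\<theta>\<close> adds a second \<open>\<mu>\<close>.\<close>
  have second: "?\<rho> (snd (?\<rho> \<sigma> t')) t = map_prod scaled_pull (weight (\<lambda>k. \<mu>\<^sup>2 * inverse \<mu> ^ k)) (\<rho> (snd (\<rho> \<sigma>' ?s')) ?s)"
  proof -
    let ?x = "snd (\<rho> \<sigma>' ?s')"
    have "?\<rho> (snd (?\<rho> \<sigma> t')) t = ?\<rho> (pull (weight (\<lambda>_. \<mu>) ?x)) t"
      by (simp only: \<sigma>'(2) RG[OF \<sigma>'(1) t'] snd_map_prod scaled_pull_eq(2))
    also have "\<dots> = map_prod pull scaled_pull (map_prod (weight (\<lambda>_. \<mu>)) (weight (\<lambda>_. \<mu>)) (\<rho> ?x ?s))"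
      by (simp only: RG[OF weight_closed[OF closed(2)] t] scale[OF closed(2) s(1)])
    also have "\<dots> = map_prod scaled_pull (weight (\<lambda>k. \<mu>\<^sup>2 * inverse \<mu> ^ k)) (\<rho> ?x ?s)"
      by (intro prod_eqI) (simp_all add: weight_weight power2_eq_square mult.assoc mult.commute)
    finally show ?thesis .
  qed
  have "twofold ?\<rho> \<sigma> t t' = (fst (?\<rho> \<sigma> (t + t')), snd (?\<rho> \<sigma> (t + t')), snd (?\<rho> \<sigma> (t + t')), D\<^sub>\<mu>)"
    unfolding twofold_def first second fst_map_prod snd_map_prod D'(1-3) weight_minus[symmetric] D'(4) D\<^sub>\<mu>_def
    by (simp only: \<sigma>'(2) RG[OF \<sigma>'(1) tt'] fst_map_prod snd_map_prod distrib_left)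
  moreover have "((\<lambda>u. fst (?\<rho> \<sigma> u) Xs p) has_vector_derivative D\<^sub>\<mu> Xs p) (at (t + t') within {0..})" for Xs p
  proof -
    let ?c = "inverse \<mu> ^ length Xs"
    have lin: "((\<lambda>u. \<mu>\<^sup>2 * u) has_vector_derivative \<mu>\<^sup>2) (at (t + t') within {0..})"
      using bounded_linear.has_vector_derivative[OF bounded_linear_mult_right[of "\<mu>\<^sup>2"] has_vector_derivative_id]
      by simp
    have "((\<lambda>u. fst (\<rho> \<sigma>' u) Xs p) has_vector_derivative D Xs p) (at (\<mu>\<^sup>2 * (t + t')) within {0..})"
      using deriv by (simp add: distrib_left)
    \<comment> \<open>The chain rule asks for the derivative within the image of the half line under
      multiplication by \<open>\<mu>^2\<close>, which lies in the half line.\<close>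
    then have "((\<lambda>u. fst (\<rho> \<sigma>' u) Xs p) has_vector_derivative D Xs p)
        (at (\<mu>\<^sup>2 * (t + t')) within (\<lambda>u. \<mu>\<^sup>2 * u) ` {0..})"
      by (rule has_vector_derivative_within_subset) auto
    from vector_diff_chain_within[OF lin this]
    have "((\<lambda>u. fst (\<rho> \<sigma>' (\<mu>\<^sup>2 * u)) Xs p) has_vector_derivative \<mu>\<^sup>2 *\<^sub>R D Xs p) (at (t + t') within {0..})"
      by (simp only: o_def)
    from bounded_linear.has_vector_derivative[OF bounded_linear_scaleR_right this, of ?c]
    have d: "((\<lambda>u. ?c *\<^sub>R fst (\<rho> \<sigma>' (\<mu>\<^sup>2 * u)) Xs p) has_vector_derivative D\<^sub>\<mu> Xs p) (at (t + t') within {0..})"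
      by (simp add: D\<^sub>\<mu>_def weight_def mult.commute)
    \<comment> \<open>The formula for the action is available for \<open>u \<ge> 0\<close>, which
      suffices for a derivative within the half line.\<close>
    have eq: "fst (?\<rho> \<sigma> u) Xs p = ?c *\<^sub>R fst (\<rho> \<sigma>' (\<mu>\<^sup>2 * u)) Xs p" if "u \<in> {0..}" for u
      using that by (simp only: \<sigma>'(2) RG[OF \<sigma>'(1)] atLeast_iff fst_map_prod weight_def[of _ "fst (\<rho> \<sigma>' (\<mu>\<^sup>2 * u))"])
    show ?thesis
      by (rule has_vector_derivative_transform[OF _ eq d]) (simp only: atLeast_iff tt')
  qed
  ultimately show "\<exists>D. twofold ?\<rho> \<sigma> t t' = (fst (?\<rho> \<sigma> (t + t')), snd (?\<rho> \<sigma> (t + t')), snd (?\<rho> \<sigma> (t + t')), D) \<and>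
      (\<forall>Xs p. ((\<lambda>u. fst (?\<rho> \<sigma> u) Xs p) has_vector_derivative D Xs p) (at (t + t') within {0..}))"
    by (intro exI[of _ D\<^sub>\<mu>] conjI allI)
qed

text \<open>Both sides of the first equation become a \<open>pull\<close>. In the second equation
  each term contains exactly one exterior derivative or one coefficient of \<open>\<theta>\<close>,
  hence becomes a \<open>scaled_pull\<close>.\<close>

lemma unitary_rep_RG_action:
  assumes hom: "hom_section M E \<rho>" and \<rho>: "unitary_rep M E \<rho>"
  shows "unitary_rep M E (RG_action M E \<mu> \<rho>)"
  unfolding unitary_rep_def
proof (intro ballI allI impI)
  let ?\<rho> = "RG_action M E \<mu> \<rho>"
  note RG = RG_action_pull[OF hom]
  fix \<sigma> \<tau> and t :: real assume \<sigma>: "\<sigma> \<in> \<Omega>" and \<tau>: "\<tau> \<in> \<Omega>" and t: "t \<ge> 0"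
  obtain \<sigma>' where \<sigma>': "\<sigma>' \<in> \<Omega>" "\<sigma> = pull \<sigma>'"
    using \<sigma> by (rule pull_cases)
  obtain \<tau>' where \<tau>': "\<tau>' \<in> \<Omega>" "\<tau> = pull \<tau>'"
    using \<tau> by (rule pull_cases)
  let ?s = "\<mu>\<^sup>2 * t"
  have s: "?s \<ge> 0"
    using t by simp
  note \<sigma>_closed = hom_section_closed[OF hom \<sigma>'(1) s] and \<tau>_closed = hom_section_closed[OF hom \<tau>'(1) s]
  note u = \<rho>[unfolded unitary_rep_def, rule_format, OF \<sigma>'(1) \<tau>'(1) s]
  have P1: "form_pairing E (fst (?\<rho> \<sigma> t)) \<tau> = pull (form_pairing E (fst (\<rho> \<sigma>' ?s)) \<tau>')"
    by (simp only: \<sigma>'(2) \<tau>'(2) RG[OF \<sigma>'(1) t] fst_map_prod pairing_pull(1)[OF \<sigma>_closed(1) \<tau>'(1)])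
  have P2: "form_pairing E \<sigma> (fst (?\<rho> \<tau> t)) = pull (form_pairing E \<sigma>' (fst (\<rho> \<tau>' ?s)))"
    by (simp only: \<sigma>'(2) \<tau>'(2) RG[OF \<tau>'(1) t] fst_map_prod pairing_pull(1)[OF \<sigma>'(1) \<tau>_closed(1)])
  have P3: "form_pairing E (total_parity E (snd (?\<rho> \<sigma> t))) \<tau>
      = scaled_pull (form_pairing E (total_parity E (snd (\<rho> \<sigma>' ?s))) \<tau>')"
    by (simp only: \<sigma>'(2) \<tau>'(2) RG[OF \<sigma>'(1) t] snd_map_prod total_parity_weight_E[OF \<sigma>_closed(2)]
        pairing_pull(2)[OF total_parity_closed[OF \<sigma>_closed(2)] \<tau>'(1)])
  have P4: "form_pairing E (total_parity E \<sigma>) (snd (?\<rho> \<tau> t))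
      = scaled_pull (form_pairing E (total_parity E \<sigma>') (snd (\<rho> \<tau>' ?s)))"
    by (simp only: \<sigma>'(2) \<tau>'(2) RG[OF \<tau>'(1) t] snd_map_prod total_parity_weight_E[OF \<sigma>'(1)]
        pairing_pull(3)[OF total_parity_closed[OF \<sigma>'(1)] \<tau>_closed(2)])
  show "form_pairing E (fst (?\<rho> \<sigma> t)) \<tau> = form_pairing E \<sigma> (fst (?\<rho> \<tau> t)) \<and>
      ext_deriv M (form_pairing E (fst (?\<rho> \<sigma> t)) \<tau>) - form_pairing E (total_parity E (snd (?\<rho> \<sigma> t))) \<tau>
        = form_pairing E (total_parity E \<sigma>) (snd (?\<rho> \<tau> t))"
  proof
    show "form_pairing E (fst (?\<rho> \<sigma> t)) \<tau> = form_pairing E \<sigma> (fst (?\<rho> \<tau> t))"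
      by (simp only: P1 P2 u[THEN conjunct1])
    show "ext_deriv M (form_pairing E (fst (?\<rho> \<sigma> t)) \<tau>) - form_pairing E (total_parity E (snd (?\<rho> \<sigma> t))) \<tau>
        = form_pairing E (total_parity E \<sigma>) (snd (?\<rho> \<tau> t))"
      unfolding P1 P3 P4 ext_deriv_pull u[THEN conjunct2, symmetric] weight_diff ..
  qed
qed

lemma cl_representation_RG_action:
  assumes \<rho>: "cl_representation M n E \<rho>"
    and scale: "\<And>\<sigma> t c. \<sigma> \<in> \<Omega> \<Longrightarrow> t \<ge> 0 \<Longrightarrow>
      \<rho> (weight (\<lambda>_. c) \<sigma>) t = map_prod (weight (\<lambda>_. c)) (weight (\<lambda>_. c)) (\<rho> \<sigma> t)"
  shows "cl_representation M n E (RG_action M E \<mu> \<rho>)"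
  unfolding cl_representation_def
proof (intro conjI allI impI ballI)
  let ?\<rho> = "RG_action M E \<mu> \<rho>"
  note \<rho>' = \<rho>[unfolded cl_representation_def]
  note rep = \<rho>'[THEN conjunct1] and unitary = \<rho>'[THEN conjunct2, THEN conjunct1]
  note hom = rep[unfolded representation_def, THEN conjunct1]
  show "representation M E ?\<rho>"
    by (rule representation_RG_action[OF rep scale])
  show "unitary_rep M E ?\<rho>"
    by (rule unitary_rep_RG_action[OF hom unitary])
  fix i \<sigma> and t :: real assume i: "i < n" and \<sigma>: "\<sigma> \<in> \<Omega>" and t: "t \<ge> 0"
  obtain \<sigma>' where \<sigma>': "\<sigma>' \<in> \<Omega>" "\<sigma> = pull \<sigma>'"
    using \<sigma> by (rule pull_cases)
  let ?s = "\<mu>\<^sup>2 * t"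
  have s: "?s \<ge> 0"
    using t by simp
  note closed = hom_section_closed[OF hom \<sigma>'(1) s]
  note C = hermitian_cliff[OF E i]
  note cliff_weight = cliff_act_weight[OF vector_bundle_E C in_fib]
  have "?\<rho> (cliff_act E i \<sigma>) t = map_prod pull scaled_pull (\<rho> (cliff_act E i \<sigma>') ?s)"
    by (simp only: \<sigma>'(2) cliff_weight[OF \<sigma>'(1)]
        RG_action_pull[OF hom bundle_forms_cliff_act[OF M vector_bundle_E C \<sigma>'(1)] t])
  also have "\<dots> = map_prod pull scaled_pull (odd_extension (cliff_act E i) (\<rho> \<sigma>' ?s))"
    by (simp only: \<rho>'[THEN conjunct2, THEN conjunct2, rule_format, OF i \<sigma>'(1) s])
  also have "\<dots> = odd_extension (cliff_act E i) (map_prod pull scaled_pull (\<rho> \<sigma>' ?s))"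
    by (rule odd_extension_map_prod[symmetric])
      (simp_all only: cliff_weight[OF closed(1)] cliff_weight[OF closed(2)] weight_minus)
  also have "\<dots> = odd_extension (cliff_act E i) (?\<rho> \<sigma> t)"
    by (simp only: \<sigma>'(2) RG_action_pull[OF hom \<sigma>'(1) t])
  finally show "?\<rho> (cliff_act E i \<sigma>) t = odd_extension (cliff_act E i) (?\<rho> \<sigma> t)" .
qed

text \<open>The case \<open>c = \<mu>\<close> of the intertwining of exponentials: the series of the
  rescaled operator at \<open>t\<close> is the image of the series of \<open>A\<close> at
  \<open>\<mu>^2 t\<close> under the maps by which \<open>RG_action\<close> acts.\<close>

lemma associated_rep_RG_action:
  assumes hom: "hom_section M E \<rho>" and A: "super_connection M E A" and \<rho>: "associated_rep M E A \<rho>"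
  shows "associated_rep M E (bismut_quillen_rescaling \<mu> A) (RG_action M E \<mu> \<rho>)"
  unfolding associated_rep_def
proof (intro ballI allI impI)
  fix \<sigma> and t :: real and Xs p assume \<sigma>: "\<sigma> \<in> \<Omega>" and t: "t \<ge> 0"
  obtain \<sigma>' where \<sigma>': "\<sigma>' \<in> \<Omega>" "\<sigma> = pull \<sigma>'"
    using \<sigma> by (rule pull_cases)
  let ?B = "bismut_quillen_rescaling \<mu> A"
  note sums = associated_rep_conjugate_sums[OF M A super_connection_rescaling[OF A] rescaling_pull[OF A] \<rho> \<sigma>'(1) t,
      of Xs p]
  show "(\<lambda>k. (1 / fact k) *\<^sub>R fst ((exponent ?B t ^^ k) (\<sigma>, 0)) Xs p) sums fst (RG_action M E \<mu> \<rho> \<sigma> t) Xs p \<and>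
      (\<lambda>k. (1 / fact k) *\<^sub>R snd ((exponent ?B t ^^ k) (\<sigma>, 0)) Xs p) sums snd (RG_action M E \<mu> \<rho> \<sigma> t) Xs p"
    unfolding \<sigma>'(2) RG_action_pull[OF hom \<sigma>'(1) t] fst_map_prod snd_map_prod by (intro conjI sums)
qed

end

theorem lemma4p4:
  fixes M :: "('m::{t2_space,second_countable_topology}) manifold"
    and E :: "('m, 'k::finite) cl_bundle"
    and n :: nat
    and \<mu> :: real
    and A :: "('m, 'k) form_op"
    and \<rho> :: "('m, 'k) path_op"
  assumes "smooth_manifold M" and "oriented_atlas M" and "compact (UNIV :: 'm set)"
    and "\<mu> > 0"
    and "hermitian_cl_bundle M n E"
    and "unitary_cl_super_connection M n E A"
    and "cl_representation M n E \<rho>"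
    and "associated_rep M E A \<rho>"
  shows "unitary_cl_super_connection M n E (bismut_quillen_rescaling \<mu> A) \<and>
    cl_representation M n E (RG_action M E \<mu> \<rho>) \<and>
    associated_rep M E (bismut_quillen_rescaling \<mu> A) (RG_action M E \<mu> \<rho>)"
proof -
  interpret renormalization M E n \<mu>
    using assms(1,4,5) by unfold_locales
  have A: "super_connection M E A"
    using assms(6) unfolding unitary_cl_super_connection_def unitary_super_connection_def by simp
  have hom: "hom_section M E \<rho>"
    using assms(7) unfolding cl_representation_def representation_def by simp
  show ?thesis
    by (intro conjI unitary_cl_super_connection_rescaling[OF assms(6)] associated_rep_RG_action[OF hom A assms(8)]
        cl_representation_RG_action[OF assms(7) associated_rep_scale[OF assms(1) A assms(8)]])
qed

end
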